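(* Let $\mathcal{B}$ be a reflexive separable Banach space or a Hilbert space and let $t>0$. Suppose that $\mathrm{C}$ and $\mathrm{D}$ are generators of $C_0$-semigroups $\exp(s\mathrm{C})$ and $\exp(s\mathrm{D})$ in $\mathcal{B}$. Assume that: (i) $\mathcal{D}(\mathrm{C})\cap\mathcal{D}(\mathrm{D})$ is dense in $\mathcal{B}$. (ii) $\mathcal{D}(\mathrm{C}^* )\cap\mathcal{D}(\mathrm{D}^* )$ is dense in $\mathcal{B}^*$. (iii) There exist $a\in\mathbb{R}$, $M\ge 1$ such that $\|\{\exp(\frac{s}{n}\mathrm{C})\exp(\frac{s}{n}\mathrm{D})\}^m\|\le M\exp(as\frac{m}{n})$ for all $n,m\in\mathbb{N}$, $s>0$. Then the sum $\mathrm{C}+\mathrm{D}$ is a closable operator and its closure is a generator of a $C_0$-semigroup if and only if there exists a dense linear subspace $\mathbf{A}\subseteq\mathcal{D}(\mathrm{C})\cap\mathcal{D}(\mathrm{D})$ (dense in $\mathcal{B}$) such that for any $f\in\mathbf{A}$, $s\ge 0$ there exists a sequence $\{f_n\}_{n=1}^\infty$, $f_n\in\mathcal{D}(\mathrm{C})\cap\mathcal{D}(\mathrm{D})$, satisfying the following conditions: (a) $\lim_{n\to\infty}\|(\exp(\frac{t}{n}\mathrm{C})\exp(\frac{t}{n}\mathrm{D}))^{[ns]}f-f_n\|=0$; (b) $\{(\mathrm{C}+\mathrm{D})f_n\}_{n=1}^\infty$ is a bounded sequence. Furthermore, if conditions (a)–(b) are satisfied (for such $\mathbf{A}$ and sequences),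 then $$\exp(s(\overline{\mathrm{C}+\mathrm{D}}))f=\lim_{n\to\infty}\{\exp(\tfrac{s}{n}\mathrm{C})\exp(\tfrac{s}{n}\mathrm{D})\}^n f,\qquad s>0,$$ for all $f\in\mathcal{B}$.
   Context: The sum $\mathrm{C}+\mathrm{D}$ has domain $\mathcal{D}(\mathrm{C})\cap\mathcal{D}(\mathrm{D})$. $\mathrm{C}^*,\mathrm{D}^*$ are the adjoint operators in the dual space $\mathcal{B}^*$. $[x]$ is the integer part of $x$. *)

theory Defs
  imports "HOL-Analysis.Analysis"
begin

text \<open>
  The scalars are a type \<open>'k\<close> of sort \<open>{real_normed_field, euclidean_space}\<close>: a finite-dimensional
  real normed field with multiplicative norm, which is \<open>real\<close> or \<open>complex\<close> up to isometric
  isomorphism. So real and complex Banach spaces are treated at once. A Banach space over \<open>'k\<close> is a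
  type of class \<open>banach\<close> with a \<open>'k\<close>-scalar multiplication extending that of the reals and
  compatible with the norm.
\<close>

locale normed_space_over = vector_space scl
  for scl :: "'k::{real_normed_field,euclidean_space} \<Rightarrow> 'a::real_normed_vector \<Rightarrow> 'a" +
  assumes scl_of_real: "scl (of_real r) x = r *\<^sub>R x"
    and norm_scl: "norm (scl c x) = norm c * norm x"

lemma normed_space_over_scaleR:
  "normed_space_over ((*\<^sub>R) :: real \<Rightarrow> 'a::real_normed_vector \<Rightarrow> 'a)"
  by unfold_locales (simp_all add: algebra_simps)

lemma normed_space_over_complex: "normed_space_over ((*) :: complex \<Rightarrow> complex \<Rightarrow> complex)"
  by unfold_locales (simp_all add: algebra_simps scaleR_conv_of_real norm_mult)


subsection \<open>Duality, reflexivity and Hilbert spaces\<close>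

definition dual_space ::
    "('k::{real_normed_field,euclidean_space} \<Rightarrow> 'a::real_normed_vector \<Rightarrow> 'a) \<Rightarrow> ('a \<Rightarrow>\<^sub>L 'k) set" where
  "dual_space scl = {\<phi>. Vector_Spaces.linear scl (*) (blinfun_apply \<phi>)}"

definition dual_scale ::
    "'k::{real_normed_field,euclidean_space} \<Rightarrow> ('a::real_normed_vector \<Rightarrow>\<^sub>L 'k) \<Rightarrow> ('a \<Rightarrow>\<^sub>L 'k)" where
  "dual_scale c \<phi> = Blinfun (\<lambda>x. c * blinfun_apply \<phi> x)"

text \<open>The dual is a subset of a type, so functionals on it are constrained only on that subset.\<close>

definition bidual ::
    "('k::{real_normed_field,euclidean_space} \<Rightarrow> 'a::real_normed_vector \<Rightarrow> 'a)
      \<Rightarrow> (('a \<Rightarrow>\<^sub>L 'k) \<Rightarrow> 'k) set" where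
  "bidual scl = {\<Psi>.
     (\<forall>\<phi>\<in>dual_space scl. \<forall>\<psi>\<in>dual_space scl. \<Psi> (\<phi> + \<psi>) = \<Psi> \<phi> + \<Psi> \<psi>) \<and>
     (\<forall>c. \<forall>\<phi>\<in>dual_space scl. \<Psi> (dual_scale c \<phi>) = c * \<Psi> \<phi>) \<and>
     (\<exists>K. \<forall>\<phi>\<in>dual_space scl. norm (\<Psi> \<phi>) \<le> K * norm \<phi>)}"

definition reflexive_space ::
    "('k::{real_normed_field,euclidean_space} \<Rightarrow> 'a::real_normed_vector \<Rightarrow> 'a) \<Rightarrow> bool" where
  "reflexive_space scl \<longleftrightarrow>
     (\<forall>\<Psi>\<in>bidual scl. \<exists>x. \<forall>\<phi>\<in>dual_space scl. \<Psi> \<phi> = blinfun_apply \<phi> x)"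

text \<open>Conjugation is the reflection of \<open>'k\<close> in the line \<open>\<real>1\<close>; the inner product of \<open>'k\<close> is the
  real one.\<close>

definition scalar_cnj :: "'k::{real_normed_field,euclidean_space} \<Rightarrow> 'k" where
  "scalar_cnj c = of_real (2 * (c \<bullet> 1)) - c"

lemma scalar_cnj_real: "scalar_cnj (c::real) = c"
  by (simp add: scalar_cnj_def)

lemma scalar_cnj_complex: "scalar_cnj c = cnj c"
  by (simp add: scalar_cnj_def complex_eq_iff inner_complex_def)

text \<open>Positive definiteness is part of the last conjunct; completeness comes from class \<open>banach\<close>.\<close>

definition hilbert_space ::
    "('k::{real_normed_field,euclidean_space} \<Rightarrow> 'a::banach \<Rightarrow> 'a) \<Rightarrow> bool" where
  "hilbert_space scl \<longleftrightarrow> (\<exists>ip :: 'a \<Rightarrow> 'a \<Rightarrow> 'k.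
     (\<forall>x y z. ip (x + y) z = ip x z + ip y z) \<and>
     (\<forall>c x y. ip (scl c x) y = c * ip x y) \<and>
     (\<forall>x y. ip y x = scalar_cnj (ip x y)) \<and>
     (\<forall>x. ip x x = of_real ((norm x)\<^sup>2)))"


subsection \<open>Unbounded operators\<close>

text \<open>
  An operator is identified with its graph, a set of pairs; its domain is \<^const>\<open>Domain\<close> of the graph,
  and its closure, when it is closable, is the topological closure of the graph.
\<close>

definition op_apply :: "('a \<times> 'b) set \<Rightarrow> 'a \<Rightarrow> 'b" where
  "op_apply G x = (THE y. (x, y) \<in> G)"

definition op_sum :: "('a \<times> 'b::plus) set \<Rightarrow> ('a \<times> 'b) set \<Rightarrow> ('a \<times> 'b) set" where
  "op_sum G H = {(x, y + z) | x y z. (x, y) \<in> G \<and> (x, z) \<in> H}"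

lemma Domain_op_sum: "Domain (op_sum G H) = Domain G \<inter> Domain H"
  unfolding op_sum_def by blast

definition closable :: "('a::topological_space \<times> 'b::topological_space) set \<Rightarrow> bool" where
  "closable G \<longleftrightarrow> single_valued (closure G)"

definition adjoint_op ::
    "('k::{real_normed_field,euclidean_space} \<Rightarrow> 'a::real_normed_vector \<Rightarrow> 'a) \<Rightarrow> ('a \<times> 'a) set
      \<Rightarrow> (('a \<Rightarrow>\<^sub>L 'k) \<times> ('a \<Rightarrow>\<^sub>L 'k)) set" where
  "adjoint_op scl G = {(\<phi>, \<psi>). \<phi> \<in> dual_space scl \<and> \<psi> \<in> dual_space scl \<and>
     (\<forall>(x, y)\<in>G. blinfun_apply \<phi> y = blinfun_apply \<psi> x)}"


subsection \<open>Semigroups and generators\<close>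

text \<open>Semigroups are indexed by \<open>real\<close>; their values at negative times are irrelevant.\<close>

definition c0_semigroup ::
    "('k::{real_normed_field,euclidean_space} \<Rightarrow> 'a::real_normed_vector \<Rightarrow> 'a)
      \<Rightarrow> (real \<Rightarrow> 'a \<Rightarrow> 'a) \<Rightarrow> bool" where
  "c0_semigroup scl T \<longleftrightarrow>
     (\<forall>s\<ge>0. bounded_linear (T s) \<and> Vector_Spaces.linear scl scl (T s)) \<and>
     T 0 = id \<and>
     (\<forall>r\<ge>0. \<forall>s\<ge>0. T (r + s) = T r \<circ> T s) \<and>
     (\<forall>x. continuous_on {0..} (\<lambda>s. T s x))"

definition generator :: "(real \<Rightarrow> 'a::real_normed_vector \<Rightarrow> 'a) \<Rightarrow> ('a \<times> 'a) set" where
  "generator T = {(x, y). ((\<lambda>h. (T h x - x) /\<^sub>R h) \<longlongrightarrow> y) (at_right 0)}"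

definition is_generator ::
    "('k::{real_normed_field,euclidean_space} \<Rightarrow> 'a::real_normed_vector \<Rightarrow> 'a)
      \<Rightarrow> ('a \<times> 'a) set \<Rightarrow> bool" where
  "is_generator scl G \<longleftrightarrow> (\<exists>T. c0_semigroup scl T \<and> generator T = G)"

text \<open>\<open>exp (s G)\<close>, for a generator \<open>G\<close> and \<open>s \<ge> 0\<close>; a generator determines its semigroup at
  nonnegative times, so there the choice is immaterial.\<close>

definition semigroup_exp ::
    "('k::{real_normed_field,euclidean_space} \<Rightarrow> 'a::real_normed_vector \<Rightarrow> 'a)
      \<Rightarrow> ('a \<times> 'a) set \<Rightarrow> real \<Rightarrow> 'a \<Rightarrow> 'a" where
  "semigroup_exp scl G = (SOME T. c0_semigroup scl T \<and> generator T = G)"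

definition trotter_step ::
    "('k::{real_normed_field,euclidean_space} \<Rightarrow> 'a::real_normed_vector \<Rightarrow> 'a)
      \<Rightarrow> ('a \<times> 'a) set \<Rightarrow> ('a \<times> 'a) set \<Rightarrow> real \<Rightarrow> 'a \<Rightarrow> 'a" where
  "trotter_step scl C D r = semigroup_exp scl C r \<circ> semigroup_exp scl D r"

definition approximation_condition ::
    "('k::{real_normed_field,euclidean_space} \<Rightarrow> 'a::real_normed_vector \<Rightarrow> 'a)
      \<Rightarrow> ('a \<times> 'a) set \<Rightarrow> ('a \<times> 'a) set \<Rightarrow> real \<Rightarrow> 'a set \<Rightarrow> bool" where
  "approximation_condition scl C D t A \<longleftrightarrow>
     module.subspace scl A \<and> closure A = UNIV \<and> A \<subseteq> Domain C \<inter> Domain D \<and>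
     (\<forall>f\<in>A. \<forall>s\<ge>0. \<exists>F :: nat \<Rightarrow> 'a.
        (\<forall>n\<ge>1. F n \<in> Domain C \<inter> Domain D) \<and>
        (\<lambda>n. norm ((trotter_step scl C D (t / real n) ^^ nat \<lfloor>real n * s\<rfloor>) f - F n))
          \<longlonglongrightarrow> 0 \<and>
        bounded ((\<lambda>n. op_apply (op_sum C D) (F n)) ` {1..}))"

end

theory Submission
  imports Defs
begin

text \<open>
  Write \<open>V r = exp (r C) exp (r D)\<close> and \<open>L = C + D\<close>; condition (iii) bounds the powers of \<open>V r\<close>.

  Chernoff's argument: if the range of \<open>\<mu> - L\<close> is dense for all large \<open>\<mu>\<close>, then the resolvents
  \<open>J h = (1 - h cl L)\<^sup>-\<^sup>1\<close> exist and have stable powers. For \<open>x\<close> in the domain of \<open>(cl L)\<^sup>2\<close> both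
  \<open>V r ^ m x\<close> with \<open>r m = h\<close>, \<open>r \<rightarrow> 0\<close>, and \<open>J h x\<close> agree with \<open>x + h cl L x\<close> up to \<open>O(h\<^sup>2)\<close>. Telescoping over
  \<open>k = \<sigma> / h\<close> steps shows that \<open>V r ^ n x\<close> with \<open>r n \<rightarrow> \<sigma>\<close> is eventually within \<open>O(1 / k)\<close> of
  \<open>J h ^ k x\<close>, so it converges; the limits form a semigroup with generator \<open>cl L\<close>. The same estimate
  with \<open>T h\<close> in place of \<open>J h\<close> identifies the limit with any semigroup \<open>T\<close> generated by \<open>cl L\<close>, which gives
  the product formula and, taking for \<open>A\<close> the domain of \<open>L\<close>, the necessity of (a) and (b).

  For the sufficiency, a functional \<open>\<psi>\<close> annihilating the range of \<open>\<mu> - L\<close> satisfies \<open>\<psi> \<circ> L = \<mu> \<psi>\<close>. By (a) and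
  (b) it behaves on the orbits of \<open>A\<close> like a limit of functionals in the domains of both adjoints, on which
  the difference quotients of \<open>V r\<close> converge in norm by (ii). So \<open>\<psi>\<close> would grow like \<open>exp (\<mu> s)\<close> along
  these orbits, against the stability bound; hence \<open>\<psi>\<close> vanishes on \<open>A\<close>, and \<open>\<psi> = 0\<close>.
\<close>


subsection \<open>Separation by continuous functionals\<close>

text \<open>No generation theorem is presupposed: the semigroup is built as the limit of the powers
  of \<open>V r\<close>, and its generator is identified afterwards. The comparison succeeds because
  stability carries each of the \<open>k\<close> local errors, of order \<open>h\<^sup>2\<close>
  with \<open>k * h = \<sigma>\<close>, through a single bounded power. The same must be secured for
  the resolvents, where naive iteration of their bound would produce \<open>M ^ k\<close>. In the
  sufficiency part the obstacle is that (b) bounds \<open>L\<close> along the approximating sequence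
  for each \<open>s\<close> separately, with no uniformity in \<open>s\<close>. What is uniform on
  bounded time intervals is the bound on the exact orbit and its difference quotients; so the defect
  is summed along the orbit with discrete exponential weights, and dominated convergence replaces
  the missing uniformity. The role of (ii): a dual semigroup is in general continuous in norm only
  on the closure of the adjoint domain, and the product needs this continuity for a functional
  produced by \<open>C\<close> along the dual semigroup of \<open>D\<close>.\<close>

definition sublinear :: "('a::real_vector \<Rightarrow> real) \<Rightarrow> bool" where
  "sublinear p \<longleftrightarrow> (\<forall>x y. p (x + y) \<le> p x + p y) \<and> (\<forall>c\<ge>0. \<forall>x. p (c *\<^sub>R x) = c * p x)"

lemma sublinear_zero:
  assumes "sublinear p"
  shows "p 0 = 0"
proof -
  have "p (0 *\<^sub>R 0) = 0 * p 0" using assms unfolding sublinear_def by blast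
  then show ?thesis by simp
qed

lemma sublinear_minus:
  assumes "sublinear p"
  shows "- p (- x) \<le> p x"
proof -
  have "p (x + - x) \<le> p x + p (- x)" using assms unfolding sublinear_def by blast
  then show ?thesis using sublinear_zero[OF assms] by simp
qed

text \<open>Provides lower bounds of chains for Zorn's lemma. Subadditivity passes to the infimum
  because directedness supplies one \<open>u\<close> below both \<open>q\<close> and
  \<open>q'\<close>, which gives the mixed bound \<open>q x + q' y\<close>.\<close>

lemma sublinear_infimum:
  assumes "Q \<noteq> {}" and sub: "\<And>q. q \<in> Q \<Longrightarrow> sublinear q"
    and directed: "\<And>q q'. q \<in> Q \<Longrightarrow> q' \<in> Q \<Longrightarrow> \<exists>u\<in>Q. u \<le> q \<and> u \<le> q'"
    and bdd: "\<And>x. bdd_below ((\<lambda>q. q x) ` Q)"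
  shows "sublinear (\<lambda>x. INF q\<in>Q. q x)"
  unfolding sublinear_def
proof (intro conjI allI impI)
  fix x y
  have "(INF q\<in>Q. q (x + y)) \<le> q x + q' y" if "q \<in> Q" "q' \<in> Q" for q q'
  proof -
    obtain u where u: "u \<in> Q" "u \<le> q" "u \<le> q'" using directed \<open>q \<in> Q\<close> \<open>q' \<in> Q\<close> by blast
    have "(INF q\<in>Q. q (x + y)) \<le> u (x + y)" using bdd u(1) by (rule cINF_lower)
    also have "\<dots> \<le> u x + u y" using sub[OF u(1)] by (auto simp: sublinear_def)
    also have "\<dots> \<le> q x + q' y" using u(2,3) by (auto simp: le_fun_def intro: add_mono)
    finally show ?thesis .
  qed
  then have "(INF q\<in>Q. q (x + y)) - q' y \<le> (INF q\<in>Q. q x)" if "q' \<in> Q" for q'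
    using \<open>Q \<noteq> {}\<close> that by (intro cINF_greatest) (auto simp: algebra_simps)
  then have "(INF q\<in>Q. q (x + y)) - (INF q\<in>Q. q x) \<le> (INF q\<in>Q. q y)"
    using \<open>Q \<noteq> {}\<close> by (intro cINF_greatest) (auto simp: algebra_simps)
  then show "(INF q\<in>Q. q (x + y)) \<le> (INF q\<in>Q. q x) + (INF q\<in>Q. q y)" by simp
next
  fix c :: real and x assume "c \<ge> 0"
  have le: "d * (INF q\<in>Q. q z) \<le> (INF q\<in>Q. q (d *\<^sub>R z))" if "d \<ge> 0" for d z
  proof (rule cINF_greatest[OF \<open>Q \<noteq> {}\<close>])
    fix q assume "q \<in> Q"
    then have "q (d *\<^sub>R z) = d * q z" using sub that by (auto simp: sublinear_def)
    moreover have "(INF q\<in>Q. q z) \<le> q z" using bdd \<open>q \<in> Q\<close> by (rule cINF_lower)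
    ultimately show "d * (INF q\<in>Q. q z) \<le> q (d *\<^sub>R z)" using that by (simp add: mult_left_mono)
  qed
  show "(INF q\<in>Q. q (c *\<^sub>R x)) = c * (INF q\<in>Q. q x)"
  proof (cases "c = 0")
    case True
    have "(\<lambda>q. q 0) ` Q = {0}" using sublinear_zero sub \<open>Q \<noteq> {}\<close> by fastforce
    then show ?thesis using True by simp
  next
    case False
    then have "c > 0" using \<open>c \<ge> 0\<close> by simp
    have "inverse c * (INF q\<in>Q. q (c *\<^sub>R x)) \<le> (INF q\<in>Q. q x)"
      using le[of "inverse c" "c *\<^sub>R x"] \<open>c > 0\<close> by simp
    then have "(INF q\<in>Q. q (c *\<^sub>R x)) \<le> c * (INF q\<in>Q. q x)"
      using \<open>c > 0\<close> by (simp add: field_simps)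
    then show ?thesis using le[OF \<open>c \<ge> 0\<close>, of x] by simp
  qed
qed

text \<open>Lowers \<open>p\<close> towards \<open>- p y\<close> at \<open>- y\<close>. For a
  minimal \<open>p\<close> this changes nothing, so \<open>p (- y) \<le> - p y\<close> and
  \<open>p\<close> is odd; this is how minimality becomes linearity.\<close>

lemma sublinear_directional:
  fixes p :: "'a::real_vector \<Rightarrow> real" and y :: 'a
  assumes p: "sublinear p"
  defines "q \<equiv> \<lambda>x. INF t\<in>{0..}. p (x + t *\<^sub>R y) - t * p y"
  shows "sublinear q" "q \<le> p" "q (- y) \<le> - p y"
proof -
  have lb: "- p (- x) \<le> p (x + t *\<^sub>R y) - t * p y" if "t \<ge> 0" for x t
  proof -
    have "p (t *\<^sub>R y) \<le> p (x + t *\<^sub>R y) + p (- x)"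
      using p[unfolded sublinear_def, THEN conjunct1, rule_format, of "x + t *\<^sub>R y" "- x"] by simp
    then show ?thesis using p that by (simp add: sublinear_def)
  qed
  have bdd: "bdd_below ((\<lambda>t. p (x + t *\<^sub>R y) - t * p y) ` {0..})" for x
    by (rule bdd_belowI[of _ "- p (- x)"]) (use lb in auto)
  have le: "q x \<le> p (x + t *\<^sub>R y) - t * p y" if "t \<ge> 0" for x t
    unfolding q_def by (rule cINF_lower[OF bdd]) (use that in auto)
  show "q \<le> p" using le[of 0] by (auto simp: le_fun_def)
  show "q (- y) \<le> - p y" using le[of 1 "- y"] sublinear_zero[OF p] by simp
  have add: "q (x + z) \<le> q x + q z" for x z
  proof -
    have "q (x + z) - (p (z + t *\<^sub>R y) - t * p y) \<le> q x" if "t \<ge> 0" for t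
      unfolding q_def
    proof (rule cINF_greatest)
      fix s :: real assume "s \<in> {0..}"
      then have "s \<ge> 0" by simp
      have "q (x + z) \<le> p ((x + s *\<^sub>R y) + (z + t *\<^sub>R y)) - (s + t) * p y"
        using le[of "s + t" "x + z"] \<open>s \<ge> 0\<close> \<open>t \<ge> 0\<close> by (simp add: algebra_simps)
      also have "\<dots> \<le> p (x + s *\<^sub>R y) + p (z + t *\<^sub>R y) - (s + t) * p y"
        using p by (simp add: sublinear_def)
      finally show "(INF t\<in>{0..}. p (x + z + t *\<^sub>R y) - t * p y) - (p (z + t *\<^sub>R y) - t * p y)
          \<le> p (x + s *\<^sub>R y) - s * p y"
        unfolding q_def by (simp add: algebra_simps)
    qed simp
    then have "q (x + z) - q x \<le> q z"
      unfolding q_def by (intro cINF_greatest) (auto simp: algebra_simps)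
    then show ?thesis by simp
  qed
  have scal: "c * q x \<le> q (c *\<^sub>R x)" if "c > 0" for c x
    unfolding q_def
  proof (rule cINF_greatest)
    fix t :: real assume "t \<in> {0..}"
    then have "c * q x \<le> c * (p (x + (t / c) *\<^sub>R y) - (t / c) * p y)"
      using le[of "t / c" x] that by simp
    also have "\<dots> = p (c *\<^sub>R (x + (t / c) *\<^sub>R y)) - t * p y"
      using p that by (simp add: sublinear_def right_diff_distrib)
    also have "\<dots> = p (c *\<^sub>R x + t *\<^sub>R y) - t * p y"
      using that by (simp add: scaleR_add_right)
    finally show "c * (INF t\<in>{0..}. p (x + t *\<^sub>R y) - t * p y) \<le> p (c *\<^sub>R x + t *\<^sub>R y) - t * p y"
      unfolding q_def .
  qed simp
  have q0: "q 0 = 0"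
  proof -
    have "(\<lambda>t. p (0 + t *\<^sub>R y) - t * p y) ` {0..} = {0}"
      using p by (auto simp: sublinear_def image_iff intro!: exI[of _ 0])
    then show ?thesis unfolding q_def by simp
  qed
  show "sublinear q" unfolding sublinear_def
  proof (intro conjI allI impI add)
    fix c :: real and x assume "c \<ge> 0"
    show "q (c *\<^sub>R x) = c * q x"
    proof (cases "c = 0")
      case False
      then have "c > 0" using \<open>c \<ge> 0\<close> by simp
      then show ?thesis using scal[of c x] scal[of "inverse c" "c *\<^sub>R x"]
        by (auto simp: field_simps)
    qed (simp add: q0)
  qed
qed

text \<open>Hahn-Banach without extending from subspaces: Zorn's lemma gives a minimal sublinear
  \<open>f\<close> below \<open>p\<close>, \<open>sublinear_directional\<close> makes it odd, and an
  odd sublinear functional is linear.\<close>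

lemma linear_below_sublinear:
  assumes p: "sublinear p"
  obtains f where "linear f" "f \<le> p"
proof -
  define A where "A = {q. sublinear q \<and> q \<le> p}"
  have "\<exists>m\<in>A. \<forall>q\<in>A. q \<le> m \<longrightarrow> q = m"
  proof (rule predicate_Zorn)
    show "partial_order_on A (relation_of (\<lambda>q q'. q' \<le> q) A)"
      by (auto simp: partial_order_on_def preorder_on_def refl_on_def trans_def antisym_def
          relation_of_def)
  next
    fix Q assume Q: "Q \<in> Chains (relation_of (\<lambda>q q'. q' \<le> q) A)"
    then have QA: "Q \<subseteq> A" and chain: "\<And>q q'. q \<in> Q \<Longrightarrow> q' \<in> Q \<Longrightarrow> q \<le> q' \<or> q' \<le> q"
      by (auto simp: Chains_def relation_of_def)
    show "\<exists>u\<in>A. \<forall>q\<in>Q. u \<le> q"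
    proof (cases "Q = {}")
      case True
      then show ?thesis using p by (auto simp: A_def)
    next
      case False
      have bdd: "bdd_below ((\<lambda>q. q x) ` Q)" for x
      proof (rule bdd_belowI[of _ "- p (- x)"])
        fix r assume "r \<in> (\<lambda>q. q x) ` Q"
        then obtain q where q: "q \<in> A" "r = q x" using QA by auto
        then have "- p (- x) \<le> - q (- x)" by (auto simp: A_def le_fun_def)
        also have "\<dots> \<le> q x" using q by (auto simp: A_def intro: sublinear_minus)
        finally show "- p (- x) \<le> r" using q by simp
      qed
      have sub: "sublinear (\<lambda>x. INF q\<in>Q. q x)"
      proof (rule sublinear_infimum[OF False])
        show "\<exists>u\<in>Q. u \<le> q \<and> u \<le> q'" if "q \<in> Q" "q' \<in> Q" for q q'
          using chain[OF that] that by blast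
      qed (use QA bdd in \<open>auto simp: A_def\<close>)
      have below: "(\<lambda>x. INF q\<in>Q. q x) \<le> q" if "q \<in> Q" for q
        using cINF_lower[OF bdd that] by (simp add: le_fun_def)
      obtain q where "q \<in> Q" using False by auto
      then have "(\<lambda>x. INF q\<in>Q. q x) \<le> p" using below QA by (force simp: A_def)
      then show ?thesis using sub below by (auto simp: A_def)
    qed
  qed
  then obtain f where f: "sublinear f" "f \<le> p" and min: "\<And>q. q \<in> A \<Longrightarrow> q \<le> f \<Longrightarrow> q = f"
    by (auto simp: A_def)
  have neg: "f (- y) \<le> - f y" for y
  proof -
    note q = sublinear_directional[OF f(1), of y]
    have "(\<lambda>x. INF t\<in>{0..}. f (x + t *\<^sub>R y) - t * f y) = f"
      by (rule min) (use q f order_trans in \<open>auto simp: A_def\<close>)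
    from fun_cong[OF this, of "- y"] q(3) show ?thesis by simp
  qed
  then have neg: "f (- y) = - f y" for y
    using neg[of y] sublinear_minus[OF f(1), of y] by (intro antisym) linarith+
  have add_le: "f (x + y) \<le> f x + f y" for x y using f(1) by (auto simp: sublinear_def)
  have "linear f"
  proof
    fix x y show "f (x + y) = f x + f y"
      using add_le[of "- x" "- y"] add_le[of x y] neg[of "x + y"] neg[of x] neg[of y]
      by (simp add: algebra_simps)
  next
    fix c :: real and x
    show "f (c *\<^sub>R x) = c *\<^sub>R f x"
    proof (cases "c \<ge> 0")
      case True then show ?thesis using f(1) by (simp add: sublinear_def)
    next
      case False
      then have "f ((- c) *\<^sub>R x) = (- c) * f x" using f(1)[unfolded sublinear_def, THEN conjunct2, rule_format, of "- c" x] by linarith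
      then show ?thesis using neg[of "c *\<^sub>R x"] by simp
    qed
  qed
  then show ?thesis using f(2) that by blast
qed

lemma sublinear_infdist:
  fixes S :: "'a::real_normed_vector set"
  assumes S: "subspace S"
  shows "sublinear (\<lambda>x. infdist x S)"
proof -
  have ne: "S \<noteq> {}" using subspace_0[OF S] by auto
  have near: "\<exists>a\<in>S. dist x a < infdist x S + e" if "e > 0" for x e
  proof (rule ccontr)
    assume "\<not> ?thesis"
    then have "infdist x S + e \<le> (INF a\<in>S. dist x a)" by (intro cINF_greatest[OF ne]) auto
    then show False using that by (simp add: infdist_notempty[OF ne])
  qed
  have scal: "infdist (c *\<^sub>R x) S \<le> c * infdist x S" if "c > 0" for c x
  proof (rule field_le_epsilon)
    fix e :: real assume "e > 0"
    then have "e / c > 0" using that by simp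
    then obtain a where a: "a \<in> S" "dist x a < infdist x S + e / c" using near by blast
    have "infdist (c *\<^sub>R x) S \<le> dist (c *\<^sub>R x) (c *\<^sub>R a)"
      using a(1) subspace_scale[OF S] by (intro infdist_le) auto
    also have "\<dots> = c * dist x a" using that by (simp add: dist_norm flip: scaleR_diff_right)
    also have "\<dots> \<le> c * infdist x S + e" using a(2) that by (simp add: field_simps)
    finally show "infdist (c *\<^sub>R x) S \<le> c * infdist x S + e" .
  qed
  show ?thesis unfolding sublinear_def
  proof (intro conjI allI impI)
    fix x y
    show "infdist (x + y) S \<le> infdist x S + infdist y S"
    proof (rule field_le_epsilon)
      fix e :: real assume "e > 0"
      then obtain a b where a: "a \<in> S" "dist x a < infdist x S + e / 2"
        and b: "b \<in> S" "dist y b < infdist y S + e / 2"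
        using near[of "e / 2"] by (meson half_gt_zero)
      have "infdist (x + y) S \<le> dist (x + y) (a + b)"
        using a(1) b(1) subspace_add[OF S] by (intro infdist_le) auto
      also have "\<dots> \<le> dist x a + dist y b" by (rule dist_triangle_add)
      also have "\<dots> \<le> infdist x S + infdist y S + e" using a(2) b(2) by simp
      finally show "infdist (x + y) S \<le> infdist x S + infdist y S + e" .
    qed
  next
    fix c :: real and x :: 'a assume "c \<ge> 0"
    show "infdist (c *\<^sub>R x) S = c * infdist x S"
    proof (cases "c = 0")
      case True then show ?thesis using subspace_0[OF S] by simp
    next
      case False
      then have "c > 0" using \<open>c \<ge> 0\<close> by simp
      then show ?thesis using scal[of c x] scal[of "inverse c" "c *\<^sub>R x"] by (auto simp: field_simps)
    qed
  qed
qed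

text \<open>The distance to \<open>S\<close> is sublinear and vanishes on \<open>S\<close>, so a
  linear \<open>f\<close> below it vanishes on \<open>S\<close> and is bounded. Starting below the
  functional directed along \<open>z\<close>, and not just below the distance, forces
  \<open>f z\<close> to be at least the distance of \<open>z\<close>, which is positive.\<close>

lemma separating_real_functional:
  fixes S :: "'a::real_normed_vector set"
  assumes S: "subspace S" and z: "z \<notin> closure S"
  obtains f :: "'a \<Rightarrow> real" where "bounded_linear f" "\<And>x. x \<in> S \<Longrightarrow> f x = 0" "f z \<noteq> 0"
proof -
  define p where "p = (\<lambda>x. infdist x S)"
  have p: "sublinear p" unfolding p_def by (rule sublinear_infdist[OF S])
  note q = sublinear_directional[OF p, of z]
  obtain f where f: "linear f" "f \<le> (\<lambda>x. INF t\<in>{0..}. p (x + t *\<^sub>R z) - t * p z)"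
    using linear_below_sublinear[OF q(1)] by blast
  have fp: "f x \<le> p x" for x using f(2) q(2) by (auto simp: le_fun_def intro: order_trans)
  have fm: "f (- x) = - f x" for x using f(1) by (rule linear_neg)
  have ne: "S \<noteq> {}" using subspace_0[OF S] by auto
  have pn: "p x \<le> norm x" for x
    using infdist_le[OF subspace_0[OF S], of x] by (simp add: p_def)
  show ?thesis
  proof
    show "bounded_linear f"
    proof (rule bounded_linear.intro[OF f(1)], unfold_locales)
      have "norm (f x) \<le> norm x * 1" for x
        using fp[of x] fp[of "- x"] fm[of x] pn[of x] pn[of "- x"] by auto
      then show "\<exists>K. \<forall>x. norm (f x) \<le> norm x * K" by blast
    qed
    show "f x = 0" if "x \<in> S" for x
      using fp[of x] fp[of "- x"] fm[of x] that subspace_neg[OF S that] by (simp add: p_def)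
    have "f (- z) \<le> - p z" using f(2) q(3) by (auto simp: le_fun_def intro: order_trans)
    moreover have "p z > 0" using z ne in_closure_iff_infdist_zero[OF ne] infdist_nonneg[of z S]
      by (auto simp: p_def less_le)
    ultimately show "f z \<noteq> 0" using fm[of z] by auto
  qed
qed

lemma (in normed_space_over) scl_scaleR: "scl c (r *\<^sub>R x) = r *\<^sub>R scl c x"
  using scale_left_commute[of c "of_real r" x] by (simp only: scl_of_real)

lemma (in normed_space_over) scaleR_scl: "scl (r *\<^sub>R c) x = r *\<^sub>R scl c x"
  using scale_scale[of "of_real r" c x] by (simp only: scl_of_real scaleR_conv_of_real)

lemma (in normed_space_over) subspace_imp_real_subspace:
  "module.subspace scl S \<Longrightarrow> Real_Vector_Spaces.subspace S"
  by (auto simp: subspace_def Real_Vector_Spaces.subspace_def simp flip: scl_of_real)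

lemma (in normed_space_over) bounded_linear_scl: "bounded_linear (scl c)"
  by (rule bounded_linear_intro[of _ "norm c"]) (auto simp: scale_right_distrib scl_scaleR norm_scl)

(* The scalar-valued functional h is recovered from the real functional f: the inner product of
   k * h x and 1 is to be f (scl k x), and (k, c) \<mapsto> (k * c) \<bullet> 1 is nondegenerate on the scalars. *)
theorem (in normed_space_over) separating_functional:
  assumes S: "module.subspace scl S" and z: "z \<notin> closure S"
  obtains \<phi> where "\<phi> \<in> dual_space scl" "\<And>x. x \<in> S \<Longrightarrow> blinfun_apply \<phi> x = 0" "blinfun_apply \<phi> z \<noteq> 0"
proof -
  obtain f :: "'a \<Rightarrow> real" where f: "bounded_linear f" "\<And>x. x \<in> S \<Longrightarrow> f x = 0" "f z \<noteq> 0"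
    using separating_real_functional[OF subspace_imp_real_subspace[OF S] z] by blast
  interpret f: bounded_linear f by fact
  \<comment> \<open>\<open>\<Theta> c\<close> represents the real functional
    \<open>k \<mapsto> (k * c) \<bullet> 1\<close> through the euclidean inner product. It is
    injective because \<open>inverse c * c\<close> pairs with 1 to 1, hence invertible in finite
    dimension, with inverse \<open>g\<close>.\<close>
  define \<Theta> where "\<Theta> = (\<lambda>c::'k. \<Sum>b\<in>Basis. ((b * c) \<bullet> 1) *\<^sub>R b)"
  have lin: "linear \<Theta>"
    unfolding \<Theta>_def
    by (rule linearI) (auto simp: distrib_left inner_add_left scaleR_add_left sum.distrib scaleR_sum_right)
  have inner_\<Theta>: "k \<bullet> \<Theta> c = (k * c) \<bullet> 1" for k c
  proof -
    have "(k * c) \<bullet> 1 = ((\<Sum>b\<in>Basis. (k \<bullet> b) *\<^sub>R b) * c) \<bullet> 1" by (simp add: euclidean_representation)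
    also have "\<dots> = (\<Sum>b\<in>Basis. (k \<bullet> b) * ((b * c) \<bullet> 1))"
      by (simp add: sum_distrib_right inner_sum_left)
    also have "\<dots> = k \<bullet> \<Theta> c"
      unfolding \<Theta>_def by (simp add: inner_sum_right mult.commute)
    finally show ?thesis by simp
  qed
  have one: "(1::'k) \<bullet> 1 = 1" by (metis norm_eq_1 norm_one)
  have "inj \<Theta>"
  proof (rule linear_injective_0[OF lin, THEN iffD2], intro allI impI)
    fix c assume "\<Theta> c = 0"
    then have "(inverse c * c) \<bullet> 1 = 0" using inner_\<Theta>[of "inverse c" c] by simp
    then show "c = 0" using one by (cases "c = 0") auto
  qed
  then have "surj \<Theta>" using lin by (simp add: linear_injective_imp_surjective)
  obtain g where g: "linear g" "\<And>c. g (\<Theta> c) = c" "\<And>c. \<Theta> (g c) = c"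
    using linear_injective_isomorphism[OF lin \<open>inj \<Theta>\<close>] by auto
  define h where "h = (\<lambda>x. g (\<Sum>b\<in>Basis. f (scl b x) *\<^sub>R b))"
  have h: "(k * h x) \<bullet> 1 = f (scl k x)" for k x
  proof -
    have "(k * h x) \<bullet> 1 = k \<bullet> (\<Sum>b\<in>Basis. f (scl b x) *\<^sub>R b)"
      by (simp flip: inner_\<Theta> add: h_def g)
    also have "\<dots> = (\<Sum>b\<in>Basis. f (scl ((k \<bullet> b) *\<^sub>R b) x))"
      by (simp add: inner_sum_right scaleR_scl f.scaleR mult.commute)
    also have "\<dots> = f (scl (\<Sum>b\<in>Basis. (k \<bullet> b) *\<^sub>R b) x)"
      by (simp add: scale_sum_left f.sum)
    finally show ?thesis by (simp add: euclidean_representation)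
  qed
  have eqI: "c = d" if eq: "\<And>k. (k * c) \<bullet> 1 = (k * d) \<bullet> 1" for c d :: 'k
  proof (rule ccontr)
    assume "c \<noteq> d"
    then have "(inverse (c - d) * c) \<bullet> 1 - (inverse (c - d) * d) \<bullet> 1 = 1"
      using one by (simp flip: inner_diff_left right_diff_distrib)
    then show False using eq[of "inverse (c - d)"] by simp
  qed
  have blin: "bounded_linear h"
    unfolding h_def
    by (intro bounded_linear_compose[OF linear_conv_bounded_linear[THEN iffD1, OF g(1)]]
        bounded_linear_sum bounded_linear_scaleR_const bounded_linear_compose[OF f(1)] bounded_linear_scl)
  have lin_h: "Vector_Spaces.linear scl (*) h"
    unfolding Vector_Spaces.linear_iff
  proof (intro conjI allI)
    show "vector_space scl" by (rule vector_space_axioms)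
    show "vector_space ((*) :: 'k \<Rightarrow> 'k \<Rightarrow> 'k)" by unfold_locales (auto simp: algebra_simps)
    show "h (x + y) = h x + h y" for x y using blin by (simp add: bounded_linear.linear linear_add)
    show "h (scl c x) = c * h x" for c x
      by (rule eqI) (metis h mult.assoc scale_scale)
  qed
  show ?thesis
  proof (rule that[of "Blinfun h"])
    show "Blinfun h \<in> dual_space scl"
      using lin_h by (simp add: dual_space_def bounded_linear_Blinfun_apply[OF blin])
    show "blinfun_apply (Blinfun h) x = 0" if "x \<in> S" for x
    proof -
      have "scl k x \<in> S" for k using S that by (simp add: subspace_def)
      then have "h x = 0" by (intro eqI) (simp add: h f)
      then show ?thesis by (simp add: bounded_linear_Blinfun_apply[OF blin])
    qed
    show "blinfun_apply (Blinfun h) z \<noteq> 0"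
      using h[of 1 z] f(3) by (auto simp: bounded_linear_Blinfun_apply[OF blin])
  qed
qed


subsection \<open>Strongly continuous semigroups\<close>

text \<open>Baire: the closed sets \<open>F k\<close> cover the space, so one of them contains a
  ball. Differences of its points with the centre give the constant \<open>2 * k / e\<close>; the
  maximum with 1 provides \<open>K \<ge> 1\<close>.\<close>

lemma uniform_boundedness:
  fixes T :: "'i \<Rightarrow> 'a::banach \<Rightarrow> 'b::real_normed_vector"
  assumes lin: "\<And>i. i \<in> I \<Longrightarrow> bounded_linear (T i)"
    and bdd: "\<And>x. \<exists>B. \<forall>i\<in>I. norm (T i x) \<le> B"
  obtains K where "K \<ge> 1" "\<And>i x. i \<in> I \<Longrightarrow> norm (T i x) \<le> K * norm x"
proof -
  define F where "F = (\<lambda>k::nat. {x. \<forall>i\<in>I. norm (T i x) \<le> real k})"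
  have "closed (F k)" for k
  proof -
    have "F k = (\<Inter>i\<in>I. {x. norm (T i x) \<le> real k})" by (auto simp: F_def)
    moreover have "closed {x. norm (T i x) \<le> real k}" if "i \<in> I" for i
      using linear_continuous_on[OF lin[OF that], of UNIV]
      by (intro closed_Collect_le continuous_intros) auto
    ultimately show ?thesis by auto
  qed
  moreover have "(\<Union>k. F k) = UNIV"
  proof -
    have "\<exists>k. x \<in> F k" for x
    proof -
      obtain B where B: "\<forall>i\<in>I. norm (T i x) \<le> B" using bdd by blast
      obtain k where "B \<le> real k" using real_arch_simple by blast
      then have "x \<in> F k" using B unfolding F_def by fastforce
      then show ?thesis by blast
    qed
    then show ?thesis by auto
  qed
  ultimately have "\<exists>k. interior (F k) \<noteq> {}"
    using Baire_category_alt[of euclidean "range F"] completely_metrizable_space_euclidean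
    by fastforce
  then obtain k x0 where "x0 \<in> interior (F k)" by blast
  then obtain e where e: "e > 0" "cball x0 e \<subseteq> F k" using mem_interior_cball by blast
  have bound: "norm (T i x) \<le> (2 * real k / e) * norm x" if i: "i \<in> I" for i x
  proof (cases "x = 0")
    case True
    then show ?thesis using linear_0[OF bounded_linear.linear[OF lin[OF i]]] by simp
  next
    case False
    interpret bounded_linear "T i" by (rule lin[OF i])
    let ?u = "(e / norm x) *\<^sub>R x"
    have nu: "norm ?u = e" using False e(1) by simp
    have "x0 + ?u \<in> F k" "x0 \<in> F k" using e nu by (auto simp: dist_norm subset_iff simp del: norm_scaleR)
    then have "norm (T i (x0 + ?u)) \<le> k" "norm (T i x0) \<le> k" using i by (auto simp: F_def)
    then have "norm (T i ?u) \<le> 2 * real k"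
      using norm_triangle_ineq4[of "T i (x0 + ?u)" "T i x0"] by (simp add: add)
    then have "(e / norm x) * norm (T i x) \<le> 2 * real k" using e(1) by (simp add: scaleR)
    then show ?thesis using e(1) False by (simp add: field_simps)
  qed
  show ?thesis
  proof (rule that[of "max 1 (2 * real k / e)"])
    fix i x assume "i \<in> I"
    then have "norm (T i x) \<le> (2 * real k / e) * norm x" by (rule bound)
    also have "\<dots> \<le> max 1 (2 * real k / e) * norm x" by (intro mult_right_mono) auto
    finally show "norm (T i x) \<le> max 1 (2 * real k / e) * norm x" .
  qed simp
qed

lemma norm_diff_le_vector_derivative:
  fixes f :: "real \<Rightarrow> 'b::real_normed_vector"
  assumes "convex S" and deriv: "\<And>s. s \<in> S \<Longrightarrow> (f has_vector_derivative f' s) (at s within S)"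
    and bound: "\<And>s. s \<in> S \<Longrightarrow> norm (f' s) \<le> B" and "u \<in> S" "v \<in> S"
  shows "norm (f u - f v) \<le> B * \<bar>u - v\<bar>"
proof -
  have "onorm (\<lambda>h. h *\<^sub>R f' s) \<le> B" if "s \<in> S" for s
    using bound[OF that] by (intro onorm_le) (simp add: mult_right_mono mult.commute[of B] mult_left_mono)
  then have "norm (f u - f v) \<le> B * norm (u - v)"
    using assms by (intro differentiable_bound[of S f "\<lambda>s h. h *\<^sub>R f' s"]) (auto simp: has_vector_derivative_def)
  then show ?thesis by simp
qed

text \<open>Keeps the real structure of \<open>c0_semigroup\<close> and drops \<open>scl\<close>,
  which is brought back where functionals and the final semigroup require it.\<close>

locale operator_semigroup =
  fixes T :: "real \<Rightarrow> 'a::banach \<Rightarrow> 'a"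
  assumes bounded_linear: "s \<ge> 0 \<Longrightarrow> bounded_linear (T s)"
    and zero: "T 0 x = x"
    and add: "r \<ge> 0 \<Longrightarrow> s \<ge> 0 \<Longrightarrow> T (r + s) x = T r (T s x)"
    and continuous: "continuous_on {0..} (\<lambda>s. T s x)"

lemma c0_semigroup_imp_operator_semigroup: "c0_semigroup scl T \<Longrightarrow> operator_semigroup T"
  unfolding c0_semigroup_def by (rule operator_semigroup.intro) (auto simp: fun_eq_iff)

context operator_semigroup
begin

lemma T_diff: "s \<ge> 0 \<Longrightarrow> T s (x - y) = T s x - T s y"
  using bounded_linear bounded_linear.linear linear_diff by blast

lemma T_add: "s \<ge> 0 \<Longrightarrow> T s (x + y) = T s x + T s y"
  using bounded_linear bounded_linear.linear linear_add by blast

lemma T_scaleR: "s \<ge> 0 \<Longrightarrow> T s (c *\<^sub>R x) = c *\<^sub>R T s x"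
  using bounded_linear bounded_linear.linear linear_scale by blast

lemma bounded_on_interval:
  obtains K where "K \<ge> 1" "\<And>s x. 0 \<le> s \<Longrightarrow> s \<le> S \<Longrightarrow> norm (T s x) \<le> K * norm x"
proof (rule uniform_boundedness[of "{0..S}" T])
  show "bounded_linear (T s)" if "s \<in> {0..S}" for s using bounded_linear that by auto
  show "\<exists>B. \<forall>s\<in>{0..S}. norm (T s x) \<le> B" for x
  proof -
    have "compact ((\<lambda>s. T s x) ` {0..S})"
      by (intro compact_continuous_image continuous_on_subset[OF continuous]) auto
    then have "bounded ((\<lambda>s. T s x) ` {0..S})" by (rule compact_imp_bounded)
    then show ?thesis by (auto simp: bounded_iff)
  qed
qed (use that in auto)

lemma tendsto_right_zero: "((\<lambda>s. T s x) \<longlongrightarrow> x) (at_right 0)"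
proof -
  have "((\<lambda>s. T s x) \<longlongrightarrow> T 0 x) (at 0 within {0..})"
    using continuous by (auto simp: continuous_on_def)
  then have "((\<lambda>s. T s x) \<longlongrightarrow> T 0 x) (at_right 0)" by (rule tendsto_within_subset) auto
  then show ?thesis by (simp add: zero)
qed

lemma subspace_generator: "subspace (generator T)"
  unfolding subspace_def
proof (intro conjI ballI allI)
  have 0: "T h 0 = 0" if "h \<ge> 0" for h using T_scaleR[OF that, of 0 0] by simp
  have "((\<lambda>h. (T h 0 - 0) /\<^sub>R h) \<longlongrightarrow> 0) (at_right 0)"
    by (rule Lim_transform_eventually[OF tendsto_const])
      (use eventually_at_right_less[of "0::real"] in eventually_elim, simp add: 0)
  then show "0 \<in> generator T" by (simp add: generator_def zero_prod_def)
next
  fix u v assume "u \<in> generator T" "v \<in> generator T"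
  then obtain x y x' y' where [simp]: "u = (x, y)" "v = (x', y')" and
    lim: "((\<lambda>h. (T h x - x) /\<^sub>R h) \<longlongrightarrow> y) (at_right 0)" "((\<lambda>h. (T h x' - x') /\<^sub>R h) \<longlongrightarrow> y') (at_right 0)"
    by (auto simp: generator_def)
  have "((\<lambda>h. (T h (x + x') - (x + x')) /\<^sub>R h) \<longlongrightarrow> y + y') (at_right 0)"
    by (rule Lim_transform_eventually[OF tendsto_add[OF lim]])
      (use eventually_at_right_less[of "0::real"] in eventually_elim, simp add: T_add flip: scaleR_add_right)
  then show "u + v \<in> generator T" by (simp add: generator_def)
next
  fix c :: real and u assume "u \<in> generator T"
  then obtain x y where [simp]: "u = (x, y)" and
    lim: "((\<lambda>h. (T h x - x) /\<^sub>R h) \<longlongrightarrow> y) (at_right 0)"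
    by (auto simp: generator_def)
  have "((\<lambda>h. (T h (c *\<^sub>R x) - (c *\<^sub>R x)) /\<^sub>R h) \<longlongrightarrow> c *\<^sub>R y) (at_right 0)"
    by (rule Lim_transform_eventually[OF tendsto_scaleR[OF tendsto_const[of c] lim]])
      (use eventually_at_right_less[of "0::real"] in eventually_elim, simp add: T_scaleR mult.commute flip: scaleR_diff_right)
  then show "c *\<^sub>R u \<in> generator T" by (simp add: generator_def)
qed

lemma generator_orbit:
  assumes "(x, y) \<in> generator T" "s \<ge> 0"
  shows "(T s x, T s y) \<in> generator T"
proof -
  interpret Ts: bounded_linear "T s" by (rule bounded_linear[OF assms(2)])
  have "((\<lambda>h. T s ((T h x - x) /\<^sub>R h)) \<longlongrightarrow> T s y) (at_right 0)"
    using assms(1) by (intro Ts.tendsto) (simp add: generator_def)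
  moreover have "\<forall>\<^sub>F h in at_right 0. T s ((T h x - x) /\<^sub>R h) = (T h (T s x) - T s x) /\<^sub>R h"
    unfolding eventually_at_filter
    by (rule always_eventually) (use assms(2) in \<open>auto simp: Ts.scaleR Ts.diff add.commute simp flip: add\<close>)
  ultimately have "((\<lambda>h. (T h (T s x) - T s x) /\<^sub>R h) \<longlongrightarrow> T s y) (at_right 0)"
    by (rule Lim_transform_eventually)
  then show ?thesis by (simp add: generator_def)
qed

text \<open>The generator is defined by a right derivative at 0 alone. The quotient to the left of
  \<open>s\<close> is a right quotient at \<open>u < s\<close>, controlled by the uniform bound
  \<open>K\<close>, followed by a replacement of \<open>T u y\<close> by \<open>T s y\<close>
  through strong continuity.\<close>

lemma orbit_has_vector_derivative:
  assumes xy: "(x, y) \<in> generator T" and "s \<ge> 0"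
  shows "((\<lambda>s. T s x) has_vector_derivative T s y) (at s within {0..})"
proof -
  obtain K where K: "K \<ge> 1" "\<And>u x. 0 \<le> u \<Longrightarrow> u \<le> s + 1 \<Longrightarrow> norm (T u x) \<le> K * norm x"
    using bounded_on_interval[of "s + 1"] by blast
  have lim: "((\<lambda>h. (T h x - x) /\<^sub>R h) \<longlongrightarrow> y) (at_right 0)"
    using xy by (simp add: generator_def)
  have "\<exists>d>0. \<forall>u\<in>{0..}. \<bar>u - s\<bar> < d \<longrightarrow>
      norm (T u x - T s x - (u - s) *\<^sub>R T s y) \<le> e * \<bar>u - s\<bar>" if "e > 0" for e
  proof -
    \<comment> \<open>Half of \<open>e\<close> pays for the quotient after an operator of norm at
      most \<open>K\<close> is applied, the other half for moving \<open>T u y\<close> to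
      \<open>T s y\<close>.\<close>
    define e' where "e' = e / (2 * K)"
    have "e' > 0" using K(1) \<open>e > 0\<close> by (simp add: e'_def)
    obtain d1 where d1: "d1 > 0" "\<And>h. 0 < h \<Longrightarrow> h < d1 \<Longrightarrow> norm ((T h x - x) /\<^sub>R h - y) < e'"
      using tendstoD[OF lim \<open>e' > 0\<close>] unfolding eventually_at_right[OF zero_less_one] dist_norm
      by auto
    have quot: "norm (T h x - x - h *\<^sub>R y) \<le> e' * h" if "0 < h" "h < d1" for h
    proof -
      have "T h x - x - h *\<^sub>R y = h *\<^sub>R ((T h x - x) /\<^sub>R h - y)"
        using that(1) by (simp add: scaleR_diff_right)
      then have "norm (T h x - x - h *\<^sub>R y) = h * norm ((T h x - x) /\<^sub>R h - y)"
        using that(1) by (simp only: norm_scaleR abs_of_pos)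
      then show ?thesis using d1(2)[OF that] that by (simp add: mult.commute)
    qed
    have "\<exists>d>0. \<forall>u\<in>{0..}. dist u s < d \<longrightarrow> dist (T u y) (T s y) < e / 2"
      using continuous[of y, unfolded continuous_on_iff, THEN bspec, of s, THEN spec, of "e / 2"]
        \<open>s \<ge> 0\<close> \<open>e > 0\<close> by simp
    then obtain d2 where d2: "d2 > 0" "\<And>u. u \<ge> 0 \<Longrightarrow> \<bar>u - s\<bar> < d2 \<Longrightarrow> norm (T u y - T s y) < e / 2"
      by (auto simp: dist_norm)
    show ?thesis
    proof (intro exI[of _ "min 1 (min d1 d2)"] conjI ballI impI)
      fix u :: real assume "u \<in> {0..}" and u: "\<bar>u - s\<bar> < min 1 (min d1 d2)"
      then have "u \<ge> 0" by simp
      have step: "norm (T (v + h) x - T v x - h *\<^sub>R T v y) \<le> e / 2 * h"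
        if "v \<ge> 0" "v \<le> s + 1" "0 < h" "h < d1" for v h
      proof -
        have "T (v + h) x - T v x - h *\<^sub>R T v y = T v (T h x - x - h *\<^sub>R y)"
          using that by (simp add: add T_diff T_scaleR)
        then have "norm (T (v + h) x - T v x - h *\<^sub>R T v y) \<le> K * norm (T h x - x - h *\<^sub>R y)"
          using K(2) that by simp
        also have "\<dots> \<le> K * (e' * h)" using K(1) quot that by (intro mult_left_mono) auto
        also have "\<dots> = e / 2 * h" using K(1) by (simp add: e'_def field_simps)
        finally show ?thesis .
      qed
      consider "u = s" | "u > s" | "u < s" by linarith
      then show "norm (T u x - T s x - (u - s) *\<^sub>R T s y) \<le> e * \<bar>u - s\<bar>"
      proof cases
        case 2
        then have "norm (T u x - T s x - (u - s) *\<^sub>R T s y) \<le> e / 2 * (u - s)"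
          using step[of s "u - s"] u \<open>s \<ge> 0\<close> by simp
        also have "\<dots> \<le> e * \<bar>u - s\<bar>" using 2 \<open>e > 0\<close> by simp
        finally show ?thesis .
      next
        case 3
        then have 1: "norm (T s x - T u x - (s - u) *\<^sub>R T u y) \<le> e / 2 * (s - u)"
          using step[of u "s - u"] u \<open>u \<ge> 0\<close> by simp
        have 2: "norm ((s - u) *\<^sub>R (T u y - T s y)) \<le> (s - u) * (e / 2)"
          using d2(2)[of u] u \<open>u \<ge> 0\<close> 3 by simp
        have "T u x - T s x - (u - s) *\<^sub>R T s y =
            - (T s x - T u x - (s - u) *\<^sub>R T u y) - (s - u) *\<^sub>R (T u y - T s y)"
          by (simp add: algebra_simps)
        then have "norm (T u x - T s x - (u - s) *\<^sub>R T s y) \<le> e / 2 * (s - u) + (s - u) * (e / 2)"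
          using 1 2 norm_triangle_ineq4[of "- (T s x - T u x - (s - u) *\<^sub>R T u y)" "(s - u) *\<^sub>R (T u y - T s y)"]
          by (simp only: norm_minus_cancel)
        then show ?thesis using 3 by (simp add: algebra_simps)
      qed auto
    qed (use d1 d2 in auto)
  qed
  then show ?thesis
    unfolding has_vector_derivative_def has_derivative_within_alt
    by (simp add: bounded_linear_scaleR_left)
qed

text \<open>The derivative of \<open>exp (- \<mu> * s) *\<^sub>R \<psi> (T s x)\<close> vanishes.
  With \<open>\<psi>\<close> the identity this describes eigenvectors of the generator, with
  \<open>\<psi>\<close> a functional the annihilators of the range of \<open>\<mu>\<close> minus the
  generator.\<close>

lemma orbit_eq_exp:
  fixes \<psi> :: "'a \<Rightarrow> 'b::real_normed_vector"
  assumes \<psi>: "bounded_linear \<psi>" and xy: "(x, y) \<in> generator T"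
    and eig: "\<And>s. s \<ge> 0 \<Longrightarrow> \<psi> (T s y) = \<mu> *\<^sub>R \<psi> (T s x)" and "s \<ge> 0"
  shows "\<psi> (T s x) = exp (\<mu> * s) *\<^sub>R \<psi> x"
proof -
  define f where "f = (\<lambda>s. exp (- \<mu> * s) *\<^sub>R \<psi> (T s x))"
  have "(f has_vector_derivative 0) (at u within {0..})" if "u \<in> {0..}" for u
  proof -
    have "u \<ge> 0" using that by simp
    have 1: "((\<lambda>s. \<psi> (T s x)) has_vector_derivative \<psi> (T u y)) (at u within {0..})"
      using \<psi> orbit_has_vector_derivative[OF xy \<open>u \<ge> 0\<close>] by (rule bounded_linear.has_vector_derivative)
    have 2: "((\<lambda>s. exp (- \<mu> * s)) has_real_derivative - \<mu> * exp (- \<mu> * u)) (at u within {0..})"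
      by (auto intro!: derivative_eq_intros)
    have "exp (- \<mu> * u) *\<^sub>R \<psi> (T u y) + (- \<mu> * exp (- \<mu> * u)) *\<^sub>R \<psi> (T u x) = 0"
      using eig[OF \<open>u \<ge> 0\<close>] by (simp add: mult.commute)
    then show ?thesis
      unfolding f_def using has_vector_derivative_scaleR[OF 2 1] by (simp only:)
  qed
  then obtain c where c: "\<And>u. u \<in> {0..} \<Longrightarrow> f u = c"
    using has_vector_derivative_zero_constant[of "{0..}" f] by auto
  have "f s = f 0" using c \<open>s \<ge> 0\<close> by simp
  then have "exp (\<mu> * s) *\<^sub>R f s = exp (\<mu> * s) *\<^sub>R \<psi> x" by (simp add: f_def zero)
  then show ?thesis by (simp add: f_def exp_minus_inverse)
qed

text \<open>The mean value inequality is used twice: \<open>z\<close> bounds the drift of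
  \<open>T s y\<close> from \<open>y\<close> by \<open>B * h\<close>, and this drift is the
  derivative of \<open>T s x - s *\<^sub>R y\<close>.\<close>

lemma second_order_expansion:
  assumes xy: "(x, y) \<in> generator T" and yz: "(y, z) \<in> generator T" and "h \<ge> 0"
    and bound: "\<And>s. 0 \<le> s \<Longrightarrow> s \<le> h \<Longrightarrow> norm (T s z) \<le> B"
  shows "norm (T h x - x - h *\<^sub>R y) \<le> B * h\<^sup>2"
proof -
  have "B \<ge> 0" using norm_ge_zero order_trans bound[of 0] \<open>h \<ge> 0\<close> by blast
  have sub: "{0..h} \<subseteq> {0..}" by auto
  have deriv: "((\<lambda>s. T s u) has_vector_derivative T s v) (at s within {0..h})"
    if "(u, v) \<in> generator T" "s \<in> {0..h}" for u v s
    using that(2) by (intro has_vector_derivative_within_subset[OF orbit_has_vector_derivative[OF that(1)] sub]) simp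
  have "norm (T s y - y) \<le> B * h" if s: "s \<in> {0..h}" for s
  proof -
    have "norm (T s y - T 0 y) \<le> B * \<bar>s - 0\<bar>"
      using deriv[OF yz] bound s
      by (intro norm_diff_le_vector_derivative[of "{0..h}" _ "\<lambda>s. T s z"]) auto
    also have "\<dots> \<le> B * h" using s \<open>B \<ge> 0\<close> by (auto intro: mult_left_mono)
    finally show ?thesis by (simp add: zero)
  qed
  then have "norm ((T h x - h *\<^sub>R y) - (T 0 x - 0 *\<^sub>R y)) \<le> (B * h) * \<bar>h - 0\<bar>"
    using deriv[OF xy] \<open>h \<ge> 0\<close>
    by (intro norm_diff_le_vector_derivative[of "{0..h}" "\<lambda>s. T s x - s *\<^sub>R y" "\<lambda>s. T s y - y"])
      (auto intro!: derivative_eq_intros)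
  then show ?thesis using \<open>h \<ge> 0\<close> by (simp add: zero power2_eq_square algebra_simps)
qed

end


subsection \<open>Stable families consistent with an operator\<close>

lemma subspace_closure:
  fixes S :: "'a::real_normed_vector set"
  assumes "subspace S"
  shows "subspace (closure S)"
  unfolding subspace_def
proof (intro conjI ballI allI)
  show "0 \<in> closure S" using subspace_0[OF assms] closure_subset by blast
next
  fix x y assume "x \<in> closure S" "y \<in> closure S"
  then obtain f g where "\<forall>n. f n \<in> S" "f \<longlonglongrightarrow> x" "\<forall>n. g n \<in> S" "g \<longlonglongrightarrow> y"
    unfolding closure_sequential by blast
  then have "\<forall>n. f n + g n \<in> S" "(\<lambda>n. f n + g n) \<longlonglongrightarrow> x + y"
    using subspace_add[OF assms] by (auto intro: tendsto_add)
  then show "x + y \<in> closure S"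
    unfolding closure_sequential by (intro exI[of _ "\<lambda>n. f n + g n"] conjI)
next
  fix c :: real and x assume "x \<in> closure S"
  then obtain f where "\<forall>n. f n \<in> S" "f \<longlonglongrightarrow> x" unfolding closure_sequential by blast
  then have "\<forall>n. c *\<^sub>R f n \<in> S" "(\<lambda>n. c *\<^sub>R f n) \<longlonglongrightarrow> c *\<^sub>R x"
    using subspace_scale[OF assms] by (auto intro: tendsto_scaleR)
  then show "c *\<^sub>R x \<in> closure S"
    unfolding closure_sequential by (intro exI[of _ "\<lambda>n. c *\<^sub>R f n"] conjI)
qed

lemma norm_add_diff_le: "norm (x + y - z) \<le> norm x + norm y + norm (z :: 'a::real_normed_vector)"
  by (rule order_trans[OF norm_triangle_ineq4 add_right_mono[OF norm_triangle_ineq]])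

lemma Cauchy_lipschitz:
  fixes f :: "nat \<Rightarrow> 'a::real_normed_vector" and g :: "nat \<Rightarrow> 'b::real_normed_vector"
  assumes f: "Cauchy f" and "c > 0" and le: "\<And>m n. norm (g m - g n) \<le> c * norm (f m - f n)"
  shows "Cauchy g"
proof (rule metric_CauchyI)
  fix e :: real assume "e > 0"
  then obtain N where N: "\<And>m n. m \<ge> N \<Longrightarrow> n \<ge> N \<Longrightarrow> dist (f m) (f n) < e / c"
    using metric_CauchyD[OF f, of "e / c"] \<open>c > 0\<close> by auto
  have "dist (g m) (g n) < e" if "m \<ge> N" "n \<ge> N" for m n
    using le[of m n] N[OF that] \<open>c > 0\<close> by (simp add: dist_norm field_simps)
  then show "\<exists>N. \<forall>m\<ge>N. \<forall>n\<ge>N. dist (g m) (g n) < e" by blast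
qed

text \<open>Stability and consistency of a one-step scheme for \<open>L\<close>. The factor
  \<open>M\<close> is shared by all powers, whereas multiplying bounds of single steps would produce
  \<open>M ^ m\<close>; \<open>a \<ge> 0\<close> makes the bound \<open>K\<close> monotone in
  time.\<close>

locale chernoff_family =
  fixes V :: "real \<Rightarrow> 'a::banach \<Rightarrow> 'a" and L :: "('a \<times> 'a) set" and M a :: real
  assumes bounded_linear_V: "r > 0 \<Longrightarrow> bounded_linear (V r)"
    and stable: "r > 0 \<Longrightarrow> norm ((V r ^^ m) x) \<le> M * exp (a * (r * real m)) * norm x"
    and M_ge_1: "M \<ge> 1" and a_nonneg: "a \<ge> 0"
    and subspace_L: "subspace L"
    and consistent: "(x, y) \<in> L \<Longrightarrow> ((\<lambda>r. (V r x - x) /\<^sub>R r) \<longlongrightarrow> y) (at_right 0)"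
    and dense_domain: "closure (Domain L) = UNIV"
begin

abbreviation G :: "('a \<times> 'a) set" where "G \<equiv> closure L"

definition K :: "real \<Rightarrow> real" where "K S = M * exp (a * S)"

lemma K_ge_1: "S \<ge> 0 \<Longrightarrow> K S \<ge> 1"
  using mult_mono[of 1 M 1 "exp (a * S)"] M_ge_1 a_nonneg by (simp add: K_def)

lemma K_mono: "s \<le> s' \<Longrightarrow> K s \<le> K s'"
  unfolding K_def using M_ge_1 a_nonneg by (intro mult_left_mono) (auto intro: mult_left_mono)

lemma subspace_G: "subspace G"
  using subspace_L by (rule subspace_closure)

lemma L_subset_G: "L \<subseteq> G"
  by (rule closure_subset)

lemma bounded_linear_power: "r > 0 \<Longrightarrow> bounded_linear (V r ^^ m)"
proof (induction m)
  case (Suc m)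
  then show ?case using bounded_linear_compose[OF bounded_linear_V, of r] by (simp add: comp_def)
qed (simp add: id_def)

lemma power_diff: "r > 0 \<Longrightarrow> (V r ^^ m) (x - y) = (V r ^^ m) x - (V r ^^ m) y"
  using bounded_linear_power bounded_linear.linear linear_diff by metis

lemma power_plus: "r > 0 \<Longrightarrow> (V r ^^ m) (x + y) = (V r ^^ m) x + (V r ^^ m) y"
  using bounded_linear_power bounded_linear.linear linear_add by metis

lemma power_scaleR: "r > 0 \<Longrightarrow> (V r ^^ m) (c *\<^sub>R x) = c *\<^sub>R (V r ^^ m) x"
  using bounded_linear_power bounded_linear.linear linear_scale by metis

lemma power_bound:
  assumes "r > 0" "r * real m \<le> S"
  shows "norm ((V r ^^ m) x) \<le> K S * norm x"
proof -
  have "norm ((V r ^^ m) x) \<le> K (r * real m) * norm x" using stable[OF assms(1)] by (simp add: K_def)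
  also have "\<dots> \<le> K S * norm x" using K_mono[OF assms(2)] by (rule mult_right_mono) simp
  finally show ?thesis .
qed

lemma G_approx:
  assumes "(x, y) \<in> G" "\<delta> > 0"
  obtains x' y' where "(x', y') \<in> L" "norm (x - x') < \<delta>" "norm (y - y') < \<delta>"
proof -
  obtain z where z: "z \<in> L" "dist z (x, y) < \<delta>" using assms closure_approachable by blast
  obtain x' y' where [simp]: "z = (x', y')" by fastforce
  have "dist x' x \<le> dist z (x, y)" "dist y' y \<le> dist z (x, y)"
    using dist_fst_le[of z "(x, y)"] dist_snd_le[of z "(x, y)"] by auto
  then show ?thesis using that[of x' y'] z by (simp add: dist_norm norm_minus_commute)
qed

lemma power_sub_id: "r > 0 \<Longrightarrow> (V r ^^ m) x - x = (\<Sum>i<m. (V r ^^ i) (V r x - x))"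
  using sum_lessThan_telescope[of "\<lambda>i. (V r ^^ i) x" m] by (simp add: power_diff funpow_swap1)

lemma step_le:
  assumes "r > 0" "r * real m \<le> S" "i < m"
  shows "r * real i \<le> S"
proof -
  have "r * real i \<le> r * real m" using assms by (intro mult_left_mono) auto
  then show ?thesis using assms(2) by linarith
qed

lemma norm_sum_power_le:
  assumes "r > 0" "r * real m \<le> S" "d \<ge> 0" "\<And>i. i < m \<Longrightarrow> norm (u i) \<le> d"
  shows "norm (r *\<^sub>R (\<Sum>i<m. u i)) \<le> r * real m * d"
proof -
  have "norm (\<Sum>i<m. u i) \<le> real m * d"
    using sum_norm_bound[of "{..<m}" u d] assms(4) by simp
  then show ?thesis using assms(1) by (simp add: mult_left_mono mult.assoc)
qed

text \<open>Discrete counterpart of integrating the orbit of \<open>y\<close>. Telescoping gives it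
  exactly at a nearby \<open>(x', y')\<close> in \<open>L\<close>, with the difference quotient in
  place of \<open>y'\<close>, since consistency is available only on \<open>L\<close>; stability
  makes the remaining errors uniform in \<open>m\<close>.\<close>

lemma power_integral_approx:
  assumes xy: "(x, y) \<in> G" and "S \<ge> 0" "\<epsilon> > 0"
  shows "\<forall>\<^sub>F r in at_right 0. \<forall>m. r * real m \<le> S \<longrightarrow>
    norm ((V r ^^ m) x - x - r *\<^sub>R (\<Sum>i<m. (V r ^^ i) y)) \<le> \<epsilon>"
proof -
  define k where "k = K S"
  have k: "k \<ge> 1" using K_ge_1[OF \<open>S \<ge> 0\<close>] by (simp add: k_def)
  \<comment> \<open>Four errors share \<open>\<epsilon>\<close>: the power at \<open>x - x'\<close>,
    the vector \<open>x - x'\<close> itself, and two sums over total time at most \<open>S\<close>,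
    for \<open>y - y'\<close> and for the consistency defect \<open>D\<close>.\<close>
  define \<delta> where "\<delta> = \<epsilon> / (k + 1 + 2 * (S * k))"
  have pos: "k + 1 + 2 * (S * k) > 0" using k \<open>S \<ge> 0\<close> by (simp add: add_pos_nonneg)
  have "\<delta> > 0" using \<open>\<epsilon> > 0\<close> pos by (simp add: \<delta>_def)
  obtain x' y' where xy': "(x', y') \<in> L" "norm (x - x') < \<delta>" "norm (y - y') < \<delta>"
    using G_approx[OF xy \<open>\<delta> > 0\<close>] by blast
  have "\<forall>\<^sub>F r in at_right 0. dist ((V r x' - x') /\<^sub>R r) y' < \<delta>"
    using consistent[OF xy'(1)] \<open>\<delta> > 0\<close> by (rule tendstoD)
  then show ?thesis using eventually_at_right_less
  proof eventually_elim
    case (elim r)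
    then have "r > 0" by simp
    define D where "D = (V r x' - x') /\<^sub>R r - y'"
    have D: "norm D < \<delta>" using elim by (simp add: D_def dist_norm)
    have VD: "V r x' - x' = r *\<^sub>R (D + y')" using \<open>r > 0\<close> by (simp add: D_def)
    show ?case
    proof (intro allI impI)
      fix m assume m: "r * real m \<le> S"
      have rS: "r * real i \<le> S" if "i < m" for i
        by (rule step_le[OF \<open>r > 0\<close> m that])
      have pb: "norm ((V r ^^ i) u) \<le> k * \<delta>" if "i < m" "norm u < \<delta>" for i u
        using power_bound[OF \<open>r > 0\<close> rS[OF that(1)], of u, folded k_def] that(2) k
          mult_left_mono[of "norm u" \<delta> k] by linarith
      have "(V r ^^ m) x' - x' = r *\<^sub>R (\<Sum>i<m. (V r ^^ i) (D + y'))"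
        using \<open>r > 0\<close> by (simp add: power_sub_id VD power_scaleR scaleR_sum_right)
      then have eq: "(V r ^^ m) x - x - r *\<^sub>R (\<Sum>i<m. (V r ^^ i) y) =
          (V r ^^ m) (x - x') - (x - x') - r *\<^sub>R (\<Sum>i<m. (V r ^^ i) (y - y'))
            + r *\<^sub>R (\<Sum>i<m. (V r ^^ i) D)"
        using \<open>r > 0\<close> by (simp add: power_diff power_plus sum.distrib sum_subtractf algebra_simps)
      have 1: "norm ((V r ^^ m) (x - x')) \<le> k * \<delta>"
        using power_bound[OF \<open>r > 0\<close> m, of "x - x'", folded k_def] xy'(2) k
          mult_left_mono[of "norm (x - x')" \<delta> k] by linarith
      have rm: "r * real m * (k * \<delta>) \<le> S * (k * \<delta>)"
        using m k \<open>\<delta> > 0\<close> by (intro mult_right_mono) auto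
      have 2: "norm (r *\<^sub>R (\<Sum>i<m. (V r ^^ i) u)) \<le> S * (k * \<delta>)" if "norm u < \<delta>" for u
        using k \<open>\<delta> > 0\<close> pb[OF _ that] by (intro order_trans[OF norm_sum_power_le[OF \<open>r > 0\<close> m] rm]) auto
      have "norm ((V r ^^ m) x - x - r *\<^sub>R (\<Sum>i<m. (V r ^^ i) y)) \<le>
          norm ((V r ^^ m) (x - x')) + norm (x - x') + norm (r *\<^sub>R (\<Sum>i<m. (V r ^^ i) (y - y')))
            + norm (r *\<^sub>R (\<Sum>i<m. (V r ^^ i) D))"
        unfolding eq by (smt (verit) norm_triangle_ineq norm_triangle_ineq4)
      also have "\<dots> \<le> k * \<delta> + \<delta> + S * (k * \<delta>) + S * (k * \<delta>)"
        using 1 2[OF xy'(3)] 2[OF D] xy'(2) by linarith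
      also have "\<dots> = (k + 1 + 2 * (S * k)) * \<delta>" by (simp add: algebra_simps)
      also have "\<dots> = \<epsilon>" using pos by (simp add: \<delta>_def)
      finally show "norm ((V r ^^ m) x - x - r *\<^sub>R (\<Sum>i<m. (V r ^^ i) y)) \<le> \<epsilon>" .
    qed
  qed
qed

lemma power_diff_id_bound:
  assumes xy: "(x, y) \<in> G" and "S \<ge> 0" "\<epsilon> > 0"
  shows "\<forall>\<^sub>F r in at_right 0. \<forall>m. r * real m \<le> S \<longrightarrow>
    norm ((V r ^^ m) x - x) \<le> K S * (r * real m) * norm y + \<epsilon>"
  using power_integral_approx[OF assms] eventually_at_right_less
proof eventually_elim
  case (elim r)
  show ?case
  proof (intro allI impI)
    fix m assume m: "r * real m \<le> S"
    have "r * real i \<le> S" if "i < m" for i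
      by (rule step_le[OF elim(2) m that])
    then have "norm (r *\<^sub>R (\<Sum>i<m. (V r ^^ i) y)) \<le> r * real m * (K S * norm y)"
      using power_bound[OF elim(2)] K_ge_1[OF \<open>S \<ge> 0\<close>] by (intro norm_sum_power_le[OF elim(2) m]) auto
    moreover have "norm ((V r ^^ m) x - x - r *\<^sub>R (\<Sum>i<m. (V r ^^ i) y)) \<le> \<epsilon>" using elim(1) m by blast
    ultimately show "norm ((V r ^^ m) x - x) \<le> K S * (r * real m) * norm y + \<epsilon>"
      using norm_triangle_sub[of "(V r ^^ m) x - x" "r *\<^sub>R (\<Sum>i<m. (V r ^^ i) y)"]
      by (simp add: algebra_simps)
  qed
qed

text \<open>Equicontinuity in time. Pulling out the smaller power costs one factor
  \<open>K S\<close> and bounding the drift of the remaining power another, whence the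
  square.\<close>

lemma power_shift_bound:
  assumes xy: "(x, y) \<in> G" and "S \<ge> 0" "\<epsilon> > 0"
  shows "\<forall>\<^sub>F r in at_right 0. \<forall>p q. r * real p \<le> S \<longrightarrow> r * real q \<le> S \<longrightarrow>
    norm ((V r ^^ p) x - (V r ^^ q) x) \<le> (K S)\<^sup>2 * \<bar>r * real p - r * real q\<bar> * norm y + \<epsilon>"
proof -
  have k: "K S \<ge> 1" by (rule K_ge_1[OF \<open>S \<ge> 0\<close>])
  then have "\<epsilon> / K S > 0" using \<open>\<epsilon> > 0\<close> by simp
  show ?thesis
    using power_diff_id_bound[OF xy \<open>S \<ge> 0\<close> \<open>\<epsilon> / K S > 0\<close>] eventually_at_right_less
  proof eventually_elim
    case (elim r)
    have *: "norm ((V r ^^ p) x - (V r ^^ q) x) \<le> (K S)\<^sup>2 * \<bar>r * real p - r * real q\<bar> * norm y + \<epsilon>"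
      if "q \<le> p" "r * real p \<le> S" "r * real q \<le> S" for p q
    proof -
      have d: "r * real (p - q) = r * real p - r * real q" "r * real q \<ge> 0"
        using that(1) elim(2) by (auto simp: of_nat_diff right_diff_distrib)
      have "(V r ^^ p) x - (V r ^^ q) x = (V r ^^ q) ((V r ^^ (p - q)) x - x)"
        using that(1) elim(2) by (simp add: power_diff flip: funpow_add[THEN fun_cong, unfolded comp_apply])
      then have "norm ((V r ^^ p) x - (V r ^^ q) x) \<le> K S * norm ((V r ^^ (p - q)) x - x)"
        using power_bound[OF elim(2) that(3)] by simp
      also have "\<dots> \<le> K S * (K S * (r * real (p - q)) * norm y + \<epsilon> / K S)"
        using elim(1)[rule_format, of "p - q"] d that(2) k by (intro mult_left_mono) linarith+
      also have "\<dots> = (K S)\<^sup>2 * \<bar>r * real p - r * real q\<bar> * norm y + \<epsilon>"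
        using k d(1) that(1) elim(2) by (simp add: distrib_left power2_eq_square mult_left_mono)
      finally show ?thesis .
    qed
    show ?case
    proof (intro allI impI)
      fix p q assume "r * real p \<le> S" "r * real q \<le> S"
      then show "norm ((V r ^^ p) x - (V r ^^ q) x) \<le> (K S)\<^sup>2 * \<bar>r * real p - r * real q\<bar> * norm y + \<epsilon>"
        using *[of q p] *[of p q] by (cases "q \<le> p") (auto simp: norm_minus_commute abs_minus_commute)
    qed
  qed
qed

text \<open>Subtracting \<open>(r * m) *\<^sub>R y\<close> from the discrete integral leaves a sum
  of drifts \<open>(V r ^^ i) y - y\<close>. Their bound \<open>b\<close> stays a parameter: it is
  of order \<open>h\<close> in \<open>power_second_order\<close>, and arbitrarily small, for general
  \<open>y\<close>, in \<open>G_subset_generator_W\<close>.\<close>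

lemma power_first_order:
  assumes xy: "(x, y) \<in> G" and "S \<ge> 0" "b \<ge> 0" "\<epsilon> > 0"
    and near: "\<forall>\<^sub>F r in at_right 0. \<forall>m. r * real m \<le> S \<longrightarrow> norm ((V r ^^ m) y - y) \<le> b"
  shows "\<forall>\<^sub>F r in at_right 0. \<forall>m. r * real m \<le> S \<longrightarrow>
    norm ((V r ^^ m) x - x - (r * real m) *\<^sub>R y) \<le> r * real m * b + \<epsilon>"
  using power_integral_approx[OF xy \<open>S \<ge> 0\<close> \<open>\<epsilon> > 0\<close>] near eventually_at_right_less
proof eventually_elim
  case (elim r)
  show ?case
  proof (intro allI impI)
    fix m assume m: "r * real m \<le> S"
    have "r * real i \<le> S" if "i < m" for i
      by (rule step_le[OF elim(3) m that])
    then have 1: "norm (r *\<^sub>R (\<Sum>i<m. (V r ^^ i) y - y)) \<le> r * real m * b"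
      using elim(2) \<open>b \<ge> 0\<close> by (intro norm_sum_power_le[OF elim(3) m]) auto
    have 2: "norm ((V r ^^ m) x - x - r *\<^sub>R (\<Sum>i<m. (V r ^^ i) y)) \<le> \<epsilon>" using elim(1) m by blast
    have "(V r ^^ m) x - x - (r * real m) *\<^sub>R y =
        ((V r ^^ m) x - x - r *\<^sub>R (\<Sum>i<m. (V r ^^ i) y)) + r *\<^sub>R (\<Sum>i<m. (V r ^^ i) y - y)"
      by (simp add: sum_subtractf scaleR_diff_right sum_constant_scaleR)
    then show "norm ((V r ^^ m) x - x - (r * real m) *\<^sub>R y) \<le> r * real m * b + \<epsilon>"
      using 1 2 norm_triangle_ineq by (smt (verit))
  qed
qed

lemma power_second_order:
  assumes xy: "(x, y) \<in> G" and yz: "(y, z) \<in> G" and "h \<ge> 0" "\<epsilon> > 0"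
  shows "\<forall>\<^sub>F r in at_right 0. \<forall>m. r * real m \<le> h \<longrightarrow>
    norm ((V r ^^ m) x - x - (r * real m) *\<^sub>R y) \<le> K h * norm z * h\<^sup>2 + \<epsilon>"
proof -
  define \<epsilon>' where "\<epsilon>' = \<epsilon> / (2 * (h + 1))"
  have "\<epsilon>' > 0" using \<open>\<epsilon> > 0\<close> \<open>h \<ge> 0\<close> by (simp add: \<epsilon>'_def)
  have k: "K h \<ge> 1" by (rule K_ge_1[OF \<open>h \<ge> 0\<close>])
  define b where "b = K h * h * norm z + \<epsilon>'"
  have "b \<ge> 0" using k \<open>h \<ge> 0\<close> \<open>\<epsilon>' > 0\<close> by (simp add: b_def)
  have "\<forall>\<^sub>F r in at_right 0. \<forall>m. r * real m \<le> h \<longrightarrow> norm ((V r ^^ m) y - y) \<le> b"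
    using power_diff_id_bound[OF yz \<open>h \<ge> 0\<close> \<open>\<epsilon>' > 0\<close>]
  proof eventually_elim
    case (elim r)
    show ?case
    proof (intro allI impI)
      fix m assume m: "r * real m \<le> h"
      have "K h * (r * real m) * norm z \<le> K h * h * norm z"
        using m k by (intro mult_right_mono mult_left_mono) auto
      then show "norm ((V r ^^ m) y - y) \<le> b" using elim m by (force simp: b_def)
    qed
  qed
  from power_first_order[OF xy \<open>h \<ge> 0\<close> \<open>b \<ge> 0\<close> half_gt_zero[OF \<open>\<epsilon> > 0\<close>] this]
  show ?thesis
  proof eventually_elim
    case (elim r)
    show ?case
    proof (intro allI impI)
      fix m assume m: "r * real m \<le> h"
      have "r * real m * b \<le> h * b" using m \<open>b \<ge> 0\<close> by (rule mult_right_mono)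
      also have "h * b \<le> K h * norm z * h\<^sup>2 + \<epsilon> / 2"
        using \<open>h \<ge> 0\<close> \<open>\<epsilon> > 0\<close> by (simp add: b_def \<epsilon>'_def power2_eq_square field_simps)
      finally show "norm ((V r ^^ m) x - x - (r * real m) *\<^sub>R y) \<le> K h * norm z * h\<^sup>2 + \<epsilon>"
        using elim[rule_format, OF m] by simp
    qed
  qed
qed

text \<open>The defect made in block \<open>j\<close> is carried on by a single power of
  \<open>V r\<close>, bounded by \<open>K S\<close>. Hence \<open>K S\<close> enters once and not to
  the power \<open>k\<close>.\<close>

lemma power_telescope_bound:
  assumes "r > 0" "r * real (k * m) \<le> S" "S \<ge> 0" "d \<ge> 0"
    and step: "\<And>j. j < k \<Longrightarrow> norm ((V r ^^ m) (z j) - z (Suc j)) \<le> d"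
  shows "norm ((V r ^^ (k * m)) (z 0) - z k) \<le> real k * (K S * d)"
proof -
  have "(\<Sum>j<k. (V r ^^ ((k - Suc j) * m)) ((V r ^^ m) (z j) - z (Suc j)))
      = (\<Sum>j<k. (V r ^^ ((k - j) * m)) (z j) - (V r ^^ ((k - Suc j) * m)) (z (Suc j)))"
  proof (rule sum.cong)
    fix j assume "j \<in> {..<k}"
    then have "(k - j) * m = (k - Suc j) * m + m"
      by (metis Suc_diff_Suc add.commute lessThan_iff mult_Suc)
    then show "(V r ^^ ((k - Suc j) * m)) ((V r ^^ m) (z j) - z (Suc j)) =
        (V r ^^ ((k - j) * m)) (z j) - (V r ^^ ((k - Suc j) * m)) (z (Suc j))"
      using \<open>r > 0\<close> by (simp add: power_diff funpow_add)
  qed simp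
  also have "\<dots> = (V r ^^ (k * m)) (z 0) - z k"
    using sum_lessThan_telescope'[of "\<lambda>j. (V r ^^ ((k - j) * m)) (z j)" k] by simp
  finally have eq: "(V r ^^ (k * m)) (z 0) - z k =
      (\<Sum>j<k. (V r ^^ ((k - Suc j) * m)) ((V r ^^ m) (z j) - z (Suc j)))" by simp
  have "norm ((V r ^^ ((k - Suc j) * m)) ((V r ^^ m) (z j) - z (Suc j))) \<le> K S * d" if "j < k" for j
  proof -
    have "real ((k - Suc j) * m) \<le> real (k * m)" by (simp only: of_nat_le_iff mult_le_mono1 diff_le_self)
    then have "r * real ((k - Suc j) * m) \<le> S"
      using assms(1,2) by (smt (verit) mult_left_mono)
    then have "norm ((V r ^^ ((k - Suc j) * m)) ((V r ^^ m) (z j) - z (Suc j)))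
        \<le> K S * norm ((V r ^^ m) (z j) - z (Suc j))"
      by (rule power_bound[OF \<open>r > 0\<close>])
    also have "\<dots> \<le> K S * d" using step[OF that] K_ge_1[OF \<open>S \<ge> 0\<close>] by (intro mult_left_mono) auto
    finally show ?thesis .
  qed
  then show ?thesis unfolding eq
    using sum_norm_bound[of "{..<k}" "\<lambda>j. (V r ^^ ((k - Suc j) * m)) ((V r ^^ m) (z j) - z (Suc j))" "K S * d"]
    by simp
qed

end


subsection \<open>Resolvents\<close>

lemma tendsto_exp_quotient:
  fixes a :: real
  shows "((\<lambda>r. (exp (a * r) - 1) / r) \<longlongrightarrow> a) (at_right 0)"
proof -
  have "((\<lambda>r. exp (a * r)) has_field_derivative a) (at 0)"
    by (auto intro!: derivative_eq_intros)
  then have "((\<lambda>r. (exp (a * r) - 1) / r) \<longlongrightarrow> a) (at 0)"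
    by (simp add: DERIV_def)
  then show ?thesis by (rule tendsto_within_subset) auto
qed

text \<open>Turns the factors \<open>1 / (1 - a * h)\<close> of resolvent powers into exponential
  growth at the doubled rate; the restriction to \<open>1 / 2\<close> reappears in
  \<open>admissible_step\<close>.\<close>

lemma inverse_one_minus_le_exp:
  fixes u :: real
  assumes "0 \<le> u" "u \<le> 1 / 2"
  shows "1 / (1 - u) \<le> exp (2 * u)"
proof -
  have "1 \<le> (1 + 2 * u) * (1 - u)" using assms mult_left_mono[of "2 * u" 1 u] by (simp add: algebra_simps)
  also have "\<dots> \<le> exp (2 * u) * (1 - u)"
    using assms exp_ge_add_one_self[of "2 * u"] by (intro mult_right_mono) auto
  finally show ?thesis using assms by (simp add: field_simps)
qed

context chernoff_family
begin

(* dominates x c: the limit superior as r \<rightarrow> 0 of the equivalent norms SUP m. exp (- a r m) * norm ((V r ^^ m) x)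
   is at most c. In such a norm V r is bounded by exp (a r), so the resolvent estimate has no constant M and
   can be iterated; iterating it for the original norm would produce powers of M. *)
definition dominates :: "'a \<Rightarrow> real \<Rightarrow> bool" where
  "dominates x c \<longleftrightarrow> (\<forall>\<epsilon>>0. \<forall>\<^sub>F r in at_right 0. \<forall>m.
     norm ((V r ^^ m) x) \<le> exp (a * (r * real m)) * (c + \<epsilon>))"

lemma dominates_norm: "dominates x (M * norm x)"
  unfolding dominates_def
proof (intro allI impI)
  fix \<epsilon> :: real assume "\<epsilon> > 0"
  show "\<forall>\<^sub>F r in at_right 0. \<forall>m. norm ((V r ^^ m) x) \<le> exp (a * (r * real m)) * (M * norm x + \<epsilon>)"
    using eventually_at_right_less
  proof eventually_elim
    case (elim r)
    show ?case
    proof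
      fix m
      have "norm ((V r ^^ m) x) \<le> exp (a * (r * real m)) * (M * norm x)"
        using stable[OF elim, of m x] by (simp add: mult_ac)
      also have "\<dots> \<le> exp (a * (r * real m)) * (M * norm x + \<epsilon>)"
        using \<open>\<epsilon> > 0\<close> by simp
      finally show "norm ((V r ^^ m) x) \<le> exp (a * (r * real m)) * (M * norm x + \<epsilon>)" .
    qed
  qed
qed

lemma norm_le_if_dominates:
  assumes "dominates x c"
  shows "norm x \<le> c"
proof (rule field_le_epsilon)
  fix \<epsilon> :: real assume "\<epsilon> > 0"
  then have "\<forall>\<^sub>F r in at_right (0::real). \<forall>m. norm ((V r ^^ m) x) \<le> exp (a * (r * real m)) * (c + \<epsilon>)"
    using assms by (simp add: dominates_def)
  then have "\<forall>\<^sub>F r in at_right (0::real). norm x \<le> c + \<epsilon>"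
    by eventually_elim (use funpow_0 in \<open>force dest: spec[of _ "0::nat"]\<close>)
  then show "norm x \<le> c + \<epsilon>" by simp
qed

text \<open>With \<open>D\<close> the difference quotient of \<open>V r\<close> at a nearby
  \<open>x'\<close> and \<open>g = x' - h *\<^sub>R D\<close>, one has exactly
  \<open>(1 + r / h) *\<^sub>R x' = V r x' + (r / h) *\<^sub>R g\<close>. In the equivalent norm
  belonging to \<open>r\<close>, \<open>V r\<close> is bounded by \<open>exp (a * r)\<close>, so the
  norm \<open>B\<close> of \<open>x'\<close> satisfies a linear inequality that can be solved; its
  coefficient tends to \<open>1 - a * h\<close>.\<close>

lemma dominates_resolvent:
  assumes xy: "(x, y) \<in> G" and h: "h > 0" "a * h < 1" and dom: "dominates (x - h *\<^sub>R y) c"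
  shows "dominates x (c / (1 - a * h))"
  unfolding dominates_def
proof (intro allI impI)
  fix \<epsilon> :: real assume "\<epsilon> > 0"
  define \<theta> where "\<theta> = 1 - a * h"
  have "\<theta> > 0" using h by (simp add: \<theta>_def)
  have "c \<ge> 0" using norm_le_if_dominates[OF dom] norm_ge_zero order_trans by blast
  \<comment> \<open>Chosen so that \<open>M * \<delta> * (1 + 2 * h)\<close>, the cost of passing
    from \<open>x - h *\<^sub>R y\<close> to \<open>g\<close>, is at most a quarter of both
    \<open>\<epsilon>\<close> and \<open>\<epsilon> * \<theta>\<close>; the latter is needed because
    the result is divided by \<open>\<theta>\<close>.\<close>
  define \<delta> where "\<delta> = \<epsilon> * min 1 \<theta> / (4 * M * (1 + 2 * h))"
  have den: "4 * M * (1 + 2 * h) > 0" using M_ge_1 h by simp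
  have "\<delta> > 0" using \<open>\<epsilon> > 0\<close> \<open>\<theta> > 0\<close> den by (simp add: \<delta>_def)
  have \<delta>_eq: "M * \<delta> * (1 + 2 * h) = \<epsilon> * min 1 \<theta> / 4"
    using den by (simp add: \<delta>_def field_simps)
  have M\<delta>: "M * \<delta> \<le> \<epsilon> / 4"
  proof -
    have "M * \<delta> * 1 \<le> M * \<delta> * (1 + 2 * h)" using M_ge_1 \<open>\<delta> > 0\<close> h by (intro mult_left_mono) auto
    also have "\<dots> \<le> \<epsilon> / 4" unfolding \<delta>_eq using \<open>\<epsilon> > 0\<close> by (simp add: min_def)
    finally show ?thesis by simp
  qed
  define c1 where "c1 = c + \<epsilon> * \<theta> / 4 + M * \<delta> * (1 + 2 * h)"
  have "c1 \<ge> 0" using \<open>c \<ge> 0\<close> \<open>\<epsilon> > 0\<close> \<open>\<theta> > 0\<close> \<open>\<delta> > 0\<close> M_ge_1 h by (simp add: c1_def)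
  have c1: "c1 / \<theta> \<le> c / \<theta> + \<epsilon> / 2"
  proof -
    have "\<epsilon> * min 1 \<theta> \<le> \<epsilon> * \<theta>" using \<open>\<epsilon> > 0\<close> by (intro mult_left_mono) auto
    then have "c1 \<le> c + \<epsilon> * \<theta> / 4 + \<epsilon> * \<theta> / 4" unfolding c1_def \<delta>_eq by simp
    then show ?thesis using \<open>\<theta> > 0\<close> by (simp add: field_simps)
  qed
  obtain x' y' where xy': "(x', y') \<in> L" "norm (x - x') < \<delta>" "norm (y - y') < \<delta>"
    using G_approx[OF xy \<open>\<delta> > 0\<close>] by blast
  have lim: "((\<lambda>r. c1 / (1 - h * ((exp (a * r) - 1) / r))) \<longlongrightarrow> c1 / \<theta>) (at_right 0)"
    unfolding \<theta>_def mult.commute[of a h]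
    using h by (intro tendsto_intros tendsto_exp_quotient) (auto simp: mult.commute)
  have lim0: "((\<lambda>r. 1 - h * ((exp (a * r) - 1) / r)) \<longlongrightarrow> \<theta>) (at_right 0)"
    unfolding \<theta>_def mult.commute[of a h] by (intro tendsto_intros tendsto_exp_quotient)
  have ev: "\<forall>\<^sub>F r in at_right 0. dist ((V r x' - x') /\<^sub>R r) y' < \<delta>"
    using consistent[OF xy'(1)] \<open>\<delta> > 0\<close> by (rule tendstoD)
  have "\<epsilon> * \<theta> / 4 > 0" using \<open>\<epsilon> > 0\<close> \<open>\<theta> > 0\<close> by simp
  with dom have "\<forall>\<^sub>F r in at_right 0. \<forall>m.
      norm ((V r ^^ m) (x - h *\<^sub>R y)) \<le> exp (a * (r * real m)) * (c + \<epsilon> * \<theta> / 4)"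
    by (simp add: dominates_def)
  moreover have "\<forall>\<^sub>F r in at_right 0. c1 / (1 - h * ((exp (a * r) - 1) / r)) < c1 / \<theta> + \<epsilon> / 4"
    using order_tendstoD(2)[OF lim] \<open>\<epsilon> > 0\<close> by simp
  moreover have "\<forall>\<^sub>F r in at_right 0. 1 - h * ((exp (a * r) - 1) / r) > 0"
    using order_tendstoD(1)[OF lim0 \<open>\<theta> > 0\<close>] .
  ultimately show "\<forall>\<^sub>F r in at_right 0. \<forall>m.
      norm ((V r ^^ m) x) \<le> exp (a * (r * real m)) * (c / (1 - a * h) + \<epsilon>)"
    using ev eventually_at_right_less
  proof eventually_elim
    case (elim r)
    then have r: "r > 0" by simp
    define D where "D = (V r x' - x') /\<^sub>R r"
    have D: "norm (D - y') < \<delta>" using elim by (simp add: D_def dist_norm)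
    have VD: "V r x' = x' + r *\<^sub>R D" using r by (simp add: D_def)
    define g where "g = x' - h *\<^sub>R D"
    have eq: "g - (x - h *\<^sub>R y) = (x' - x) + h *\<^sub>R (y - y') - h *\<^sub>R (D - y')"
      by (simp add: g_def algebra_simps)
    have "norm (g - (x - h *\<^sub>R y)) \<le> norm (x - x') + h * norm (y - y') + h * norm (D - y')"
      unfolding eq norm_minus_commute[of x x']
      using h(1) norm_triangle_ineq4[of "(x' - x) + h *\<^sub>R (y - y')" "h *\<^sub>R (D - y')"]
        norm_triangle_ineq[of "x' - x" "h *\<^sub>R (y - y')"] by simp
    also have "\<dots> \<le> \<delta> + h * \<delta> + h * \<delta>"
      using xy'(2,3) D h(1) by (intro add_mono mult_left_mono) auto
    finally have gd: "norm (g - (x - h *\<^sub>R y)) \<le> \<delta> * (1 + 2 * h)" by (simp add: algebra_simps)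
    have Vg: "norm ((V r ^^ m) g) \<le> exp (a * (r * real m)) * c1" for m
    proof -
      have "norm ((V r ^^ m) g) \<le> norm ((V r ^^ m) (x - h *\<^sub>R y)) + norm ((V r ^^ m) (g - (x - h *\<^sub>R y)))"
        using r norm_triangle_ineq[of "(V r ^^ m) (x - h *\<^sub>R y)" "(V r ^^ m) (g - (x - h *\<^sub>R y))"]
        by (simp add: power_diff)
      also have "norm ((V r ^^ m) (g - (x - h *\<^sub>R y))) \<le> M * exp (a * (r * real m)) * (\<delta> * (1 + 2 * h))"
        using M_ge_1 gd by (intro order_trans[OF stable[OF r]] mult_left_mono) auto
      also have "norm ((V r ^^ m) (x - h *\<^sub>R y)) \<le> exp (a * (r * real m)) * (c + \<epsilon> * \<theta> / 4)"
        using elim by blast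
      finally show ?thesis by (simp add: c1_def algebra_simps)
    qed
    \<comment> \<open>The weighted norms whose supremum \<open>B\<close> is the equivalent norm of
      \<open>x'\<close>. Stability makes \<open>B\<close> finite, without which the inequality for
      \<open>B\<close> could not be solved.\<close>
    define b where "b = (\<lambda>m. norm ((V r ^^ m) x') / exp (a * (r * real m)))"
    have b_le: "b m \<le> M * norm x'" for m
      using stable[OF r, of m x'] by (simp add: b_def field_simps)
    have bdd: "bdd_above (range b)" by (rule bdd_aboveI[of _ "M * norm x'"]) (use b_le in auto)
    define B where "B = (SUP m. b m)"
    have b_B: "b m \<le> B" for m unfolding B_def using bdd by (intro cSUP_upper) auto
    have rec: "(1 + r / h) * b m \<le> exp (a * r) * B + (r / h) * c1" for m
    proof -
      have "(1 + r / h) *\<^sub>R x' = V r x' + (r / h) *\<^sub>R g"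
        using h(1) by (simp add: VD g_def algebra_simps)
      then have "(V r ^^ m) ((1 + r / h) *\<^sub>R x') = (V r ^^ m) (V r x') + (r / h) *\<^sub>R (V r ^^ m) g"
        using r by (simp add: power_plus power_scaleR)
      then have "(1 + r / h) *\<^sub>R (V r ^^ m) x' = (V r ^^ Suc m) x' + (r / h) *\<^sub>R (V r ^^ m) g"
        using r by (simp add: power_scaleR funpow_swap1)
      then have "(1 + r / h) * norm ((V r ^^ m) x') = norm ((V r ^^ Suc m) x' + (r / h) *\<^sub>R (V r ^^ m) g)"
        using r h(1) by (metis abs_of_nonneg add_nonneg_nonneg divide_nonneg_nonneg less_imp_le norm_scaleR zero_le_one)
      also have "\<dots> \<le> norm ((V r ^^ Suc m) x') + (r / h) * norm ((V r ^^ m) g)"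
        using norm_triangle_ineq[of "(V r ^^ Suc m) x'" "(r / h) *\<^sub>R (V r ^^ m) g"] r h(1) by simp
      also have "\<dots> \<le> exp (a * (r * real m)) * exp (a * r) * B + (r / h) * (exp (a * (r * real m)) * c1)"
      proof (intro add_mono mult_left_mono)
        have "exp (a * (r * real (Suc m))) = exp (a * (r * real m)) * exp (a * r)"
          by (simp add: algebra_simps flip: exp_add)
        then show "norm ((V r ^^ Suc m) x') \<le> exp (a * (r * real m)) * exp (a * r) * B"
          using b_B[of "Suc m"] by (simp add: b_def field_simps)
      qed (use Vg r h in auto)
      finally show ?thesis by (simp add: b_def field_simps)
    qed
    have "(1 + r / h) * B \<le> exp (a * r) * B + (r / h) * c1"
    proof -
      have "B \<le> (exp (a * r) * B + (r / h) * c1) / (1 + r / h)"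
        unfolding B_def
      proof (rule cSUP_least)
        fix m
        show "b m \<le> (exp (a * r) * (SUP m. b m) + (r / h) * c1) / (1 + r / h)"
          using rec[of m] r h(1) unfolding B_def by (simp add: pos_le_divide_eq add_pos_pos mult.commute)
      qed simp
      then show ?thesis using r h(1) by (simp add: pos_le_divide_eq add_pos_pos mult.commute)
    qed
    then have "(h / r) * ((1 + r / h) * B - exp (a * r) * B) \<le> (h / r) * ((r / h) * c1)"
      using r h(1) by (intro mult_left_mono) auto
    moreover have "(h / r) * ((1 + r / h) * B - exp (a * r) * B) = B * (1 - h * ((exp (a * r) - 1) / r))"
      using r h(1) by (simp add: field_simps)
    ultimately have "B * (1 - h * ((exp (a * r) - 1) / r)) \<le> c1" using r h(1) by simp
    then have "B \<le> c1 / (1 - h * ((exp (a * r) - 1) / r))"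
      using elim(3) by (simp add: pos_le_divide_eq)
    then have B: "B \<le> c1 / \<theta> + \<epsilon> / 4" using elim(2) by simp
    show ?case
    proof
      fix m
      have "norm ((V r ^^ m) x) \<le> norm ((V r ^^ m) x') + norm ((V r ^^ m) (x - x'))"
        using r norm_triangle_ineq[of "(V r ^^ m) x'" "(V r ^^ m) (x - x')"] by (simp add: power_diff)
      also have "norm ((V r ^^ m) x') \<le> exp (a * (r * real m)) * B"
        using b_B[of m] by (simp add: b_def field_simps)
      also have "norm ((V r ^^ m) (x - x')) \<le> M * exp (a * (r * real m)) * \<delta>"
        using M_ge_1 xy'(2) by (intro order_trans[OF stable[OF r]] mult_left_mono) auto
      finally have "norm ((V r ^^ m) x) \<le> exp (a * (r * real m)) * (B + M * \<delta>)"
        by (simp add: algebra_simps)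
      also have "\<dots> \<le> exp (a * (r * real m)) * (c / \<theta> + \<epsilon>)"
        using B c1 M\<delta> by (intro mult_left_mono) auto
      finally show "norm ((V r ^^ m) x) \<le> exp (a * (r * real m)) * (c / (1 - a * h) + \<epsilon>)"
        by (simp add: \<theta>_def)
    qed
  qed
qed

lemma resolvent_bound:
  assumes "(x, y) \<in> G" "h > 0" "a * h < 1"
  shows "norm x \<le> M / (1 - a * h) * norm (x - h *\<^sub>R y)"
  using norm_le_if_dominates[OF dominates_resolvent[OF assms dominates_norm]] by simp

end

section \<open>Resolvents of \<open>G\<close> and the implicit Euler scheme\<close>

locale chernoff_generation = chernoff_family +
  fixes \<omega> :: real
  assumes dense_range: "\<mu> > \<omega> \<Longrightarrow> closure ((\<lambda>(x, y). \<mu> *\<^sub>R x - y) ` L) = UNIV"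
begin

definition admissible_step :: "real \<Rightarrow> bool" where
  "admissible_step h \<longleftrightarrow> h > 0 \<and> a * h \<le> 1 / 2 \<and> 1 / h > \<omega>"

lemma eventually_admissible_step: "\<forall>\<^sub>F h in at_right 0. admissible_step h"
proof -
  have "((\<lambda>h. a * h) \<longlongrightarrow> a * 0) (at_right 0)" by (intro tendsto_intros)
  then have "\<forall>\<^sub>F h in at_right 0. a * h < 1 / 2" by (rule order_tendstoD(2)) simp
  moreover have "\<forall>\<^sub>F h :: real in at_right 0. 1 / h > \<omega>"
    using filterlim_inverse_at_top_right[unfolded filterlim_at_top_dense] by (simp add: inverse_eq_divide)
  ultimately show ?thesis using eventually_at_right_less
    by eventually_elim (auto simp: admissible_step_def)
qed

text \<open>\<open>resolvent_bound\<close> transfers convergence from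
  \<open>X n - h *\<^sub>R Y n\<close> to \<open>X n\<close>, and \<open>Y n\<close> is determined
  by these two. So the range belonging to the closed graph \<open>G\<close> is closed, and density
  makes it everything.\<close>

lemma resolvent_exists:
  assumes "admissible_step h"
  shows "\<exists>x y. (x, y) \<in> G \<and> x - h *\<^sub>R y = v"
proof -
  have h: "h > 0" "a * h < 1" "1 / h > \<omega>" using assms by (auto simp: admissible_step_def)
  have "v /\<^sub>R h \<in> closure ((\<lambda>(x, y). (1 / h) *\<^sub>R x - y) ` L)" using dense_range[OF h(3)] by simp
  then obtain f where f: "\<And>n. f n \<in> (\<lambda>(x, y). (1 / h) *\<^sub>R x - y) ` L" "f \<longlonglongrightarrow> v /\<^sub>R h"
    unfolding closure_sequential by blast
  then have "\<forall>n. \<exists>x y. (x, y) \<in> L \<and> f n = (1 / h) *\<^sub>R x - y" by fastforce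
  then obtain X Y where XY: "\<And>n. (X n, Y n) \<in> L" "\<And>n. f n = (1 / h) *\<^sub>R X n - Y n" by metis
  define F where "F = (\<lambda>n. X n - h *\<^sub>R Y n)"
  have F: "F n = h *\<^sub>R f n" for n using h(1) by (simp add: F_def XY(2) scaleR_diff_right)
  have "(\<lambda>n. h *\<^sub>R f n) \<longlonglongrightarrow> h *\<^sub>R (v /\<^sub>R h)" by (intro tendsto_intros f)
  then have F_lim: "F \<longlonglongrightarrow> v" using h(1) by (simp add: F[abs_def])
  then have CF: "Cauchy F" by (simp add: LIMSEQ_imp_Cauchy)
  define C where "C = M / (1 - a * h)"
  have C: "C > 0" using h M_ge_1 by (simp add: C_def)
  have X_le: "norm (X m - X n) \<le> C * norm (F m - F n)" for m n
  proof -
    have "(X m - X n, Y m - Y n) \<in> G"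
      using subspace_diff[OF subspace_L XY(1)[of m] XY(1)[of n]] L_subset_G by auto
    from resolvent_bound[OF this h(1,2)] show ?thesis by (simp add: C_def F_def algebra_simps)
  qed
  have "Cauchy X" using CF C X_le by (rule Cauchy_lipschitz)
  then obtain x where x: "X \<longlonglongrightarrow> x" using Cauchy_convergent convergent_def by blast
  have "(\<lambda>n. (X n - F n) /\<^sub>R h) \<longlonglongrightarrow> (x - v) /\<^sub>R h" by (intro tendsto_intros x F_lim)
  moreover have "(\<lambda>n. (X n - F n) /\<^sub>R h) = Y" using h(1) by (simp add: F_def fun_eq_iff)
  ultimately have "(\<lambda>n. (X n, Y n)) \<longlonglongrightarrow> (x, (x - v) /\<^sub>R h)" using x by (intro tendsto_Pair) auto
  then have "(x, (x - v) /\<^sub>R h) \<in> G"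
    using XY(1) unfolding closure_sequential by (intro exI[of _ "\<lambda>n. (X n, Y n)"] conjI allI)
  then show ?thesis using h(1) by (intro exI[of _ x] exI[of _ "(x - v) /\<^sub>R h"]) simp
qed

lemma resolvent_unique:
  assumes "admissible_step h" "(x, y) \<in> G" "(x', y') \<in> G" "x - h *\<^sub>R y = x' - h *\<^sub>R y'"
  shows "x = x'" "y = y'"
proof -
  have h: "h > 0" "a * h < 1" using assms by (auto simp: admissible_step_def)
  have "(x - x', y - y') \<in> G" using subspace_diff[OF subspace_G assms(2,3)] by simp
  from resolvent_bound[OF this h] assms(4) show "x = x'" by (simp add: algebra_simps)
  then show "y = y'" using assms(4) h(1) by simp
qed

(* J h is the resolvent (1 - h G) ^ (-1), the step of the implicit Euler scheme. *)
definition J :: "real \<Rightarrow> 'a \<Rightarrow> 'a" where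
  "J h v = (SOME x. (x, (x - v) /\<^sub>R h) \<in> G)"

lemma J_in_G:
  assumes "admissible_step h"
  shows "(J h v, (J h v - v) /\<^sub>R h) \<in> G"
proof -
  obtain x y where xy: "(x, y) \<in> G" "x - h *\<^sub>R y = v" using resolvent_exists[OF assms] by blast
  then have "y = (x - v) /\<^sub>R h" using assms by (auto simp: admissible_step_def)
  then have "\<exists>x. (x, (x - v) /\<^sub>R h) \<in> G" using xy by blast
  then show ?thesis unfolding J_def by (rule someI_ex)
qed

text \<open>\<open>G\<close> commutes with its resolvent: \<open>w\<close> solves the resolvent
  equation for \<open>y\<close>, so uniqueness gives \<open>J h y = w\<close>.\<close>

lemma J_graph:
  assumes h: "admissible_step h" and xy: "(x, y) \<in> G"
  shows "(J h x, J h y) \<in> G" "J h x - x = h *\<^sub>R J h y"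
proof -
  have "h > 0" using h by (simp add: admissible_step_def)
  define w where "w = (J h x - x) /\<^sub>R h"
  have w: "J h x - x = h *\<^sub>R w" using \<open>h > 0\<close> by (simp add: w_def)
  have Jx: "(J h x, w) \<in> G" using J_in_G[OF h, of x] by (simp add: w_def)
  have "((J h x - x) /\<^sub>R h, (w - y) /\<^sub>R h) \<in> G"
    using subspace_scale[OF subspace_G subspace_diff[OF subspace_G Jx xy], of "inverse h"] by simp
  then have "(w, (w - y) /\<^sub>R h) \<in> G" by (simp add: w_def)
  from resolvent_unique(1)[OF h J_in_G[OF h, of y] this] \<open>h > 0\<close> have "J h y = w" by simp
  then show "(J h x, J h y) \<in> G" "J h x - x = h *\<^sub>R J h y" using Jx w by auto
qed

text \<open>Each resolvent step divides the constant in \<open>dominates\<close> by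
  \<open>1 - a * h\<close>; the factor \<open>M\<close> enters only at the start of the
  induction.\<close>

lemma J_power_bound:
  assumes "admissible_step h"
  shows "norm ((J h ^^ k) v) \<le> M * exp (2 * a * (h * real k)) * norm v"
proof -
  have h: "h > 0" "a * h < 1" "a * h \<le> 1 / 2" using assms by (auto simp: admissible_step_def)
  have "dominates ((J h ^^ k) v) (M * norm v / (1 - a * h) ^ k)"
  proof (induction k)
    case 0
    show ?case using dominates_norm by simp
  next
    case (Suc k)
    let ?u = "(J h ^^ k) v"
    have eq: "J h ?u - h *\<^sub>R ((J h ?u - ?u) /\<^sub>R h) = ?u" using h(1) by simp
    have "dominates (J h ?u) (M * norm v / (1 - a * h) ^ k / (1 - a * h))"
      by (intro dominates_resolvent[OF J_in_G[OF assms] h(1,2)]) (simp only: eq Suc.IH)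
    then show ?case by (simp add: mult.commute)
  qed
  then have "norm ((J h ^^ k) v) \<le> M * norm v * (1 / (1 - a * h)) ^ k"
    using norm_le_if_dominates by (fastforce simp: power_one_over divide_inverse power_inverse)
  also have "\<dots> \<le> M * norm v * exp (2 * (a * h)) ^ k"
    using inverse_one_minus_le_exp[of "a * h"] a_nonneg h M_ge_1
    by (intro mult_left_mono power_mono) auto
  also have "exp (2 * (a * h)) ^ k = exp (2 * a * (h * real k))"
    by (simp add: mult_ac flip: exp_of_nat_mult)
  finally show ?thesis by (simp add: mult_ac)
qed

text \<open>The domain of the square of \<open>G\<close>, on which local errors are of second
  order.\<close>

definition smooth :: "'a set" where
  "smooth = {x. \<exists>y z. (x, y) \<in> G \<and> (y, z) \<in> G}"

text \<open>For \<open>(x, y)\<close> in \<open>L\<close>, \<open>J h x\<close> is in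
  \<open>smooth\<close> and \<open>J h x - x = h *\<^sub>R J h y\<close> tends to 0, as
  \<open>J h y\<close> is bounded for admissible \<open>h\<close>.\<close>

lemma closure_smooth: "closure smooth = UNIV"
proof -
  have "x \<in> closure smooth" if "(x, y) \<in> L" for x y
    unfolding closure_approachable
  proof (intro allI impI)
    fix e :: real assume "e > 0"
    define B where "B = M * exp 1 * norm y"
    have "((\<lambda>h. h * B) \<longlongrightarrow> 0 * B) (at_right 0)" by (intro tendsto_intros)
    then have "\<forall>\<^sub>F h in at_right 0. h * B < e" using \<open>e > 0\<close> by (intro order_tendstoD(2)) auto
    then have "\<forall>\<^sub>F h in at_right 0. h * B < e \<and> admissible_step h"
      using eventually_admissible_step by eventually_elim simp
    then obtain h where h: "h * B < e" "admissible_step h" using eventually_happens' by force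
    then have "h > 0" "a * h \<le> 1 / 2" by (auto simp: admissible_step_def)
    have xy: "(x, y) \<in> G" using that L_subset_G by blast
    have "norm (J h y) \<le> M * exp (2 * a * h) * norm y" using J_power_bound[OF h(2), of 1 y] by simp
    also have "\<dots> \<le> B"
      unfolding B_def using \<open>a * h \<le> 1 / 2\<close> M_ge_1 by (intro mult_right_mono mult_left_mono) auto
    finally have "h * norm (J h y) \<le> h * B" using \<open>h > 0\<close> by simp
    moreover have "dist (J h x) x = h * norm (J h y)"
      using J_graph(2)[OF h(2) xy] \<open>h > 0\<close> by (simp add: dist_norm)
    ultimately have "dist (J h x) x < e" using h(1) by linarith
    moreover have "J h x \<in> smooth"
      unfolding smooth_def using J_graph(1)[OF h(2) xy] J_in_G[OF h(2), of y] by blast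
    ultimately show "\<exists>u\<in>smooth. dist u x < e" by blast
  qed
  then have "Domain L \<subseteq> closure smooth" by auto
  then have "closure (Domain L) \<subseteq> closure smooth" by (simp add: closure_minimal)
  then show ?thesis using dense_domain by auto
qed

end


subsection \<open>Convergence of the powers to a semigroup\<close>

context chernoff_family
begin

text \<open>General enough to treat the step \<open>t / n\<close> with power \<open>[n s]\<close>
  and the step \<open>s / n\<close> with power \<open>n\<close> alike. Only large \<open>n\<close>
  count, so the value of \<open>r 0\<close>, a division by zero in the applications, is
  harmless.\<close>

definition sampling :: "(nat \<Rightarrow> real) \<Rightarrow> (nat \<Rightarrow> nat) \<Rightarrow> real \<Rightarrow> bool" where
  "sampling r p \<sigma> \<longleftrightarrow> filterlim r (at_right 0) sequentially \<and> (\<lambda>n. r n * real (p n)) \<longlonglongrightarrow> \<sigma>"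

lemma sampling_eventually:
  assumes "sampling r p \<sigma>"
  shows "\<forall>\<^sub>F n in sequentially. r n > 0"
    and "\<sigma> < S \<Longrightarrow> \<forall>\<^sub>F n in sequentially. r n * real (p n) \<le> S"
    and "\<forall>\<^sub>F s in at_right 0. P s \<Longrightarrow> \<forall>\<^sub>F n in sequentially. P (r n)"
proof -
  have lim: "filterlim r (at_right 0) sequentially" "(\<lambda>n. r n * real (p n)) \<longlonglongrightarrow> \<sigma>"
    using assms by (auto simp: sampling_def)
  show ev: "\<forall>\<^sub>F n in sequentially. P (r n)" if "\<forall>\<^sub>F s in at_right 0. P s" for P
    using lim(1) that by (auto simp: filterlim_iff)
  show "\<forall>\<^sub>F n in sequentially. r n > 0" by (rule ev) (rule eventually_at_right_less)
  show "\<forall>\<^sub>F n in sequentially. r n * real (p n) \<le> S" if "\<sigma> < S"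
    using order_tendstoD(2)[OF lim(2) that] by eventually_elim simp
qed

lemma sampling_add:
  "sampling r p \<sigma> \<Longrightarrow> sampling r q \<tau> \<Longrightarrow> sampling r (\<lambda>n. p n + q n) (\<sigma> + \<tau>)"
  unfolding sampling_def by (auto simp: distrib_left intro: tendsto_add)

lemma sampling_floor:
  assumes "c > 0" "s \<ge> 0"
  shows "sampling (\<lambda>n. c / real n) (\<lambda>n. nat \<lfloor>real n * s\<rfloor>) (c * s)"
proof -
  have "(\<lambda>n. c / real n) \<longlonglongrightarrow> 0" by (rule lim_const_over_n)
  moreover have "\<forall>\<^sub>F n in sequentially. c / real n > 0"
    using eventually_gt_at_top[of 0] by eventually_elim (use assms in simp)
  ultimately have 1: "filterlim (\<lambda>n. c / real n) (at_right 0) sequentially"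
    by (rule tendsto_imp_filterlim_at_right)
  have "(\<lambda>n. c * s - c / real n) \<longlonglongrightarrow> c * s - 0" by (intro tendsto_intros lim_const_over_n)
  then have lower: "(\<lambda>n. c * s - c / real n) \<longlonglongrightarrow> c * s" by simp
  have "\<forall>\<^sub>F n in sequentially. c * s - c / real n \<le> c / real n * real (nat \<lfloor>real n * s\<rfloor>)"
    using eventually_gt_at_top[of 0]
  proof eventually_elim
    case (elim n)
    have "real n * s - 1 \<le> real (nat \<lfloor>real n * s\<rfloor>)" using assms(2) by (simp add: of_nat_nat)
    then have "c / real n * (real n * s - 1) \<le> c / real n * real (nat \<lfloor>real n * s\<rfloor>)"
      using assms(1) by (intro mult_left_mono) auto
    then show ?case using elim by (simp add: field_simps)
  qed
  moreover have "\<forall>\<^sub>F n in sequentially. c / real n * real (nat \<lfloor>real n * s\<rfloor>) \<le> c * s"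
    using eventually_gt_at_top[of 0]
  proof eventually_elim
    case (elim n)
    have "real (nat \<lfloor>real n * s\<rfloor>) \<le> real n * s" using assms(2) by (simp add: of_nat_nat)
    then have "c / real n * real (nat \<lfloor>real n * s\<rfloor>) \<le> c / real n * (real n * s)"
      using assms(1) by (intro mult_left_mono) auto
    then show ?case using elim by simp
  qed
  ultimately have "(\<lambda>n. c / real n * real (nat \<lfloor>real n * s\<rfloor>)) \<longlonglongrightarrow> c * s"
    using lower by (intro tendsto_sandwich[OF _ _ lower tendsto_const]) auto
  with 1 show ?thesis by (simp add: sampling_def)
qed

lemma sampling_const: "c > 0 \<Longrightarrow> sampling (\<lambda>n. c / real n) (\<lambda>n. n) c"
  using sampling_floor[of c 1] by simp

text \<open>The common core of two comparisons: \<open>z\<close> will be the Euler orbit, which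
  yields convergence, and the orbit of a given semigroup, which identifies the limit.
  \<open>y\<close> and \<open>w\<close> are the first and second images of \<open>z\<close> under
  \<open>G\<close>.\<close>

lemma power_near_approximate_orbit:
  fixes k :: nat
  assumes zy: "\<And>j. j \<le> k \<Longrightarrow> (z j, y j) \<in> G" and yw: "\<And>j. j \<le> k \<Longrightarrow> (y j, w j) \<in> G"
    and "h \<ge> 0" and B: "\<And>j. j \<le> k \<Longrightarrow> norm (w j) \<le> B"
    and step: "\<And>j. j < k \<Longrightarrow> norm (z (Suc j) - z j - h *\<^sub>R y j) \<le> B * h\<^sup>2"
    and samp: "sampling r p (real k * h)" and S: "real k * h < S" and "\<epsilon> > 0"
  shows "\<forall>\<^sub>F n in sequentially.
    norm ((V (r n) ^^ p n) (z 0) - z k) \<le> real k * (K S * ((K S + 1) * B * h\<^sup>2)) + \<epsilon>"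
proof -
  have "S > 0" using S \<open>h \<ge> 0\<close> by (smt (verit) mult_nonneg_nonneg of_nat_0_le_iff)
  have kS: "K S \<ge> 1" using K_ge_1 \<open>S > 0\<close> by simp
  have B0: "B \<ge> 0" using B[of 0] norm_ge_zero order_trans by blast
  define \<eta> where "\<eta> = \<epsilon> / (4 * (real k * K S + 1))"
  have den: "4 * (real k * K S + 1) > 0" using kS by (simp add: add_nonneg_pos)
  have "\<eta> > 0" using \<open>\<epsilon> > 0\<close> den by (simp add: \<eta>_def)
  have \<eta>_le: "real k * (K S * (2 * \<eta>)) \<le> \<epsilon> / 2"
    using \<open>\<epsilon> > 0\<close> den by (simp add: \<eta>_def field_simps)
  \<comment> \<open>\<open>m n\<close> steps of length \<open>r n\<close> nearly make up one step
    \<open>h\<close>, never exceeding it. The gap between \<open>k * m n\<close> and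
    \<open>p n\<close> is closed at the end by \<open>power_shift_bound\<close>.\<close>
  define m where "m = (\<lambda>n. nat \<lfloor>h / r n\<rfloor>)"
  \<comment> \<open>Local error of one block: \<open>K S * B * h\<^sup>2\<close> from the expansion
    of the power, \<open>B * h\<^sup>2\<close> from \<open>step\<close>, and one
    \<open>\<eta>\<close> each for the limit in \<open>r n\<close> and for \<open>r n * m n\<close>
    differing from \<open>h\<close>.\<close>
  define d where "d = (K S + 1) * B * h\<^sup>2 + 2 * \<eta>"
  have "d \<ge> 0" using kS B0 \<open>\<eta> > 0\<close> by (simp add: d_def)
  have lim: "filterlim r (at_right 0) sequentially" "(\<lambda>n. r n * real (p n)) \<longlonglongrightarrow> real k * h"
    using samp by (auto simp: sampling_def)
  have r0: "r \<longlonglongrightarrow> 0" using lim(1) by (simp add: filterlim_at)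
  note rpos = sampling_eventually(1)[OF samp]
  have m_bounds: "r n * real (m n) \<le> h" "h - r n \<le> r n * real (m n)" if "r n > 0" for n
  proof -
    have "h / r n \<ge> 0" using that \<open>h \<ge> 0\<close> by simp
    then have "real (m n) \<le> h / r n" "h / r n - 1 \<le> real (m n)"
      unfolding m_def by (simp_all add: of_nat_nat)
    then show "r n * real (m n) \<le> h" "h - r n \<le> r n * real (m n)"
      using that by (auto simp: field_simps)
  qed
  have rm: "(\<lambda>n. r n * real (m n)) \<longlonglongrightarrow> h"
  proof (rule tendsto_sandwich)
    show "\<forall>\<^sub>F n in sequentially. h - r n \<le> r n * real (m n)"
      using rpos by eventually_elim (rule m_bounds)
    show "\<forall>\<^sub>F n in sequentially. r n * real (m n) \<le> h"
      using rpos by eventually_elim (rule m_bounds)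
    show "(\<lambda>n. h - r n) \<longlonglongrightarrow> h" using tendsto_diff[OF tendsto_const r0] by simp
  qed simp
  have steps: "\<forall>\<^sub>F n in sequentially. \<forall>j\<in>{..<k}. norm ((V (r n) ^^ m n) (z j) - z (Suc j)) \<le> d"
  proof (intro eventually_ball_finite ballI)
    fix j assume "j \<in> {..<k}"
    then have j: "j < k" by simp
    have "(\<lambda>n. norm ((r n * real (m n) - h) *\<^sub>R y j)) \<longlonglongrightarrow> norm ((h - h) *\<^sub>R y j)"
      by (intro tendsto_intros rm)
    then have e1: "\<forall>\<^sub>F n in sequentially. norm ((r n * real (m n) - h) *\<^sub>R y j) < \<eta>"
      using \<open>\<eta> > 0\<close> by (intro order_tendstoD(2)) auto
    have j': "j \<le> k" using j by simp
    have e2: "\<forall>\<^sub>F n in sequentially. \<forall>q. r n * real q \<le> h \<longrightarrow>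
        norm ((V (r n) ^^ q) (z j) - z j - (r n * real q) *\<^sub>R y j) \<le> K h * norm (w j) * h\<^sup>2 + \<eta>"
      using power_second_order[OF zy[OF j'] yw[OF j'] \<open>h \<ge> 0\<close> \<open>\<eta> > 0\<close>]
      by (rule sampling_eventually(3)[OF samp])
    show "\<forall>\<^sub>F n in sequentially. norm ((V (r n) ^^ m n) (z j) - z (Suc j)) \<le> d"
      using e1 e2 rpos
    proof eventually_elim
      case (elim n)
      have hS: "h \<le> S"
      proof -
        have "1 * h \<le> real k * h" using j \<open>h \<ge> 0\<close> by (intro mult_right_mono) auto
        then show ?thesis using S by simp
      qed
      have "K h * norm (w j) * h\<^sup>2 \<le> K S * B * h\<^sup>2"
        using K_mono[OF hS] kS B[OF j'] B0 by (intro mult_right_mono mult_mono) auto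
      then have 1: "norm ((V (r n) ^^ m n) (z j) - z j - (r n * real (m n)) *\<^sub>R y j) \<le> K S * B * h\<^sup>2 + \<eta>"
        using elim(2)[rule_format, OF m_bounds(1)[OF elim(3)]] by linarith
      have eq: "(V (r n) ^^ m n) (z j) - z (Suc j) =
          ((V (r n) ^^ m n) (z j) - z j - (r n * real (m n)) *\<^sub>R y j)
          + (r n * real (m n) - h) *\<^sub>R y j - (z (Suc j) - z j - h *\<^sub>R y j)"
        by (simp add: algebra_simps)
      have "norm ((V (r n) ^^ m n) (z j) - z (Suc j)) \<le>
          norm ((V (r n) ^^ m n) (z j) - z j - (r n * real (m n)) *\<^sub>R y j)
          + norm ((r n * real (m n) - h) *\<^sub>R y j) + norm (z (Suc j) - z j - h *\<^sub>R y j)"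
        unfolding eq by (rule norm_add_diff_le)
      also have "\<dots> \<le> (K S * B * h\<^sup>2 + \<eta>) + \<eta> + B * h\<^sup>2"
        using 1 elim(1) step[OF j] by linarith
      also have "\<dots> = d" by (simp add: d_def algebra_simps)
      finally show ?case .
    qed
  qed simp
  have "\<epsilon> / 4 > 0" using \<open>\<epsilon> > 0\<close> by simp
  have shift: "\<forall>\<^sub>F n in sequentially. \<forall>q q'. r n * real q \<le> S \<longrightarrow> r n * real q' \<le> S \<longrightarrow>
      norm ((V (r n) ^^ q) (z 0) - (V (r n) ^^ q') (z 0))
        \<le> (K S)\<^sup>2 * \<bar>r n * real q - r n * real q'\<bar> * norm (y 0) + \<epsilon> / 4"
    using power_shift_bound[OF zy[of 0] _ \<open>\<epsilon> / 4 > 0\<close>, of S] \<open>S > 0\<close>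
    by (intro sampling_eventually(3)[OF samp]) auto
  have "(\<lambda>n. (K S)\<^sup>2 * \<bar>r n * real (p n) - real k * (r n * real (m n))\<bar> * norm (y 0))
      \<longlonglongrightarrow> (K S)\<^sup>2 * \<bar>real k * h - real k * h\<bar> * norm (y 0)"
    by (intro tendsto_intros lim rm)
  then have small: "\<forall>\<^sub>F n in sequentially.
      (K S)\<^sup>2 * \<bar>r n * real (p n) - real k * (r n * real (m n))\<bar> * norm (y 0) < \<epsilon> / 4"
    using \<open>\<epsilon> > 0\<close> by (intro order_tendstoD(2)) auto
  show ?thesis
    using steps shift small rpos sampling_eventually(2)[OF samp S]
  proof eventually_elim
    case (elim n)
    have rkm: "r n * real (k * m n) = real k * (r n * real (m n))" by simp
    also have "\<dots> \<le> real k * h" using m_bounds(1)[OF elim(4)] by (intro mult_left_mono) auto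
    finally have kmS: "r n * real (k * m n) \<le> S" using S by simp
    have "norm ((V (r n) ^^ (k * m n)) (z 0) - z k) \<le> real k * (K S * d)"
      using elim(1) \<open>S > 0\<close> \<open>d \<ge> 0\<close> by (intro power_telescope_bound[OF elim(4) kmS]) auto
    moreover have "norm ((V (r n) ^^ p n) (z 0) - (V (r n) ^^ (k * m n)) (z 0)) \<le> \<epsilon> / 4 + \<epsilon> / 4"
      using elim(2)[rule_format, OF elim(5) kmS] elim(3) unfolding rkm by linarith
    moreover have "real k * (K S * d) \<le> real k * (K S * ((K S + 1) * B * h\<^sup>2)) + \<epsilon> / 2"
      using \<eta>_le by (simp add: d_def distrib_left)
    ultimately show ?case
      using norm_triangle_ineq[of "(V (r n) ^^ p n) (z 0) - (V (r n) ^^ (k * m n)) (z 0)" "(V (r n) ^^ (k * m n)) (z 0) - z k"]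
      by simp
  qed
qed

text \<open>Extension from a dense set by uniform bounds, with one limit serving all samplings: the
  \<open>l i\<close> do not depend on \<open>r\<close> and \<open>p\<close>, and they form a Cauchy
  sequence.\<close>

lemma power_limit_dense:
  assumes "closure X = UNIV" and "\<sigma> \<ge> 0"
    and lim: "\<And>x. x \<in> X \<Longrightarrow> \<exists>l. \<forall>r p. sampling r p \<sigma> \<longrightarrow> (\<lambda>n. (V (r n) ^^ p n) x) \<longlonglongrightarrow> l"
  shows "\<exists>l. \<forall>r p. sampling r p \<sigma> \<longrightarrow> (\<lambda>n. (V (r n) ^^ p n) x) \<longlonglongrightarrow> l"
proof -
  define k where "k = K (\<sigma> + 1)"
  have k: "k \<ge> 1" using K_ge_1 \<open>\<sigma> \<ge> 0\<close> by (simp add: k_def)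
  have bound: "\<forall>\<^sub>F n in sequentially. \<forall>u. norm ((V (r n) ^^ p n) u) \<le> k * norm u"
    if "sampling r p \<sigma>" for r p
    using sampling_eventually(1)[OF that] sampling_eventually(2)[OF that, of "\<sigma> + 1", simplified]
    by eventually_elim (auto simp: k_def intro: power_bound)
  obtain f where f: "\<And>i. f i \<in> X" "f \<longlonglongrightarrow> x"
    using assms(1) closure_sequential[of x X] by auto
  obtain l where l: "\<And>i r p. sampling r p \<sigma> \<Longrightarrow> (\<lambda>n. (V (r n) ^^ p n) (f i)) \<longlonglongrightarrow> l i"
    using lim[OF f(1)] by metis
  have samp0: "sampling (\<lambda>n. 1 / real n) (\<lambda>n. nat \<lfloor>real n * \<sigma>\<rfloor>) \<sigma>"
    using sampling_floor[of 1 \<sigma>] \<open>\<sigma> \<ge> 0\<close> by simp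
  have l_le: "norm (l i - l j) \<le> k * norm (f i - f j)" for i j
  proof (rule tendsto_upperbound)
    show "(\<lambda>n. norm ((V (1 / real n) ^^ nat \<lfloor>real n * \<sigma>\<rfloor>) (f i) - (V (1 / real n) ^^ nat \<lfloor>real n * \<sigma>\<rfloor>) (f j)))
        \<longlonglongrightarrow> norm (l i - l j)"
      by (intro tendsto_intros l[OF samp0])
    show "\<forall>\<^sub>F n in sequentially. norm ((V (1 / real n) ^^ nat \<lfloor>real n * \<sigma>\<rfloor>) (f i) - (V (1 / real n) ^^ nat \<lfloor>real n * \<sigma>\<rfloor>) (f j))
        \<le> k * norm (f i - f j)"
      using bound[OF samp0] sampling_eventually(1)[OF samp0]
      by eventually_elim (simp flip: power_diff)
  qed simp
  have Cf: "Cauchy f" using f(2) by (rule LIMSEQ_imp_Cauchy)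
  have "Cauchy l" using Cf _ l_le by (rule Cauchy_lipschitz) (use k in simp)
  then obtain l' where l': "l \<longlonglongrightarrow> l'" using Cauchy_convergent convergent_def by blast
  have "(\<lambda>n. (V (r n) ^^ p n) x) \<longlonglongrightarrow> l'" if samp: "sampling r p \<sigma>" for r p
  proof (rule tendstoI)
    fix e :: real assume "e > 0"
    then have "e / (3 * k) > 0" "e / 3 > 0" using k by auto
    then have "\<forall>\<^sub>F i in sequentially. dist (f i) x < e / (3 * k)" "\<forall>\<^sub>F i in sequentially. dist (l i) l' < e / 3"
      using tendstoD[OF f(2) \<open>e / (3 * k) > 0\<close>] tendstoD[OF l' \<open>e / 3 > 0\<close>] by blast+
    then have "\<forall>\<^sub>F i in sequentially. dist (f i) x < e / (3 * k) \<and> dist (l i) l' < e / 3"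
      by (rule eventually_conj)
    then obtain i where i: "dist (f i) x < e / (3 * k)" "dist (l i) l' < e / 3"
      using eventually_happens' sequentially_bot by blast
    show "\<forall>\<^sub>F n in sequentially. dist ((V (r n) ^^ p n) x) l' < e"
      using bound[OF samp] sampling_eventually(1)[OF samp] tendstoD[OF l[OF samp, of i] \<open>e / 3 > 0\<close>]
    proof eventually_elim
      case (elim n)
      have "dist ((V (r n) ^^ p n) x) ((V (r n) ^^ p n) (f i)) \<le> k * dist x (f i)"
        using elim(1)[rule_format, of "x - f i"] elim(2) by (simp add: dist_norm power_diff)
      also have "\<dots> < e / 3" using i(1) k by (simp add: dist_commute field_simps)
      finally show ?case
        using dist_triangle[of "(V (r n) ^^ p n) x" l' "(V (r n) ^^ p n) (f i)"]
          dist_triangle[of "(V (r n) ^^ p n) (f i)" l' "l i"] elim(3) i(2) by linarith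
    qed
  qed
  then show ?thesis by blast
qed

end

context chernoff_generation
begin

text \<open>In the implicit scheme \<open>z (Suc j) - z j\<close> is \<open>h\<close> times the
  image at \<open>Suc j\<close>; comparing it with the image at \<open>j\<close> gives one more
  difference, hence the factor \<open>h\<^sup>2\<close>.\<close>

lemma euler_orbit:
  assumes xy: "(x, y) \<in> G" and yw: "(y, w) \<in> G" and "h = 0 \<or> admissible_step h"
  obtains z y' w' where "z 0 = x" "\<And>j. (z j, y' j) \<in> G" "\<And>j. (y' j, w' j) \<in> G"
    "\<And>j. z (Suc j) - z j - h *\<^sub>R y' j = h\<^sup>2 *\<^sub>R w' (Suc j)"
    "\<And>j. norm (w' j) \<le> M * exp (2 * a * (h * real j)) * norm w"
\<comment> \<open>The step 0, which occurs for \<open>\<sigma> = 0\<close>, has no resolvent; there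
  the orbit is constant.\<close>
proof (cases "h = 0")
  case True
  have "1 * norm w \<le> M * norm w" using M_ge_1 by (intro mult_right_mono) auto
  then show ?thesis using that[of "\<lambda>_. x" "\<lambda>_. y" "\<lambda>_. w"] xy yw True by simp
next
  case False
  then have h: "admissible_step h" using assms(3) by simp
  have in_G: "((J h ^^ j) u, (J h ^^ j) v) \<in> G" if "(u, v) \<in> G" for u v j
    using that by (induction j) (auto intro: J_graph(1)[OF h])
  have diff: "(J h ^^ Suc j) u - (J h ^^ j) u = h *\<^sub>R (J h ^^ Suc j) v" if "(u, v) \<in> G" for u v j
    using J_graph(2)[OF h in_G[OF that, of j]] by simp
  show ?thesis
  proof (rule that[of "\<lambda>j. (J h ^^ j) x" "\<lambda>j. (J h ^^ j) y" "\<lambda>j. (J h ^^ j) w"])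
    fix j
    have "(J h ^^ Suc j) x - (J h ^^ j) x - h *\<^sub>R (J h ^^ j) y
        = h *\<^sub>R ((J h ^^ Suc j) y - (J h ^^ j) y)"
      by (simp only: diff[OF xy] scaleR_diff_right)
    also have "\<dots> = h\<^sup>2 *\<^sub>R (J h ^^ Suc j) w" by (simp only: diff[OF yw] scaleR_scaleR power2_eq_square)
    finally show "(J h ^^ Suc j) x - (J h ^^ j) x - h *\<^sub>R (J h ^^ j) y = h\<^sup>2 *\<^sub>R (J h ^^ Suc j) w" .
  qed (use in_G xy yw J_power_bound[OF h] in auto)
qed

text \<open>\<open>u\<close> is an Euler approximation with a number \<open>k\<close> of steps fixed
  in advance. Its independence of the sampling is what makes all samplings share a limit. The error
  \<open>C / k\<close> is the sum of \<open>k\<close> local errors of order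
  \<open>\<sigma>\<^sup>2 / k\<^sup>2\<close>.\<close>

lemma power_near_euler:
  assumes "x \<in> smooth" "\<sigma> \<ge> 0" "e > 0"
  obtains u where "\<And>r p. sampling r p \<sigma> \<Longrightarrow> \<forall>\<^sub>F n in sequentially. dist ((V (r n) ^^ p n) x) u < e"
proof -
  obtain y w where xy: "(x, y) \<in> G" and yw: "(y, w) \<in> G" using assms(1) by (auto simp: smooth_def)
  define S where "S = \<sigma> + 1"
  define B where "B = M * exp (2 * a * S) * norm w"
  define C where "C = K S * ((K S + 1) * B * \<sigma>\<^sup>2)"
  have kS: "K S \<ge> 1" using K_ge_1 \<open>\<sigma> \<ge> 0\<close> by (simp add: S_def)
  have "B \<ge> 0" using M_ge_1 by (simp add: B_def)
  have "\<forall>\<^sub>F k in sequentially. C / real k < e / 2"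
    by (rule order_tendstoD(2)[OF lim_const_over_n]) (use \<open>e > 0\<close> in simp)
  moreover have "\<forall>\<^sub>F k in sequentially. \<sigma> / real k = 0 \<or> admissible_step (\<sigma> / real k)"
  proof (cases "\<sigma> = 0")
    case False
    then have "filterlim (\<lambda>k. \<sigma> / real k) (at_right 0) sequentially"
      using sampling_const[of \<sigma>] \<open>\<sigma> \<ge> 0\<close> by (simp add: sampling_def)
    then have "\<forall>\<^sub>F k in sequentially. admissible_step (\<sigma> / real k)"
      using eventually_admissible_step by (auto simp: filterlim_iff)
    then show ?thesis by eventually_elim simp
  qed simp
  ultimately have "\<forall>\<^sub>F k in sequentially. C / real k < e / 2 \<and> (\<sigma> / real k = 0 \<or> admissible_step (\<sigma> / real k)) \<and> k > 0"
    using eventually_gt_at_top[of 0] by eventually_elim blast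
  then obtain k :: nat where k: "C / real k < e / 2" "\<sigma> / real k = 0 \<or> admissible_step (\<sigma> / real k)" "k > 0"
    using eventually_happens' sequentially_bot by blast
  define h where "h = \<sigma> / real k"
  have kh: "real k * h = \<sigma>" using k(3) by (simp add: h_def)
  have "h \<ge> 0" using \<open>\<sigma> \<ge> 0\<close> by (simp add: h_def)
  obtain z y' w' where z: "z 0 = x" "\<And>j. (z j, y' j) \<in> G" "\<And>j. (y' j, w' j) \<in> G"
    "\<And>j. z (Suc j) - z j - h *\<^sub>R y' j = h\<^sup>2 *\<^sub>R w' (Suc j)"
    "\<And>j. norm (w' j) \<le> M * exp (2 * a * (h * real j)) * norm w"
    using euler_orbit[OF xy yw k(2)[folded h_def]] by blast
  have w'B: "norm (w' j) \<le> B" if "j \<le> k" for j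
  proof -
    have "h * real j \<le> h * real k" using that \<open>h \<ge> 0\<close> by (intro mult_left_mono) auto
    also have "\<dots> \<le> S" using kh by (simp add: mult.commute S_def)
    finally have "M * exp (2 * a * (h * real j)) * norm w \<le> B"
      unfolding B_def using a_nonneg M_ge_1 by (intro mult_right_mono mult_left_mono) (auto intro: mult_left_mono)
    then show ?thesis using z(5)[of j] by simp
  qed
  have "real k * (K S * ((K S + 1) * B * h\<^sup>2)) = C / real k"
    using k(3) by (simp add: C_def h_def power2_eq_square)
  then have small: "real k * (K S * ((K S + 1) * B * h\<^sup>2)) < e / 2" using k(1) by simp
  have near: "\<forall>\<^sub>F n in sequentially. norm ((V (r n) ^^ p n) (z 0) - z k)
      \<le> real k * (K S * ((K S + 1) * B * h\<^sup>2)) + e / 2" if "sampling r p \<sigma>" for r p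
  proof (rule power_near_approximate_orbit[of k z y' w' h B r p S "e / 2"])
    show "norm (z (Suc j) - z j - h *\<^sub>R y' j) \<le> B * h\<^sup>2" if "j < k" for j
      using w'B[of "Suc j"] that by (simp add: z(4) mult.commute[of "h\<^sup>2"] mult_right_mono)
  qed (use z w'B that kh \<open>h \<ge> 0\<close> \<open>e > 0\<close> in \<open>auto simp: S_def\<close>)
  show ?thesis
  proof (rule that[of "z k"])
    fix r p assume "sampling r p \<sigma>"
    from near[OF this] show "\<forall>\<^sub>F n in sequentially. dist ((V (r n) ^^ p n) x) (z k) < e"
      by eventually_elim (use small in \<open>simp only: dist_norm z(1)\<close>)
  qed
qed

lemma power_converges:
  assumes "\<sigma> \<ge> 0"
  shows "\<exists>l. \<forall>r p. sampling r p \<sigma> \<longrightarrow> (\<lambda>n. (V (r n) ^^ p n) x) \<longlonglongrightarrow> l"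
proof (rule power_limit_dense[OF closure_smooth assms])
  fix x assume x: "x \<in> smooth"
  have samp0: "sampling (\<lambda>n. 1 / real n) (\<lambda>n. nat \<lfloor>real n * \<sigma>\<rfloor>) \<sigma>"
    using sampling_floor[of 1 \<sigma>] assms by simp
  define s where "s = (\<lambda>n. (V (1 / real n) ^^ nat \<lfloor>real n * \<sigma>\<rfloor>) x)"
  have "Cauchy s"
  proof (rule metric_CauchyI)
    fix e :: real assume "e > 0"
    then have "e / 2 > 0" by simp
    obtain u where u: "\<And>r p. sampling r p \<sigma> \<Longrightarrow> \<forall>\<^sub>F n in sequentially. dist ((V (r n) ^^ p n) x) u < e / 2"
      using power_near_euler[OF x assms \<open>e / 2 > 0\<close>] by blast
    obtain N where N: "\<And>n. n \<ge> N \<Longrightarrow> dist (s n) u < e / 2"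
      using u[OF samp0] unfolding s_def eventually_sequentially by blast
    have "dist (s m) (s n) < e" if "m \<ge> N" "n \<ge> N" for m n
      using dist_triangle2[of "s m" "s n" u] N[OF that(1)] N[OF that(2)] by linarith
    then show "\<exists>N. \<forall>m\<ge>N. \<forall>n\<ge>N. dist (s m) (s n) < e" by blast
  qed
  then obtain l where l: "s \<longlonglongrightarrow> l" using Cauchy_convergent convergent_def by blast
  have "(\<lambda>n. (V (r n) ^^ p n) x) \<longlonglongrightarrow> l" if samp: "sampling r p \<sigma>" for r p
  proof (rule tendstoI)
    fix e :: real assume "e > 0"
    then have "e / 3 > 0" by simp
    obtain u where u: "\<And>r p. sampling r p \<sigma> \<Longrightarrow> \<forall>\<^sub>F n in sequentially. dist ((V (r n) ^^ p n) x) u < e / 3"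
      using power_near_euler[OF x assms \<open>e / 3 > 0\<close>] by blast
    show "\<forall>\<^sub>F n in sequentially. dist ((V (r n) ^^ p n) x) l < e"
      using u[OF samp] u[OF samp0, folded s_def] tendstoD[OF l \<open>e / 3 > 0\<close>]
    proof eventually_elim
      case (elim n)
      then show ?case
        using dist_triangle2[of "(V (r n) ^^ p n) x" l u] dist_triangle2[of u l "s n"]
        by (simp add: dist_commute s_def)
    qed
  qed
  then show "\<exists>l. \<forall>r p. sampling r p \<sigma> \<longrightarrow> (\<lambda>n. (V (r n) ^^ p n) x) \<longlonglongrightarrow> l" by blast
qed

section \<open>The limit semigroup and its generator\<close>

definition W :: "real \<Rightarrow> 'a \<Rightarrow> 'a" where
  "W \<sigma> x = (SOME l. \<forall>r p. sampling r p \<sigma> \<longrightarrow> (\<lambda>n. (V (r n) ^^ p n) x) \<longlonglongrightarrow> l)"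

lemma power_tendsto_W: "\<sigma> \<ge> 0 \<Longrightarrow> sampling r p \<sigma> \<Longrightarrow> (\<lambda>n. (V (r n) ^^ p n) x) \<longlonglongrightarrow> W \<sigma> x"
  using someI_ex[OF power_converges[of \<sigma> x]] unfolding W_def by blast

abbreviation (input) P :: "nat \<Rightarrow> real \<Rightarrow> 'a \<Rightarrow> 'a" where
  "P n s \<equiv> V (1 / real n) ^^ nat \<lfloor>real n * s\<rfloor>"

lemma P_sampling: "s \<ge> 0 \<Longrightarrow> sampling (\<lambda>n. 1 / real n) (\<lambda>n. nat \<lfloor>real n * s\<rfloor>) s"
  using sampling_floor[of 1 s] by simp

lemma P_tendsto_W: "s \<ge> 0 \<Longrightarrow> (\<lambda>n. P n s x) \<longlonglongrightarrow> W s x"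
  by (rule power_tendsto_W[OF _ P_sampling])

lemma W_eqI: "s \<ge> 0 \<Longrightarrow> (\<lambda>n. P n s x) \<longlonglongrightarrow> l \<Longrightarrow> W s x = l"
  using P_tendsto_W LIMSEQ_unique by blast

lemma W_bound:
  assumes "s \<ge> 0"
  shows "norm (W s x) \<le> K s * norm x"
proof (rule LIMSEQ_le)
  show "(\<lambda>n. norm (P n s x)) \<longlonglongrightarrow> norm (W s x)" by (intro tendsto_intros P_tendsto_W assms)
  have "(\<lambda>n. 1 / real n * real (nat \<lfloor>real n * s\<rfloor>)) \<longlonglongrightarrow> s"
    using P_sampling[OF assms] by (simp only: sampling_def)
  then show "(\<lambda>n. M * exp (a * (1 / real n * real (nat \<lfloor>real n * s\<rfloor>))) * norm x) \<longlonglongrightarrow> K s * norm x"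
    unfolding K_def by (intro tendsto_intros)
  show "\<exists>N. \<forall>n\<ge>N. norm (P n s x) \<le> M * exp (a * (1 / real n * real (nat \<lfloor>real n * s\<rfloor>))) * norm x"
    by (intro exI[of _ 1] allI impI stable) auto
qed

lemma W_plus:
  assumes "s \<ge> 0"
  shows "W s (x + y) = W s x + W s y"
proof (rule W_eqI[OF assms])
  have "(\<lambda>n. P n s x + P n s y) \<longlonglongrightarrow> W s x + W s y" by (intro tendsto_intros P_tendsto_W assms)
  moreover have "\<forall>\<^sub>F n in sequentially. P n s x + P n s y = P n s (x + y)"
    using eventually_gt_at_top[of 0] by eventually_elim (simp add: power_plus)
  ultimately show "(\<lambda>n. P n s (x + y)) \<longlonglongrightarrow> W s x + W s y" by (rule Lim_transform_eventually)
qed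

text \<open>Serves for homogeneity under real scalars and under \<open>scl\<close> alike:
  multiplication by a scalar is a bounded operator commuting with \<open>V r\<close>.\<close>

lemma W_commute:
  assumes "s \<ge> 0" "bounded_linear U" and comm: "\<And>r x. r > 0 \<Longrightarrow> V r (U x) = U (V r x)"
  shows "W s (U x) = U (W s x)"
proof (rule W_eqI[OF assms(1)])
  have pow: "(V r ^^ m) (U x) = U ((V r ^^ m) x)" if "r > 0" for r m
    by (induction m) (simp_all add: comm that)
  have "\<forall>\<^sub>F n in sequentially. U (P n s x) = P n s (U x)"
    using eventually_gt_at_top[of 0] by eventually_elim (simp add: pow)
  moreover have "(\<lambda>n. U (P n s x)) \<longlonglongrightarrow> U (W s x)"
    using bounded_linear.tendsto[OF assms(2) P_tendsto_W[OF assms(1)]] .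
  ultimately show "(\<lambda>n. P n s (U x)) \<longlonglongrightarrow> U (W s x)" by (rule Lim_transform_eventually[rotated])
qed

lemma W_scaleR: "s \<ge> 0 \<Longrightarrow> W s (c *\<^sub>R x) = c *\<^sub>R W s x"
  using W_commute[of s "\<lambda>x. c *\<^sub>R x"] linear_scale[OF bounded_linear.linear[OF bounded_linear_V]]
  by (auto simp: bounded_linear_scaleR_right)

lemma W_diff: "s \<ge> 0 \<Longrightarrow> W s (x - y) = W s x - W s y"
  using W_plus[of s "x - y" y] by simp

lemma bounded_linear_W: "s \<ge> 0 \<Longrightarrow> bounded_linear (W s)"
  by (rule bounded_linear_intro[of _ "K s"]) (use W_bound in \<open>auto simp: W_plus W_scaleR mult.commute\<close>)

lemma W_zero: "W 0 x = x"
proof -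
  have "(\<lambda>n. (V (1 / real n) ^^ 0) x) \<longlonglongrightarrow> W 0 x"
    using sampling_const[of 1] by (intro power_tendsto_W) (auto simp: sampling_def)
  then show ?thesis by (simp add: LIMSEQ_const_iff)
qed

lemma W_add:
  assumes "s \<ge> 0" "s' \<ge> 0"
  shows "W (s + s') x = W s (W s' x)"
proof -
  have "(\<lambda>n. P n s (P n s' x)) \<longlonglongrightarrow> W (s + s') x"
    using power_tendsto_W[OF _ sampling_add[OF P_sampling[OF assms(1)] P_sampling[OF assms(2)]], of x] assms
    by (simp add: funpow_add)
  moreover have "(\<lambda>n. P n s (P n s' x)) \<longlonglongrightarrow> W s (W s' x)"
  proof -
    have diff0: "(\<lambda>n. P n s (P n s' x - W s' x)) \<longlonglongrightarrow> 0"
    proof (rule Lim_null_comparison)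
      show "\<forall>\<^sub>F n in sequentially. norm (P n s (P n s' x - W s' x)) \<le> K (s + 1) * norm (P n s' x - W s' x)"
        using sampling_eventually(1)[OF P_sampling[OF assms(1)]]
          sampling_eventually(2)[OF P_sampling[OF assms(1)], of "s + 1", simplified]
        by eventually_elim (use power_bound in auto)
      have "(\<lambda>n. K (s + 1) * norm (P n s' x - W s' x)) \<longlonglongrightarrow> K (s + 1) * norm (W s' x - W s' x)"
        by (intro tendsto_intros P_tendsto_W assms)
      then show "(\<lambda>n. K (s + 1) * norm (P n s' x - W s' x)) \<longlonglongrightarrow> 0" by simp
    qed
    have "(\<lambda>n. P n s (P n s' x - W s' x) + P n s (W s' x)) \<longlonglongrightarrow> 0 + W s (W s' x)"
      by (intro tendsto_add diff0 P_tendsto_W assms)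
    moreover have "\<forall>\<^sub>F n in sequentially. P n s (P n s' x - W s' x) + P n s (W s' x) = P n s (P n s' x)"
      using eventually_gt_at_top[of 0] by eventually_elim (simp add: power_diff)
    ultimately show ?thesis by (simp add: Lim_transform_eventually)
  qed
  ultimately show ?thesis by (rule LIMSEQ_unique)
qed

lemma W_lipschitz:
  assumes xy: "(x, y) \<in> G" and "0 \<le> s" "s < S" "0 \<le> s'" "s' < S"
  shows "norm (W s x - W s' x) \<le> (K S)\<^sup>2 * \<bar>s - s'\<bar> * norm y"
proof (rule field_le_epsilon)
  fix e :: real assume "e > 0"
  let ?t = "\<lambda>s n. 1 / real n * real (nat \<lfloor>real n * s\<rfloor>)"
  note samp = P_sampling[OF \<open>0 \<le> s\<close>] P_sampling[OF \<open>0 \<le> s'\<close>]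
  have lim: "?t s \<longlonglongrightarrow> s" "?t s' \<longlonglongrightarrow> s'" using samp unfolding sampling_def by blast+
  show "norm (W s x - W s' x) \<le> (K S)\<^sup>2 * \<bar>s - s'\<bar> * norm y + e"
  proof (rule tendsto_le[OF sequentially_bot])
    show "(\<lambda>n. norm (P n s x - P n s' x)) \<longlonglongrightarrow> norm (W s x - W s' x)"
      by (intro tendsto_intros P_tendsto_W assms)
    show "(\<lambda>n. (K S)\<^sup>2 * \<bar>?t s n - ?t s' n\<bar> * norm y + e) \<longlonglongrightarrow> (K S)\<^sup>2 * \<bar>s - s'\<bar> * norm y + e"
      by (intro tendsto_intros lim)
    have "\<forall>\<^sub>F r in at_right 0. \<forall>p q. r * real p \<le> S \<longrightarrow> r * real q \<le> S \<longrightarrow>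
        norm ((V r ^^ p) x - (V r ^^ q) x) \<le> (K S)\<^sup>2 * \<bar>r * real p - r * real q\<bar> * norm y + e"
      using power_shift_bound[OF xy _ \<open>e > 0\<close>, of S] assms by simp
    from sampling_eventually(3)[OF samp(1) this] sampling_eventually(2)[OF samp(1) \<open>s < S\<close>]
      sampling_eventually(2)[OF samp(2) \<open>s' < S\<close>]
    show "\<forall>\<^sub>F n in sequentially. norm (P n s x - P n s' x) \<le> (K S)\<^sup>2 * \<bar>?t s n - ?t s' n\<bar> * norm y + e"
      by eventually_elim blast
  qed
qed

lemma continuous_on_W: "continuous_on {0..} (\<lambda>s. W s x)"
  unfolding continuous_on_iff
proof (intro ballI allI impI)
  fix s e :: real assume "s \<in> {0..}" "e > 0"
  then have "s \<ge> 0" by simp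
  define S where "S = s + 2"
  have k: "K S \<ge> 1" using K_ge_1 \<open>s \<ge> 0\<close> by (simp add: S_def)
  have "e / (3 * K S) > 0" using k \<open>e > 0\<close> by simp
  moreover have "x \<in> closure (Domain L)" using dense_domain by simp
  ultimately obtain x' where x': "x' \<in> Domain L" "dist x' x < e / (3 * K S)"
    unfolding closure_approachable by blast
  then obtain y where "(x', y) \<in> G" using L_subset_G by blast
  define c where "c = (K S)\<^sup>2 * norm y + 1"
  have "c > 0" by (simp add: c_def add_nonneg_pos)
  show "\<exists>d>0. \<forall>s'\<in>{0..}. dist s' s < d \<longrightarrow> dist (W s' x) (W s x) < e"
  proof (intro exI[of _ "min 1 (e / (3 * c))"] conjI ballI impI)
    show "min 1 (e / (3 * c)) > 0" using \<open>c > 0\<close> \<open>e > 0\<close> by simp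
    fix s' :: real assume "s' \<in> {0..}" and d: "dist s' s < min 1 (e / (3 * c))"
    then have s': "s' \<ge> 0" "s' < S" "s < S" by (auto simp: S_def dist_real_def)
    have near: "norm (W u x - W u x') < e / 3" if "0 \<le> u" "u < S" for u
    proof -
      have "norm (W u x - W u x') \<le> K u * norm (x - x')"
        using W_bound[OF \<open>0 \<le> u\<close>, of "x - x'"] that by (simp add: W_diff)
      also have "\<dots> \<le> K S * norm (x - x')"
        using that by (intro mult_right_mono K_mono) auto
      also have "\<dots> < e / 3" using x'(2) k by (simp add: dist_norm norm_minus_commute field_simps)
      finally show ?thesis .
    qed
    have "norm (W s' x' - W s x') \<le> (K S)\<^sup>2 * \<bar>s' - s\<bar> * norm y"
      by (rule W_lipschitz[OF \<open>(x', y) \<in> G\<close>]) (use s' \<open>s \<ge> 0\<close> in auto)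
    also have "\<dots> \<le> \<bar>s' - s\<bar> * c" by (simp add: c_def algebra_simps)
    also have "\<dots> < e / 3" using d \<open>c > 0\<close> by (simp add: dist_real_def field_simps)
    finally have mid: "norm (W s' x' - W s x') < e / 3" .
    have eq: "W s' x - W s x = (W s' x - W s' x') + (W s' x' - W s x') - (W s x - W s x')" by simp
    have "norm (W s' x - W s x) \<le> norm (W s' x - W s' x') + norm (W s' x' - W s x') + norm (W s x - W s x')"
      unfolding eq by (rule norm_add_diff_le)
    then show "dist (W s' x) (W s x) < e"
      using near[OF s'(1,2)] near[OF \<open>s \<ge> 0\<close> s'(3)] mid by (simp add: dist_norm)
  qed
qed

sublocale W: operator_semigroup W
  by (rule operator_semigroup.intro) (use bounded_linear_W W_zero W_add continuous_on_W in auto)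

text \<open>The expansion holds for all powers up to time \<open>\<delta>\<close>, up to an error
  proportional to the elapsed time, so it survives the limit in \<open>r\<close> at fixed
  \<open>h\<close> and no limits are interchanged. As \<open>y\<close> need not be in the domain of
  \<open>G\<close>, its drift is controlled through a nearby \<open>y0\<close> in the domain of
  \<open>L\<close>.\<close>

lemma G_subset_generator_W:
  assumes xy: "(x, y) \<in> G"
  shows "(x, y) \<in> generator W"
proof -
  have "\<exists>\<delta>>0. \<forall>h. 0 < h \<and> h < \<delta> \<longrightarrow> norm (W h x - x - h *\<^sub>R y) \<le> \<eta> * h" if "\<eta> > 0" for \<eta>
  proof -
    have k: "K 1 \<ge> 1" by (rule K_ge_1) simp
    have "\<eta> / (3 * (K 1 + 1)) > 0" using k \<open>\<eta> > 0\<close> by simp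
    moreover have "y \<in> closure (Domain L)" using dense_domain by simp
    ultimately obtain y0 where y0: "y0 \<in> Domain L" "dist y0 y < \<eta> / (3 * (K 1 + 1))"
      unfolding closure_approachable by blast
    then obtain z0 where yz: "(y0, z0) \<in> G" using L_subset_G by blast
    \<comment> \<open>Keeps the part of the drift of \<open>y0\<close> that is proportional to time
      below \<open>\<eta> / 3\<close>; the summand 1 guards against \<open>z0 = 0\<close>.\<close>
    define \<delta> where "\<delta> = min 1 (\<eta> / (3 * (K 1 * norm z0 + 1)))"
    have den: "K 1 * norm z0 + 1 > 0" using k by (simp add: add_nonneg_pos)
    have "\<delta> > 0" using \<open>\<eta> > 0\<close> den by (simp add: \<delta>_def)
    have "\<eta> / 3 > 0" using \<open>\<eta> > 0\<close> by simp
    have near: "\<forall>\<^sub>F r in at_right 0. \<forall>m. r * real m \<le> \<delta> \<longrightarrow> norm ((V r ^^ m) y - y) \<le> \<eta>"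
      using power_diff_id_bound[OF yz zero_le_one \<open>\<eta> / 3 > 0\<close>] eventually_at_right_less
    proof eventually_elim
      case (elim r)
      show ?case
      proof (intro allI impI)
        fix m assume m: "r * real m \<le> \<delta>"
        then have m1: "r * real m \<le> 1" by (simp add: \<delta>_def)
        have "norm ((V r ^^ m) (y - y0)) \<le> K 1 * norm (y - y0)" by (rule power_bound[OF elim(2) m1])
        moreover have "(K 1 + 1) * norm (y - y0) < \<eta> / 3"
          using y0(2) k by (simp add: dist_norm norm_minus_commute field_simps)
        moreover have "norm ((V r ^^ m) y0 - y0) \<le> \<eta> / 3 + \<eta> / 3"
        proof -
          have "K 1 * (r * real m) * norm z0 = (r * real m) * (K 1 * norm z0)" by simp
          also have "\<dots> \<le> \<delta> * (K 1 * norm z0 + 1)" using m k \<open>\<delta> > 0\<close> by (intro mult_mono) auto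
          also have "\<dots> \<le> \<eta> / (3 * (K 1 * norm z0 + 1)) * (K 1 * norm z0 + 1)"
            using den by (intro mult_right_mono) (auto simp: \<delta>_def)
          also have "\<dots> = \<eta> / 3" using den by (simp add: field_simps)
          finally show ?thesis using elim(1)[rule_format, OF m1] by linarith
        qed
        moreover have eq: "(V r ^^ m) y - y = (V r ^^ m) (y - y0) + ((V r ^^ m) y0 - y0) - (y - y0)"
          using elim(2) by (simp add: power_diff)
        have "norm ((V r ^^ m) y - y) \<le> norm ((V r ^^ m) (y - y0)) + norm ((V r ^^ m) y0 - y0) + norm (y - y0)"
          unfolding eq by (rule norm_add_diff_le)
        ultimately show "norm ((V r ^^ m) y - y) \<le> \<eta>" by (simp add: distrib_right)
      qed
    qed
    have "norm (W h x - x - h *\<^sub>R y) \<le> \<eta> * h" if h: "0 < h" "h < \<delta>" for h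
    proof (rule field_le_epsilon)
      fix \<epsilon> :: real assume "\<epsilon> > 0"
      have "h \<ge> 0" using h by simp
      let ?t = "\<lambda>n. 1 / real n * real (nat \<lfloor>real n * h\<rfloor>)"
      note samp = P_sampling[OF \<open>h \<ge> 0\<close>]
      have lim: "?t \<longlonglongrightarrow> h" using samp unfolding sampling_def by blast
      have "\<forall>\<^sub>F r in at_right 0. \<forall>m. r * real m \<le> \<delta> \<longrightarrow>
          norm ((V r ^^ m) x - x - (r * real m) *\<^sub>R y) \<le> r * real m * \<eta> + \<epsilon>"
        by (rule power_first_order[OF xy _ _ \<open>\<epsilon> > 0\<close> near]) (use \<open>\<delta> > 0\<close> \<open>\<eta> > 0\<close> in auto)
      from sampling_eventually(3)[OF samp this] sampling_eventually(2)[OF samp h(2)]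
      have ev: "\<forall>\<^sub>F n in sequentially. norm (P n h x - x - ?t n *\<^sub>R y) \<le> ?t n * \<eta> + \<epsilon>"
        by eventually_elim blast
      have "norm (W h x - x - h *\<^sub>R y) \<le> h * \<eta> + \<epsilon>"
      proof (rule tendsto_le[OF sequentially_bot _ _ ev])
        show "(\<lambda>n. ?t n * \<eta> + \<epsilon>) \<longlonglongrightarrow> h * \<eta> + \<epsilon>" by (intro tendsto_intros lim)
        show "(\<lambda>n. norm (P n h x - x - ?t n *\<^sub>R y)) \<longlonglongrightarrow> norm (W h x - x - h *\<^sub>R y)"
          by (intro tendsto_intros lim P_tendsto_W \<open>h \<ge> 0\<close>)
      qed
      then show "norm (W h x - x - h *\<^sub>R y) \<le> \<eta> * h + \<epsilon>" by (simp add: mult.commute)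
    qed
    then show ?thesis using \<open>\<delta> > 0\<close> by blast
  qed
  note small = this
  have "((\<lambda>h. (W h x - x) /\<^sub>R h) \<longlongrightarrow> y) (at_right 0)"
  proof (rule tendstoI)
    fix e :: real assume "e > 0"
    then have "e / 2 > 0" by simp
    obtain \<delta> where \<delta>: "\<delta> > 0" "\<And>h. 0 < h \<Longrightarrow> h < \<delta> \<Longrightarrow> norm (W h x - x - h *\<^sub>R y) \<le> e / 2 * h"
      using small[OF \<open>e / 2 > 0\<close>] by blast
    have "dist ((W h x - x) /\<^sub>R h) y < e" if "0 < h" "h < \<delta>" for h
    proof -
      have "(W h x - x) /\<^sub>R h - y = (W h x - x - h *\<^sub>R y) /\<^sub>R h" using that by (simp add: scaleR_diff_right)
      then have "norm ((W h x - x) /\<^sub>R h - y) = norm (W h x - x - h *\<^sub>R y) / h"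
        using that by (simp add: divide_inverse_commute)
      also have "\<dots> \<le> e / 2" using \<delta>(2)[OF that] that by (simp add: pos_divide_le_eq)
      finally show ?thesis using \<open>e > 0\<close> by (simp add: dist_norm)
    qed
    then show "\<forall>\<^sub>F h in at_right 0. dist ((W h x - x) /\<^sub>R h) y < e"
      unfolding eventually_at_right_field using \<delta>(1) by blast
  qed
  then show ?thesis by (simp add: generator_def)
qed

(* For large \<mu> the operator \<mu> - G is onto and \<mu> - generator W is one-to-one: an eigenvector of the
   generator for the eigenvalue \<mu> would make W grow faster than the stability bound allows. *)
theorem generator_W: "generator W = G"
proof
  show "G \<subseteq> generator W" using G_subset_generator_W by auto
  show "generator W \<subseteq> G"
  proof
    fix u assume u: "u \<in> generator W"
    obtain x g where [simp]: "u = (x, g)" by fastforce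
    obtain h where h: "admissible_step h" using eventually_happens'[OF _ eventually_admissible_step] by auto
    then have "h > 0" "a * h < 1" by (auto simp: admissible_step_def)
    obtain z w where zw: "(z, w) \<in> G" "z - h *\<^sub>R w = x - h *\<^sub>R g" using resolvent_exists[OF h] by blast
    define v where "v = x - z"
    have "h *\<^sub>R (g - w) = v" using zw(2) by (simp add: v_def algebra_simps)
    then have gw: "g - w = (1 / h) *\<^sub>R v" using \<open>h > 0\<close> by auto
    have "(x - z, g - w) \<in> generator W"
      using subspace_diff[OF W.subspace_generator u G_subset_generator_W[OF zw(1)]] by simp
    then have "(v, (1 / h) *\<^sub>R v) \<in> generator W" by (simp only: gw v_def[symmetric])
    then have eig: "W s v = exp (1 / h * s) *\<^sub>R v" if "s \<ge> 0" for s
      using W.orbit_eq_exp[OF bounded_linear_ident _ _ that, of v "(1 / h) *\<^sub>R v" "1 / h"]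
      by (simp add: W.T_scaleR)
    have "norm v = 0"
    proof (rule ccontr)
      assume "norm v \<noteq> 0"
      then have v: "norm v > 0" by simp
      define d where "d = 1 / h - a"
      have "d > 0" using \<open>h > 0\<close> \<open>a * h < 1\<close> by (simp add: d_def field_simps)
      have "exp (d * s) \<le> M" if "s \<ge> 0" for s
      proof -
        have "exp (1 / h * s) * norm v \<le> M * exp (a * s) * norm v"
          using W_bound[OF that, of v] eig[OF that] by (simp add: K_def)
        then have "exp (1 / h * s) \<le> M * exp (a * s)" using v by simp
        moreover have "exp (1 / h * s) = exp (d * s) * exp (a * s)"
          by (simp add: d_def left_diff_distrib flip: exp_add)
        ultimately show ?thesis by simp
      qed
      from this[of "M / d"] have "exp M \<le> M" using \<open>d > 0\<close> M_ge_1 by simp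
      then show False using exp_ge_add_one_self[of M] by simp
    qed
    then have "v = 0" by simp
    then show "u \<in> G" using zw(1) gw by (simp add: v_def)
  qed
qed

text \<open>Uniqueness of the semigroup is not invoked: on \<open>smooth\<close> the orbit of
  \<open>T\<close> is itself an approximate orbit, so the powers, which converge to
  \<open>W \<sigma> x\<close>, stay within \<open>C / k\<close> of \<open>T \<sigma> x\<close> for
  every \<open>k\<close>.\<close>

theorem chernoff_product_formula:
  assumes T: "operator_semigroup T" and gen: "generator T = G" and "\<sigma> \<ge> 0" and samp: "sampling r p \<sigma>"
  shows "(\<lambda>n. (V (r n) ^^ p n) x) \<longlonglongrightarrow> T \<sigma> x"
proof -
  interpret T: operator_semigroup T by (rule T)
  have "W \<sigma> x = T \<sigma> x" if x: "x \<in> smooth" for x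
  proof -
    obtain y w where xy: "(x, y) \<in> G" and yw: "(y, w) \<in> G" using x by (auto simp: smooth_def)
    define S where "S = \<sigma> + 1"
    obtain B0 where B0: "B0 \<ge> 1" "\<And>s u. 0 \<le> s \<Longrightarrow> s \<le> S \<Longrightarrow> norm (T s u) \<le> B0 * norm u"
      using T.bounded_on_interval[of S] by blast
    \<comment> \<open>One factor \<open>B0\<close> for the time at which a step starts, one for the
      time within the step.\<close>
    define B where "B = B0 * (B0 * norm w)"
    have wB: "norm (T s (T s' w)) \<le> B" if "0 \<le> s" "s \<le> S" "0 \<le> s'" "s' \<le> S" for s s'
      unfolding B_def using B0 that by (intro order_trans[OF B0(2)] mult_left_mono) auto
    define C where "C = K S * ((K S + 1) * B * \<sigma>\<^sup>2)"
    have near: "dist (W \<sigma> x) (T \<sigma> x) \<le> C / real k + e" if "k > 0" "e > 0" for k :: nat and e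
    proof -
      define h where "h = \<sigma> / real k"
      have kh: "real k * h = \<sigma>" and "h \<ge> 0" using \<open>k > 0\<close> \<open>\<sigma> \<ge> 0\<close> by (auto simp: h_def)
      have jh: "0 \<le> real j * h" "real j * h \<le> S" if "j \<le> k" for j
      proof -
        have "real j * h \<le> real k * h" using that \<open>h \<ge> 0\<close> by (intro mult_right_mono) auto
        then show "real j * h \<le> S" using kh by (simp add: S_def)
      qed (use \<open>h \<ge> 0\<close> in simp)
      have hS: "h \<le> S" using jh(2)[of 1] \<open>k > 0\<close> by simp
      have orbit: "(T (real j * h) u, T (real j * h) v) \<in> G" if "(u, v) \<in> G" for u v j
        using T.generator_orbit[of u v] that \<open>h \<ge> 0\<close> by (simp add: gen)
      have "\<forall>\<^sub>F n in sequentially.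
          norm ((V (r n) ^^ p n) (T (real 0 * h) x) - T (real k * h) x) \<le> real k * (K S * ((K S + 1) * B * h\<^sup>2)) + e"
      proof (rule power_near_approximate_orbit[of k "\<lambda>j. T (real j * h) x" "\<lambda>j. T (real j * h) y" "\<lambda>j. T (real j * h) w"])
        show "norm (T (real j * h) w) \<le> B" if "j \<le> k" for j
          using wB[of 0 "real j * h"] jh[OF that] by (simp add: T.zero S_def \<open>\<sigma> \<ge> 0\<close>)
        show "norm (T (real (Suc j) * h) x - T (real j * h) x - h *\<^sub>R T (real j * h) y) \<le> B * h\<^sup>2"
          if "j < k" for j
        proof -
          have "T (real (Suc j) * h) x = T h (T (real j * h) x)"
            using T.add[of h "real j * h" x] \<open>h \<ge> 0\<close> by (simp add: algebra_simps)
          then show ?thesis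
            using T.second_order_expansion[of "T (real j * h) x" "T (real j * h) y" "T (real j * h) w" h B]
              orbit[OF xy, of j] orbit[OF yw, of j] gen \<open>h \<ge> 0\<close> wB[of _ "real j * h"] jh[of j] that hS
            by simp
        qed
      qed (use orbit xy yw \<open>h \<ge> 0\<close> samp kh \<open>e > 0\<close> in \<open>auto simp: S_def\<close>)
      then have ev: "\<forall>\<^sub>F n in sequentially. norm ((V (r n) ^^ p n) x - T \<sigma> x) \<le> C / real k + e"
        using \<open>k > 0\<close> by (simp add: T.zero kh C_def h_def power2_eq_square mult.assoc)
      have "norm (W \<sigma> x - T \<sigma> x) \<le> C / real k + e"
      proof (rule tendsto_le[OF sequentially_bot tendsto_const _ ev])
        show "(\<lambda>n. norm ((V (r n) ^^ p n) x - T \<sigma> x)) \<longlonglongrightarrow> norm (W \<sigma> x - T \<sigma> x)"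
          by (intro tendsto_intros power_tendsto_W \<open>\<sigma> \<ge> 0\<close> samp)
      qed
      then show ?thesis by (simp add: dist_norm)
    qed
    have "dist (W \<sigma> x) (T \<sigma> x) \<le> 0"
    proof (rule field_le_epsilon)
      fix e :: real assume "e > 0"
      have "(\<lambda>k. C / real k + e) \<longlonglongrightarrow> 0 + e" by (intro tendsto_intros lim_const_over_n)
      then show "dist (W \<sigma> x) (T \<sigma> x) \<le> 0 + e"
        by (rule tendsto_lowerbound)
          (use near \<open>e > 0\<close> in \<open>auto intro: eventually_mono[OF eventually_gt_at_top[of 0]]\<close>)
    qed
    then show ?thesis by simp
  qed
  then have sub: "smooth \<subseteq> {x. W \<sigma> x = T \<sigma> x}" by auto
  have "closed {x. W \<sigma> x = T \<sigma> x}"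
    using linear_continuous_on[OF bounded_linear_W, of \<sigma> UNIV] linear_continuous_on[OF T.bounded_linear, of \<sigma> UNIV] \<open>\<sigma> \<ge> 0\<close>
    by (intro closed_Collect_eq) auto
  then have "UNIV \<subseteq> {x. W \<sigma> x = T \<sigma> x}" using closure_minimal[OF sub] closure_smooth by simp
  then have "W \<sigma> x = T \<sigma> x" by blast
  then show ?thesis using power_tendsto_W[OF \<open>\<sigma> \<ge> 0\<close> samp, of x] by simp
qed

end


subsection \<open>The dual semigroup\<close>

context operator_semigroup
begin

definition adjoint_domain :: "('a \<Rightarrow>\<^sub>L 'b::real_normed_vector) set" where
  "adjoint_domain = {\<phi>. \<exists>\<psi>. \<forall>(x, y)\<in>generator T. blinfun_apply \<phi> y = blinfun_apply \<psi> x}"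

lemma dense_domain_bound:
  fixes \<phi> \<psi> :: "'a \<Rightarrow>\<^sub>L 'b::real_normed_vector"
  assumes dense: "closure (Domain (generator T)) = UNIV" and "r \<ge> 0"
    and le: "\<And>x y. (x, y) \<in> generator T \<Longrightarrow> norm (\<phi> (T r x) - \<phi> x - r *\<^sub>R \<psi> x) \<le> c * norm x"
  shows "norm (\<phi> (T r x) - \<phi> x - r *\<^sub>R \<psi> x) \<le> c * norm x"
proof -
  let ?S = "{x. norm (\<phi> (T r x) - \<phi> x - r *\<^sub>R \<psi> x) \<le> c * norm x}"
  have "closed ?S"
    using linear_continuous_on[OF bounded_linear[OF \<open>r \<ge> 0\<close>], of UNIV]
    by (intro closed_Collect_le continuous_intros) auto
  moreover have "Domain (generator T) \<subseteq> ?S" using le by auto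
  ultimately have "closure (Domain (generator T)) \<subseteq> ?S" by (simp add: closure_minimal)
  then show ?thesis using dense by auto
qed

text \<open>On the domain the derivative of \<open>\<phi> (T s x)\<close> is
  \<open>\<psi> (T s x)\<close>; the resulting bound involves only \<open>norm x\<close>, so it
  extends by density. The free \<open>\<eta>\<close> will be 0 for norm continuity of the dual orbit
  and \<open>\<psi>\<close> for its differentiability.\<close>

lemma adjoint_orbit_diff:
  fixes \<phi> \<psi> \<eta> :: "'a \<Rightarrow>\<^sub>L 'b::real_normed_vector"
  assumes dense: "closure (Domain (generator T)) = UNIV"
    and adj: "\<And>x y. (x, y) \<in> generator T \<Longrightarrow> \<phi> y = \<psi> x" and "r \<ge> 0"
    and le: "\<And>s x. 0 \<le> s \<Longrightarrow> s \<le> r \<Longrightarrow> norm (\<psi> (T s x) - \<eta> x) \<le> c * norm x"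
  shows "norm (\<phi> (T r x) - \<phi> x - r *\<^sub>R \<eta> x) \<le> (c * r) * norm x"
proof (rule dense_domain_bound[OF dense \<open>r \<ge> 0\<close>])
  fix x y assume xy: "(x, y) \<in> generator T"
  have "((\<lambda>s. \<phi> (T s x) - s *\<^sub>R \<eta> x) has_vector_derivative \<psi> (T s x) - \<eta> x) (at s within {0..r})"
    if "s \<in> {0..r}" for s
  proof -
    have "((\<lambda>s. T s x) has_vector_derivative T s y) (at s within {0..r})"
      using that by (intro has_vector_derivative_within_subset[OF orbit_has_vector_derivative[OF xy]]) auto
    then have "((\<lambda>s. \<phi> (T s x)) has_vector_derivative \<phi> (T s y)) (at s within {0..r})"
      by (rule bounded_linear.has_vector_derivative[OF blinfun.bounded_linear_right])
    moreover have "\<phi> (T s y) = \<psi> (T s x)" using adj generator_orbit[OF xy] that by simp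
    ultimately show ?thesis by (auto intro!: derivative_eq_intros)
  qed
  then have "norm ((\<phi> (T r x) - r *\<^sub>R \<eta> x) - (\<phi> (T 0 x) - 0 *\<^sub>R \<eta> x)) \<le> (c * norm x) * \<bar>r - 0\<bar>"
    using le \<open>r \<ge> 0\<close>
    by (intro norm_diff_le_vector_derivative[of "{0..r}" _ "\<lambda>s. \<psi> (T s x) - \<eta> x"]) auto
  then show "norm (\<phi> (T r x) - \<phi> x - r *\<^sub>R \<eta> x) \<le> (c * r) * norm x"
    using \<open>r \<ge> 0\<close> by (simp add: zero algebra_simps)
qed

text \<open>A dual semigroup is in general only weak-star continuous. Functionals in the adjoint
  domain have Lipschitz orbits, and local boundedness carries norm continuity over to their
  closure.\<close>

lemma adjoint_continuous:
  fixes \<eta> :: "'a \<Rightarrow>\<^sub>L 'b::real_normed_vector"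
  assumes dense: "closure (Domain (generator T)) = UNIV"
    and \<eta>: "\<eta> \<in> closure adjoint_domain"
    and "\<epsilon> > 0"
  shows "\<forall>\<^sub>F r in at_right 0. \<forall>x. norm (\<eta> (T r x) - \<eta> x) \<le> \<epsilon> * norm x"
proof -
  obtain K where K: "K \<ge> 1" "\<And>s x. 0 \<le> s \<Longrightarrow> s \<le> 1 \<Longrightarrow> norm (T s x) \<le> K * norm x"
    using bounded_on_interval[of 1] by blast
  have "\<epsilon> / (2 * (K + 1)) > 0" using K(1) \<open>\<epsilon> > 0\<close> by simp
  then obtain \<phi> \<psi> :: "'a \<Rightarrow>\<^sub>L 'b" where \<phi>: "dist \<phi> \<eta> < \<epsilon> / (2 * (K + 1))" and adj: "\<And>x y. (x, y) \<in> generator T \<Longrightarrow> \<phi> y = \<psi> x"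
    using \<eta> unfolding closure_approachable adjoint_domain_def by blast
  define c where "c = norm \<psi> * K"
  have "((\<lambda>r. c * r) \<longlongrightarrow> c * 0) (at_right 0)" by (intro tendsto_intros)
  then have "\<forall>\<^sub>F r in at_right 0. c * r < \<epsilon> / 2" using \<open>\<epsilon> > 0\<close> by (intro order_tendstoD(2)) auto
  moreover have "\<forall>\<^sub>F r in at_right 0. r \<in> {0<..<(1::real)}" by (rule eventually_at_right_real) simp
  ultimately show ?thesis
  proof eventually_elim
    case (elim r)
    show ?case
    proof
      fix x
      have "norm (\<phi> (T r x) - \<phi> x - r *\<^sub>R blinfun_apply 0 x) \<le> (c * r) * norm x"
      proof (rule adjoint_orbit_diff[OF dense adj])
        show "norm (\<psi> (T s x) - blinfun_apply 0 x) \<le> c * norm x" if "0 \<le> s" "s \<le> r" for s x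
          using norm_blinfun[of \<psi> "T s x"] mult_left_mono[OF K(2)[of s x], of "norm \<psi>"] that elim(2)
          by (simp add: c_def mult.assoc)
      qed (use elim in auto)
      also have "\<dots> \<le> \<epsilon> / 2 * norm x" using elim(1) by (intro mult_right_mono) auto
      finally have 1: "norm (\<phi> (T r x) - \<phi> x) \<le> \<epsilon> / 2 * norm x" by simp
      have "norm ((\<eta> - \<phi>) (T r x)) + norm ((\<eta> - \<phi>) x) \<le> norm (\<eta> - \<phi>) * (K * norm x) + norm (\<eta> - \<phi>) * norm x"
        using K elim(2) by (intro add_mono norm_blinfun order_trans[OF norm_blinfun mult_left_mono[OF K(2)]]) auto
      also have "\<dots> = norm (\<eta> - \<phi>) * (K + 1) * norm x" by (simp add: algebra_simps)
      also have "\<dots> \<le> \<epsilon> / 2 * norm x"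
        using \<phi> K(1) by (intro mult_right_mono) (auto simp: dist_norm norm_minus_commute field_simps)
      finally have 2: "norm ((\<eta> - \<phi>) (T r x)) + norm ((\<eta> - \<phi>) x) \<le> \<epsilon> / 2 * norm x" .
      have eq: "\<eta> (T r x) - \<eta> x = (\<phi> (T r x) - \<phi> x) + (\<eta> - \<phi>) (T r x) - (\<eta> - \<phi>) x"
        by (simp add: blinfun.diff_left)
      have "norm (\<eta> (T r x) - \<eta> x) \<le> norm (\<phi> (T r x) - \<phi> x) + norm ((\<eta> - \<phi>) (T r x)) + norm ((\<eta> - \<phi>) x)"
        unfolding eq by (rule norm_add_diff_le)
      then show "norm (\<eta> (T r x) - \<eta> x) \<le> \<epsilon> * norm x" using 1 2 by simp
    qed
  qed
qed

text \<open>An adjoint value \<open>\<psi>\<close> alone gives a Lipschitz orbit; differentiability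
  in norm comes from norm continuity of the orbit of \<open>\<psi>\<close>, hence the assumption on
  \<open>\<psi>\<close>.\<close>

lemma adjoint_expansion:
  fixes \<phi> \<psi> :: "'a \<Rightarrow>\<^sub>L 'b::real_normed_vector"
  assumes dense: "closure (Domain (generator T)) = UNIV"
    and adj: "\<And>x y. (x, y) \<in> generator T \<Longrightarrow> \<phi> y = \<psi> x"
    and \<psi>: "\<psi> \<in> closure adjoint_domain"
    and "\<epsilon> > 0"
  shows "\<forall>\<^sub>F r in at_right 0. \<forall>x. norm (\<phi> (T r x) - \<phi> x - r *\<^sub>R \<psi> x) \<le> \<epsilon> * r * norm x"
proof -
  obtain d where d: "d > 0" "\<And>r x. 0 < r \<Longrightarrow> r < d \<Longrightarrow> norm (\<psi> (T r x) - \<psi> x) \<le> \<epsilon> * norm x"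
    using adjoint_continuous[OF dense \<psi> \<open>\<epsilon> > 0\<close>] unfolding eventually_at_right_field by blast
  have "\<forall>\<^sub>F r in at_right 0. r \<in> {0<..<d}" by (rule eventually_at_right_real[OF d(1)])
  then show ?thesis
  proof eventually_elim
    case (elim r)
    show ?case
    proof
      fix x
      show "norm (\<phi> (T r x) - \<phi> x - r *\<^sub>R \<psi> x) \<le> \<epsilon> * r * norm x"
      proof (rule adjoint_orbit_diff[OF dense adj])
        show "norm (\<psi> (T s x) - \<psi> x) \<le> \<epsilon> * norm x" if "0 \<le> s" "s \<le> r" for s x
          using d(2)[of s x] that elim \<open>\<epsilon> > 0\<close> by (cases "s = 0") (auto simp: zero)
      qed (use elim in auto)
    qed
  qed
qed

end


subsection \<open>Functionals annihilating the range\<close>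

text \<open>The averages are integrals over \<open>[0, S)\<close> of step functions of width
  \<open>1 / n\<close>, so dominated convergence turns upper bounds at each \<open>s\<close>, with
  no uniformity, into a bound on the average.\<close>

lemma average_limsup_le:
  fixes \<beta> :: "nat \<Rightarrow> nat \<Rightarrow> real" and S :: nat
  assumes bound: "\<And>n k. k < n * S \<Longrightarrow> \<bar>\<beta> n k\<bar> \<le> B"
    and lim: "\<And>s \<epsilon>. 0 \<le> s \<Longrightarrow> s < real S \<Longrightarrow> \<epsilon> > 0 \<Longrightarrow>
      \<forall>\<^sub>F n in sequentially. \<beta> n (nat \<lfloor>real n * s\<rfloor>) \<le> c + \<epsilon>"
    and "\<epsilon> > 0"
  shows "\<forall>\<^sub>F n in sequentially. (\<Sum>k<n * S. \<beta> n k) / real n \<le> real S * c + \<epsilon>"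
proof -
  \<comment> \<open>Only the excess over \<open>c\<close> is integrated: it tends to 0 at each
    \<open>s\<close>, whereas \<open>\<beta>\<close> itself may have no limit.\<close>
  define e where "e = (\<lambda>n k. max 0 (\<beta> n k - c))"
  define E where "E = (\<lambda>n \<sigma>. \<Sum>k<n * S. e n k * indicator {real k / real n..<(real k + 1) / real n} \<sigma>)"
  have E_eq: "E n \<sigma> = (if 0 \<le> \<sigma> \<and> \<sigma> < real S then e n (nat \<lfloor>real n * \<sigma>\<rfloor>) else 0)" if "n > 0" for n \<sigma>
  proof (cases "\<sigma> \<ge> 0")
    case True
    have ind: "indicator {real k / real n..<(real k + 1) / real n} \<sigma> = (if k = nat \<lfloor>real n * \<sigma>\<rfloor> then 1 else 0 :: real)" for k
    proof -
      have "real k / real n \<le> \<sigma> \<and> \<sigma> < (real k + 1) / real n \<longleftrightarrow> real k \<le> real n * \<sigma> \<and> real n * \<sigma> < real k + 1"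
        using that by (auto simp: field_simps)
      also have "\<dots> \<longleftrightarrow> \<lfloor>real n * \<sigma>\<rfloor> = int k" by (auto simp: floor_eq_iff)
      also have "\<dots> \<longleftrightarrow> k = nat \<lfloor>real n * \<sigma>\<rfloor>" using True by auto
      finally show ?thesis by (auto simp: indicator_def)
    qed
    have "nat \<lfloor>real n * \<sigma>\<rfloor> < n * S \<longleftrightarrow> \<sigma> < real S"
    proof -
      have "nat \<lfloor>real n * \<sigma>\<rfloor> < n * S \<longleftrightarrow> \<lfloor>real n * \<sigma>\<rfloor> < int (n * S)" using True by (simp add: nat_less_iff)
      also have "\<dots> \<longleftrightarrow> real n * \<sigma> < real n * real S" by (simp add: floor_less_iff)
      also have "\<dots> \<longleftrightarrow> \<sigma> < real S" using that by simp
      finally show ?thesis .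
    qed
    then show ?thesis unfolding E_def ind using True by (simp add: mult_delta_right)
  next
    case False
    have ind: "indicator {real k / real n..<(real k + 1) / real n} \<sigma> = (0::real)" for k
      using False order_trans[of 0 "real k / real n" \<sigma>] by (auto simp: indicator_def)
    show ?thesis unfolding E_def ind using False by simp
  qed
  have B_nonneg: "\<bar>e n k\<bar> \<le> B + \<bar>c\<bar>" if "k < n * S" for n k
    using bound[OF that] by (auto simp: e_def)
  have E_int: "integral\<^sup>L lborel (E n) = (\<Sum>k<n * S. e n k) / real n" if "n > 0" for n
  proof -
    have le: "real k / real n \<le> (real k + 1) / real n" for k by (simp add: divide_right_mono)
    have meas: "measure lborel {real k / real n..<(real k + 1) / real n} = 1 / real n" for k
      by (simp add: measure_def emeasure_lborel_Ico[OF le] flip: diff_divide_distrib)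
    have "integral\<^sup>L lborel (E n) = (\<Sum>k<n * S. e n k * (1 / real n))"
      unfolding E_def
    proof (subst Bochner_Integration.integral_sum)
      show "integrable lborel (\<lambda>\<sigma>. e n k * indicator {real k / real n..<(real k + 1) / real n} \<sigma>)" for k
        by (intro integrable_mult_right integrable_real_indicator) (auto simp: emeasure_lborel_Ico[OF le])
    qed (simp add: meas)
    then show ?thesis by (simp add: sum_divide_distrib)
  qed
  \<comment> \<open>The shift to \<open>Suc n\<close> avoids \<open>n = 0\<close>, where the
    intervals degenerate.\<close>
  have "(\<lambda>n. integral\<^sup>L lborel (E (Suc n))) \<longlonglongrightarrow> integral\<^sup>L lborel (\<lambda>_::real. 0::real)"
  proof (rule integral_dominated_convergence[where w = "\<lambda>\<sigma>. (B + \<bar>c\<bar>) * indicator {0..<real S} \<sigma>"])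
    show "E (Suc n) \<in> borel_measurable lborel" for n unfolding E_def by measurable
    show "integrable lborel (\<lambda>\<sigma>. (B + \<bar>c\<bar>) * indicator {0..<real S} \<sigma>)"
      by (intro integrable_mult_right integrable_real_indicator) (auto simp: emeasure_lborel_Ico)
    show "AE \<sigma> in lborel. norm (E (Suc n) \<sigma>) \<le> (B + \<bar>c\<bar>) * indicator {0..<real S} \<sigma>" for n
    proof (rule AE_I2)
      fix \<sigma> :: real
      show "norm (E (Suc n) \<sigma>) \<le> (B + \<bar>c\<bar>) * indicator {0..<real S} \<sigma>"
      proof (cases "0 \<le> \<sigma> \<and> \<sigma> < real S")
        case True
        have "\<lfloor>real (Suc n) * \<sigma>\<rfloor> < int (Suc n * S)"
        proof -
          have "real (Suc n) * \<sigma> < real (Suc n) * real S" using True by (intro mult_strict_left_mono) auto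
          then show ?thesis by (simp only: floor_less_iff of_int_of_nat_eq of_nat_mult of_int_mult)
        qed
        then have "nat \<lfloor>real (Suc n) * \<sigma>\<rfloor> < Suc n * S" using True by (simp add: nat_less_iff)
        then show ?thesis using B_nonneg True E_eq[of "Suc n" \<sigma>] by simp
      next
        case False
        have "0 \<le> (B + \<bar>c\<bar>) * indicator {0..<real S} \<sigma>"
        proof (cases "S = 0")
          case True
          then show ?thesis using False by (auto simp: indicator_def)
        next
          case False
          then have "0 < Suc n * S" by simp
          from B_nonneg[OF this] show ?thesis by (auto simp: indicator_def)
        qed
        then show ?thesis using False E_eq[of "Suc n" \<sigma>] by auto
      qed
    qed
    show "AE \<sigma> in lborel. (\<lambda>n. E (Suc n) \<sigma>) \<longlonglongrightarrow> 0"
    proof (rule AE_I2)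
      fix \<sigma> :: real
      show "(\<lambda>n. E (Suc n) \<sigma>) \<longlonglongrightarrow> 0"
      proof (cases "0 \<le> \<sigma> \<and> \<sigma> < real S")
        case True
        have "(\<lambda>n. e n (nat \<lfloor>real n * \<sigma>\<rfloor>)) \<longlonglongrightarrow> 0"
        proof (rule tendstoI)
          fix d :: real assume "d > 0"
          then have "d / 2 > 0" by simp
          from lim[OF _ _ this, of \<sigma>] True
          have "\<forall>\<^sub>F n in sequentially. \<beta> n (nat \<lfloor>real n * \<sigma>\<rfloor>) \<le> c + d / 2" by simp
          then show "\<forall>\<^sub>F n in sequentially. dist (e n (nat \<lfloor>real n * \<sigma>\<rfloor>)) 0 < d"
            by eventually_elim (use \<open>d > 0\<close> in \<open>auto simp: e_def\<close>)
        qed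
        then have "(\<lambda>n. e (Suc n) (nat \<lfloor>real (Suc n) * \<sigma>\<rfloor>)) \<longlonglongrightarrow> 0" by (rule LIMSEQ_Suc)
        then show ?thesis using True by (simp add: E_eq del: of_nat_Suc)
      qed (auto simp: E_eq)
    qed
  qed simp
  then have "(\<lambda>n. integral\<^sup>L lborel (E (Suc n))) \<longlonglongrightarrow> 0" by simp
  then have "(\<lambda>n. integral\<^sup>L lborel (E n)) \<longlonglongrightarrow> 0" by (rule LIMSEQ_imp_Suc)
  then have "\<forall>\<^sub>F n in sequentially. integral\<^sup>L lborel (E n) < \<epsilon>"
    using \<open>\<epsilon> > 0\<close> by (rule order_tendstoD(2))
  then show ?thesis using eventually_gt_at_top[of 0]
  proof eventually_elim
    case (elim n)
    have "(\<Sum>k<n * S. \<beta> n k) \<le> (\<Sum>k<n * S. c + e n k)" by (rule sum_mono) (simp add: e_def)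
    also have "\<dots> = real n * (real S * c) + (\<Sum>k<n * S. e n k)" by (simp add: sum.distrib)
    finally have "(\<Sum>k<n * S. \<beta> n k) / real n \<le> (real n * (real S * c) + (\<Sum>k<n * S. e n k)) / real n"
      by (rule divide_right_mono) simp
    also have "\<dots> = real S * c + integral\<^sup>L lborel (E n)"
      using elim(2) by (simp add: E_int add_divide_distrib)
    finally show ?case using elim(1) by simp
  qed
qed

context chernoff_family
begin

text \<open>A discrete Laplace transform: \<open>q ^ k\<close> replaces
  \<open>exp (- \<mu> * s)\<close>, and \<open>q * (1 + \<mu> * r) = 1\<close> makes the weighted
  terms telescope.\<close>

lemma power_resolvent_telescope:
  assumes "r > 0" "\<mu> \<ge> 0" "linear \<phi>"
  defines "q \<equiv> 1 / (1 + \<mu> * r)"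
  shows "\<phi> f - q ^ m *\<^sub>R \<phi> ((V r ^^ m) f) =
    (\<Sum>k<m. (q ^ Suc k * r) *\<^sub>R (\<mu> *\<^sub>R \<phi> ((V r ^^ k) f) - \<phi> ((V r ((V r ^^ k) f) - (V r ^^ k) f) /\<^sub>R r)))"
proof -
  have pos: "1 + \<mu> * r > 0" using assms(1,2) by (simp add: add_pos_nonneg)
  have q: "q * (1 + \<mu> * r) = 1" using pos by (simp add: q_def)
  have "(q ^ Suc k * r) *\<^sub>R (\<mu> *\<^sub>R \<phi> u - \<phi> ((V r u - u) /\<^sub>R r)) = q ^ k *\<^sub>R \<phi> u - q ^ Suc k *\<^sub>R \<phi> (V r u)" for k u
  proof -
    have "r *\<^sub>R (\<mu> *\<^sub>R \<phi> u - \<phi> ((V r u - u) /\<^sub>R r)) = (1 + \<mu> * r) *\<^sub>R \<phi> u - \<phi> (V r u)"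
      using assms(1) by (simp add: linear_scale[OF assms(3)] linear_diff[OF assms(3)] algebra_simps)
    then have "(q ^ Suc k * r) *\<^sub>R (\<mu> *\<^sub>R \<phi> u - \<phi> ((V r u - u) /\<^sub>R r))
        = q ^ Suc k *\<^sub>R ((1 + \<mu> * r) *\<^sub>R \<phi> u - \<phi> (V r u))"
      by (metis scaleR_scaleR)
    also have "\<dots> = (q ^ k * (q * (1 + \<mu> * r))) *\<^sub>R \<phi> u - q ^ Suc k *\<^sub>R \<phi> (V r u)"
      by (simp add: scaleR_diff_right mult_ac)
    finally show ?thesis by (simp add: q)
  qed
  then have "(\<Sum>k<m. (q ^ Suc k * r) *\<^sub>R (\<mu> *\<^sub>R \<phi> ((V r ^^ k) f) - \<phi> ((V r ((V r ^^ k) f) - (V r ^^ k) f) /\<^sub>R r)))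
      = (\<Sum>k<m. q ^ k *\<^sub>R \<phi> ((V r ^^ k) f) - q ^ Suc k *\<^sub>R \<phi> ((V r ^^ Suc k) f))"
    by simp
  also have "\<dots> = \<phi> f - q ^ m *\<^sub>R \<phi> ((V r ^^ m) f)"
    using sum_lessThan_telescope'[of "\<lambda>k. q ^ k *\<^sub>R \<phi> ((V r ^^ k) f)" m] by simp
  finally show ?thesis by simp
qed

(* \<psi> annihilates the range of \<mu> - L, and pairs is a part of the graph of the adjoint of L on which the
   adjoint difference quotients of V converge in norm. With L_r = (V r - 1) / r, the telescoping identity
   expresses \<phi> f through \<mu> \<phi> u - \<phi> (L_r u) along the orbit u of f. There \<phi> (L_r u) is close to \<phi> (L F),
   hence to \<psi> (L F) = \<mu> \<psi> F if \<phi> is close to \<psi>. The bound N s on L F is not uniform in s; a uniform one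
   for \<phi> (L F) comes from L_r u = (V r ^^ k) (L_r f) and f being in the domain of L. *)
lemma annihilator_vanishes:
  fixes F Y :: "real \<Rightarrow> nat \<Rightarrow> 'a" and N :: "real \<Rightarrow> real"
    and pairs :: "(('a \<Rightarrow>\<^sub>L 'k::real_normed_vector) \<times> ('a \<Rightarrow>\<^sub>L 'k)) set"
  assumes "t > 0" and "\<mu> > a"
    and expansion: "\<And>\<phi> \<phi>' \<epsilon>. (\<phi>, \<phi>') \<in> pairs \<Longrightarrow> \<epsilon> > 0 \<Longrightarrow>
      \<forall>\<^sub>F r in at_right 0. \<forall>x. norm (blinfun_apply \<phi> (V r x) - blinfun_apply \<phi> x - r *\<^sub>R blinfun_apply \<phi>' x) \<le> \<epsilon> * r * norm x"
    and adj: "\<And>\<phi> \<phi>' x y. (\<phi>, \<phi>') \<in> pairs \<Longrightarrow> (x, y) \<in> L \<Longrightarrow> blinfun_apply \<phi> y = blinfun_apply \<phi>' x"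
    and \<psi>: "\<psi> \<in> closure (Domain pairs)"
    and eig: "\<And>x y. (x, y) \<in> L \<Longrightarrow> blinfun_apply \<psi> y = \<mu> *\<^sub>R blinfun_apply \<psi> x"
    and fg: "(f, g) \<in> L"
    and approx_in_L: "\<And>s n. s \<ge> 0 \<Longrightarrow> n \<ge> 1 \<Longrightarrow> (F s n, Y s n) \<in> L"
    and approx_near: "\<And>s. s \<ge> 0 \<Longrightarrow>
      (\<lambda>n. norm ((V (t / real n) ^^ nat \<lfloor>real n * s\<rfloor>) f - F s n)) \<longlonglongrightarrow> 0"
    and approx_bounded: "\<And>s n. s \<ge> 0 \<Longrightarrow> n \<ge> 1 \<Longrightarrow> norm (Y s n) \<le> N s"
  shows "blinfun_apply \<psi> f = 0"
proof -
  have \<mu>: "\<mu> > 0" using \<open>\<mu> > a\<close> a_nonneg by simp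
  define q where "q = (\<lambda>n x. (V (t / real n) x - x) /\<^sub>R (t / real n))"
  define u where "u = (\<lambda>n s. (V (t / real n) ^^ nat \<lfloor>real n * s\<rfloor>) f)"
  have r_pos: "t / real n > 0" if "n > 0" for n using that \<open>t > 0\<close> by simp
  have t_filter: "filterlim (\<lambda>n. t / real n) (at_right 0) sequentially"
    using sampling_const[OF \<open>t > 0\<close>] by (simp add: sampling_def)
  have "(\<lambda>n. q n f) \<longlonglongrightarrow> g"
    unfolding q_def using filterlim_compose[OF consistent[OF fg] t_filter] .
  then have "Bseq (\<lambda>n. q n f)" by (intro convergent_imp_Bseq convergentI)
  then obtain Q where Q: "Q > 0" "\<And>n. norm (q n f) \<le> Q" by (auto simp: Bseq_def)
  have bound: "norm ((V (t / real n) ^^ k) x) \<le> K (t * s) * norm x"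
    if "n > 0" "real k \<le> real n * s" for n k s x
  proof (rule power_bound[OF r_pos[OF \<open>n > 0\<close>]])
    have "t / real n * real k \<le> t / real n * (real n * s)" using that \<open>t > 0\<close> by (intro mult_left_mono) auto
    then show "t / real n * real k \<le> t * s" using that by simp
  qed
  have q_commute: "q n ((V (t / real n) ^^ k) f) = (V (t / real n) ^^ k) (q n f)" if "n > 0" for n k
    unfolding q_def using r_pos[OF that] by (simp add: power_scaleR power_diff funpow_swap1)
  have q_bound: "norm (q n ((V (t / real n) ^^ k) f)) \<le> K (t * s) * Q" if "n > 0" "real k \<le> real n * s" "s \<ge> 0" for n k s
    unfolding q_commute[OF \<open>n > 0\<close>]
    using bound[OF that(1,2), of "q n f"] Q(2)[of n] K_ge_1[of "t * s"] that \<open>t > 0\<close>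
    by (intro order_trans[OF bound[OF that(1,2)] mult_left_mono]) auto
  have floor_le: "real (nat \<lfloor>real n * s\<rfloor>) \<le> real n * s" if "s \<ge> 0" for n s
    using that by simp
  \<comment> \<open>Bounds \<open>\<mu> *\<^sub>R x - q n x\<close> for \<open>x\<close> on the
    exact orbit up to \<open>s\<close>; it does not involve \<open>N s\<close>.\<close>
  define c where "c = (\<lambda>s. K (t * s) * (\<mu> * norm f + Q))"
  have c_nonneg: "c s \<ge> 0" if "s \<ge> 0" for s
    unfolding c_def using K_ge_1[of "t * s"] that \<open>t > 0\<close> \<mu> Q(1) by (intro mult_nonneg_nonneg add_nonneg_nonneg) auto

  have triangle: "norm (- x1 + x2 + x3 - x4 + x5 + x6) \<le>
      norm x1 + norm x2 + norm x3 + norm x4 + norm x5 + norm x6" for x1 x2 x3 x4 x5 x6 :: 'k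
    using norm_triangle_ineq[of "- x1 + x2 + x3 - x4 + x5" x6] norm_triangle_ineq[of "- x1 + x2 + x3 - x4" x5]
      norm_triangle_ineq4[of "- x1 + x2 + x3" x4] norm_triangle_ineq[of "- x1 + x2" x3]
      norm_triangle_ineq[of "- x1" x2] norm_minus_cancel[of x1] by linarith

  have pointwise: "\<forall>\<^sub>F n in sequentially. norm (\<mu> *\<^sub>R \<phi> (u n s) - \<phi> (q n (u n s))) \<le> norm (\<psi> - \<phi>) * c s + \<epsilon>"
    if \<phi>: "(\<phi>, \<phi>') \<in> pairs" and "s \<ge> 0" "\<epsilon> > 0" for \<phi> \<phi>' s \<epsilon>
  proof -
    define k where "k = K (t * s)"
    have k: "k \<ge> 1" unfolding k_def using K_ge_1 \<open>s \<ge> 0\<close> \<open>t > 0\<close> by simp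
    have F: "(\<lambda>n. norm (u n s - F s n)) \<longlonglongrightarrow> 0"
      using approx_near[OF \<open>s \<ge> 0\<close>] by (simp add: u_def)
    note FY = approx_in_L[OF \<open>s \<ge> 0\<close>] and N = approx_bounded[OF \<open>s \<ge> 0\<close>]
    have N0: "N s \<ge> 0" using N[of 1] norm_ge_zero[of "Y s 1"] by linarith
    define \<eta> where "\<eta> = \<epsilon> / 6"
    have "\<eta> > 0" using \<open>\<epsilon> > 0\<close> by (simp add: \<eta>_def)
    have u_le: "norm (u n s) \<le> k * norm f" if "n > 0" for n
      unfolding u_def k_def using bound[OF that floor_le[OF \<open>s \<ge> 0\<close>]] .
    have qu_le: "norm (q n (u n s)) \<le> k * Q" if "n > 0" for n
      unfolding u_def k_def using q_bound[OF that floor_le[OF \<open>s \<ge> 0\<close>] \<open>s \<ge> 0\<close>] .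
    have F_small: "\<forall>\<^sub>F n in sequentially. norm (\<theta> (u n s - F s n)) \<le> \<eta>" for \<theta> :: "'a \<Rightarrow>\<^sub>L 'k"
    proof -
      have "(\<lambda>n. norm \<theta> * norm (u n s - F s n)) \<longlonglongrightarrow> norm \<theta> * 0" by (intro tendsto_intros F)
      then have "\<forall>\<^sub>F n in sequentially. norm \<theta> * norm (u n s - F s n) < \<eta>"
        using \<open>\<eta> > 0\<close> by (intro order_tendstoD(2)) auto
      then show ?thesis by eventually_elim (rule order_trans[OF norm_blinfun less_imp_le])
    qed
    have quot: "\<forall>\<^sub>F n in sequentially. norm (\<theta> (q n (u n s)) - \<theta> (Y s n)) \<le> 2 * \<eta>"
      if \<theta>: "(\<theta>, \<theta>') \<in> pairs" for \<theta> \<theta>'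
    proof -
      have "\<eta> / (k * norm f + 1) > 0" using k \<open>\<eta> > 0\<close> by (simp add: add_nonneg_pos)
      have "\<forall>\<^sub>F n in sequentially. \<forall>x. norm (\<theta> (V (t / real n) x) - \<theta> x - (t / real n) *\<^sub>R \<theta>' x)
          \<le> \<eta> / (k * norm f + 1) * (t / real n) * norm x"
        by (rule sampling_eventually(3)[OF sampling_const[OF \<open>t > 0\<close>] expansion[OF \<theta> \<open>\<eta> / (k * norm f + 1) > 0\<close>]])
      then show ?thesis using F_small[of \<theta>'] eventually_gt_at_top[of 0]
      proof eventually_elim
        case (elim n)
        define x where "x = u n s"
        define r where "r = t / real n"
        have r: "r > 0" using r_pos elim(3) by (simp add: r_def)
        have "\<theta> (q n x) - \<theta>' x = (\<theta> (V r x) - \<theta> x - r *\<^sub>R \<theta>' x) /\<^sub>R r"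
          unfolding q_def r_def[symmetric]
          using r by (simp add: blinfun.scaleR_right blinfun.diff_right scaleR_diff_right)
        then have "norm (\<theta> (q n x) - \<theta>' x) = norm (\<theta> (V r x) - \<theta> x - r *\<^sub>R \<theta>' x) / r"
          using r by (simp only: norm_scaleR abs_inverse abs_of_pos divide_inverse_commute)
        also have "\<dots> \<le> \<eta> / (k * norm f + 1) * norm x"
          using elim(1)[rule_format, of x, folded r_def] r by (simp only: pos_divide_le_eq) (simp add: mult_ac)
        also have "\<dots> \<le> \<eta> / (k * norm f + 1) * (k * norm f + 1)"
          using u_le[OF elim(3)] k \<open>\<eta> > 0\<close> by (intro mult_left_mono) (auto simp: x_def)
        also have "\<dots> = \<eta>" using k by (simp add: add_nonneg_pos less_imp_neq[symmetric])
        finally have 1: "norm (\<theta> (q n x) - \<theta>' x) \<le> \<eta>" .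
        have "\<theta> (Y s n) = \<theta>' (F s n)" using adj[OF \<theta> FY] elim(3) by simp
        then have eq: "\<theta> (q n x) - \<theta> (Y s n) = (\<theta> (q n x) - \<theta>' x) + \<theta>' (x - F s n)"
          by (simp add: blinfun.diff_right)
        show ?case
          using 1 elim(2) norm_triangle_ineq[of "\<theta> (q n x) - \<theta>' x" "\<theta>' (x - F s n)"]
          unfolding x_def[symmetric] eq by linarith
      qed
    qed
    \<comment> \<open>\<open>\<phi>1\<close> is chosen after \<open>s\<close>, so close to
      \<open>\<psi>\<close> that even the bound \<open>N s\<close> is absorbed. The fixed
      \<open>\<phi>\<close> is compared with \<open>\<psi>\<close> only on the exact orbit, where
      \<open>c s\<close> is available.\<close>
    have "\<eta> / (N s + k * Q + 1) > 0" using N0 k Q \<open>\<eta> > 0\<close> by (simp add: add_nonneg_pos)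
    then obtain \<phi>1 \<phi>1' where \<phi>1: "(\<phi>1, \<phi>1') \<in> pairs" "dist \<phi>1 \<psi> < \<eta> / (N s + k * Q + 1)"
      using \<psi> unfolding closure_approachable by blast
    have close: "norm (\<psi> - \<phi>1) * (N s + k * Q) \<le> \<eta>"
    proof -
      have pos: "N s + k * Q + 1 > 0" "N s + k * Q \<ge> 0" using N0 k Q by (simp_all add: add_nonneg_pos)
      have "norm (\<psi> - \<phi>1) * (N s + k * Q) \<le> \<eta> / (N s + k * Q + 1) * (N s + k * Q + 1)"
        using \<phi>1(2) pos \<open>\<eta> > 0\<close> by (intro mult_mono) (auto simp: dist_norm norm_minus_commute)
      then show ?thesis using pos by simp
    qed
    show ?thesis
      using quot[OF \<phi>] quot[OF \<phi>1(1)] F_small[of "\<mu> *\<^sub>R \<psi>"] eventually_gt_at_top[of 0]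
    proof eventually_elim
      case (elim n)
      define x where "x = u n s"
      have \<psi>Y: "\<psi> (Y s n) = \<mu> *\<^sub>R \<psi> (F s n)" using eig FY elim(4) by simp
      \<comment> \<open>The route at \<open>q n x\<close> is from \<open>\<phi>\<close> to
        \<open>\<psi>\<close> to \<open>\<phi>1\<close>, then to \<open>Y s n\<close> and back to
        \<open>\<psi>\<close>; the eigenvalue relation leads to
        \<open>\<mu> *\<^sub>R \<psi>\<close> at \<open>F s n\<close>, from there to
        \<open>x\<close> and to \<open>\<phi>\<close>.\<close>
      have eq: "\<mu> *\<^sub>R \<phi> x - \<phi> (q n x) = - (\<mu> *\<^sub>R (\<psi> - \<phi>) x) + (\<mu> *\<^sub>R \<psi>) (x - F s n) + (\<psi> - \<phi>1) (Y s n)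
          - (\<phi>1 (q n x) - \<phi>1 (Y s n)) + (\<phi>1 - \<psi>) (q n x) + (\<psi> - \<phi>) (q n x)"
        by (simp add: blinfun.diff_left blinfun.diff_right blinfun.scaleR_left \<psi>Y algebra_simps)
      have "norm (\<mu> *\<^sub>R (\<psi> - \<phi>) x) \<le> norm (\<psi> - \<phi>) * (\<mu> * (k * norm f))"
        using order_trans[OF norm_blinfun mult_left_mono[OF u_le[OF elim(4)]], of "\<psi> - \<phi>"] \<mu>
        by (simp add: x_def mult_left_mono mult.left_commute)
      moreover have "norm ((\<mu> *\<^sub>R \<psi>) (x - F s n)) \<le> \<eta>" using elim(3) by (simp add: x_def)
      moreover have "norm ((\<psi> - \<phi>1) (Y s n)) \<le> norm (\<psi> - \<phi>1) * N s"
        using N[of n] elim(4) by (intro order_trans[OF norm_blinfun mult_left_mono]) auto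
      moreover have "norm (\<phi>1 (q n x) - \<phi>1 (Y s n)) \<le> 2 * \<eta>" using elim(2) by (simp add: x_def)
      moreover have "norm ((\<phi>1 - \<psi>) (q n x)) \<le> norm (\<psi> - \<phi>1) * (k * Q)"
        unfolding norm_minus_commute[of \<psi> \<phi>1] x_def
        using qu_le[OF elim(4)] by (intro order_trans[OF norm_blinfun mult_left_mono]) auto
      moreover have "norm ((\<psi> - \<phi>) (q n x)) \<le> norm (\<psi> - \<phi>) * (k * Q)"
        unfolding x_def using qu_le[OF elim(4)] by (intro order_trans[OF norm_blinfun mult_left_mono]) auto
      ultimately have "norm (\<mu> *\<^sub>R \<phi> x - \<phi> (q n x)) \<le> norm (\<psi> - \<phi>) * (\<mu> * (k * norm f)) + \<eta>
          + norm (\<psi> - \<phi>1) * N s + 2 * \<eta> + norm (\<psi> - \<phi>1) * (k * Q) + norm (\<psi> - \<phi>) * (k * Q)"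
        unfolding eq using triangle[of "\<mu> *\<^sub>R (\<psi> - \<phi>) x" "(\<mu> *\<^sub>R \<psi>) (x - F s n)" "(\<psi> - \<phi>1) (Y s n)"
          "\<phi>1 (q n x) - \<phi>1 (Y s n)" "(\<phi>1 - \<psi>) (q n x)" "(\<psi> - \<phi>) (q n x)"] by linarith
      also have "\<dots> = norm (\<psi> - \<phi>) * c s + norm (\<psi> - \<phi>1) * (N s + k * Q) + 3 * \<eta>"
        by (simp add: c_def k_def algebra_simps)
      also have "\<dots> \<le> norm (\<psi> - \<phi>) * c s + \<epsilon>" using close \<open>\<eta> > 0\<close> by (simp add: \<eta>_def)
      finally show ?case by (simp add: x_def)
    qed
  qed

  \<comment> \<open>The horizon is \<open>n * S\<close> steps of length \<open>t / n\<close>. The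
    first term is the weighted end point of the telescope, the second the average of the pointwise
    bounds.\<close>
  have finite_time: "norm (\<phi> f) \<le> exp (- \<mu> * t) ^ S * (norm \<phi> * (K (t * real S) * norm f)) + t * (real S * (norm (\<psi> - \<phi>) * c (real S)))"
    if \<phi>: "(\<phi>, \<phi>') \<in> pairs" for \<phi> \<phi>' and S :: nat
  proof (rule field_le_epsilon)
    fix e :: real assume "e > 0"
    then have "e / (t + 1) > 0" using \<open>t > 0\<close> by simp
    define \<beta> where "\<beta> = (\<lambda>n k. if n = 0 then 0 else
      norm (\<mu> *\<^sub>R \<phi> ((V (t / real n) ^^ k) f) - \<phi> (q n ((V (t / real n) ^^ k) f))))"
    have k_le: "real k \<le> real n * real S" if "k < n * S" for n k
      using less_imp_le[OF that[folded of_nat_less_iff[where ?'a = real]]] by simp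
    have b1: "\<bar>\<beta> n k\<bar> \<le> norm \<phi> * c (real S)" if "k < n * S" for n k
    proof -
      have "n > 0" using that by (cases n) auto
      have "norm (\<mu> *\<^sub>R \<phi> ((V (t / real n) ^^ k) f)) \<le> \<mu> * (norm \<phi> * (K (t * real S) * norm f))"
        using \<mu> bound[OF \<open>n > 0\<close> k_le[OF that], of f]
        by (simp, intro order_trans[OF norm_blinfun mult_left_mono]) auto
      moreover have "norm (\<phi> (q n ((V (t / real n) ^^ k) f))) \<le> norm \<phi> * (K (t * real S) * Q)"
        using q_bound[OF \<open>n > 0\<close> k_le[OF that]] by (intro order_trans[OF norm_blinfun mult_left_mono]) auto
      ultimately have "norm (\<mu> *\<^sub>R \<phi> ((V (t / real n) ^^ k) f) - \<phi> (q n ((V (t / real n) ^^ k) f)))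
          \<le> \<mu> * (norm \<phi> * (K (t * real S) * norm f)) + norm \<phi> * (K (t * real S) * Q)"
        by (rule order_trans[OF norm_triangle_ineq4 add_mono])
      then show ?thesis using \<open>n > 0\<close> by (simp add: \<beta>_def c_def algebra_simps)
    qed
    have b2: "\<forall>\<^sub>F n in sequentially. \<beta> n (nat \<lfloor>real n * s\<rfloor>) \<le> norm (\<psi> - \<phi>) * c (real S) + \<epsilon>"
      if "0 \<le> s" "s < real S" "\<epsilon> > 0" for s \<epsilon>
      using pointwise[OF \<phi> that(1,3)]
    proof eventually_elim
      case (elim n)
      have "c s \<le> c (real S)"
        unfolding c_def using that \<open>t > 0\<close> \<mu> Q(1) by (intro mult_right_mono K_mono) auto
      then have "norm (\<psi> - \<phi>) * c s \<le> norm (\<psi> - \<phi>) * c (real S)" by (intro mult_left_mono) auto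
      moreover have "0 \<le> norm (\<psi> - \<phi>) * c s" using c_nonneg that by simp
      ultimately show ?case using elim \<open>\<epsilon> > 0\<close> by (auto simp: \<beta>_def u_def)
    qed
    have avg: "\<forall>\<^sub>F n in sequentially. (\<Sum>k<n * S. \<beta> n k) / real n \<le> real S * (norm (\<psi> - \<phi>) * c (real S)) + e / (t + 1)"
      by (rule average_limsup_le[where \<beta> = \<beta> and S = S]) (fact b1 b2 \<open>e / (t + 1) > 0\<close>)+
    have "(\<lambda>n. (1 / (1 + \<mu> * t / real n) ^ n) ^ S) \<longlonglongrightarrow> (1 / exp (\<mu> * t)) ^ S"
      by (intro tendsto_intros tendsto_exp_limit_sequentially) simp
    then have weight: "(\<lambda>n. (1 / (1 + \<mu> * t / real n) ^ n) ^ S) \<longlonglongrightarrow> exp (- \<mu> * t) ^ S"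
      by (simp add: exp_minus inverse_eq_divide)
    let ?A = "norm \<phi> * (K (t * real S) * norm f)"
    have ev: "\<forall>\<^sub>F n in sequentially. norm (\<phi> f) \<le>
        (1 / (1 + \<mu> * t / real n) ^ n) ^ S * ?A + t * (real S * (norm (\<psi> - \<phi>) * c (real S)) + e / (t + 1))"
      using avg eventually_gt_at_top[of 0]
    proof eventually_elim
      case (elim n)
      define r where "r = t / real n"
      have r: "r > 0" using r_pos elim(2) by (simp add: r_def)
      define w where "w = 1 / (1 + \<mu> * r)"
      have "\<mu> * r > 0" using r \<mu> by simp
      then have w: "0 \<le> w" "w \<le> 1" by (auto simp: w_def)
      have lin: "linear \<phi>" by (simp add: blinfun.bounded_linear_right bounded_linear.linear)
      have wS: "w ^ (n * S) = (1 / (1 + \<mu> * t / real n) ^ n) ^ S"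
        by (simp add: w_def r_def power_mult power_one_over)
      have "norm (\<phi> f - w ^ (n * S) *\<^sub>R \<phi> ((V r ^^ (n * S)) f)) \<le> (\<Sum>k<n * S. r * \<beta> n k)"
        unfolding power_resolvent_telescope[OF r less_imp_le[OF \<mu>] lin, folded w_def]
      proof (rule sum_norm_le)
        fix k assume "k \<in> {..<n * S}"
        have \<beta>_eq: "\<beta> n k = norm (\<mu> *\<^sub>R \<phi> ((V r ^^ k) f) - \<phi> ((V r ((V r ^^ k) f) - (V r ^^ k) f) /\<^sub>R r))"
          using elim(2) by (simp only: \<beta>_def q_def r_def if_False less_irrefl neq0_conv[symmetric])
        have "\<bar>w ^ Suc k * r\<bar> = w ^ Suc k * r" using w r by (intro abs_of_nonneg mult_nonneg_nonneg) auto
        then have "norm ((w ^ Suc k * r) *\<^sub>R (\<mu> *\<^sub>R \<phi> ((V r ^^ k) f) - \<phi> ((V r ((V r ^^ k) f) - (V r ^^ k) f) /\<^sub>R r)))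
            = (w ^ Suc k * r) * \<beta> n k"
          by (simp only: norm_scaleR \<beta>_eq)
        also have "\<dots> \<le> (1 * r) * \<beta> n k"
          using w r by (intro mult_right_mono power_le_one) (auto simp: \<beta>_def simp del: power_Suc intro: power_le_one)
        finally show "norm ((w ^ Suc k * r) *\<^sub>R (\<mu> *\<^sub>R \<phi> ((V r ^^ k) f) - \<phi> ((V r ((V r ^^ k) f) - (V r ^^ k) f) /\<^sub>R r)))
            \<le> r * \<beta> n k" by simp
      qed
      also have "\<dots> = t * ((\<Sum>k<n * S. \<beta> n k) / real n)" by (simp add: r_def sum_divide_distrib sum_distrib_left)
      also have "\<dots> \<le> t * (real S * (norm (\<psi> - \<phi>) * c (real S)) + e / (t + 1))"
        using elim(1) \<open>t > 0\<close> by (intro mult_left_mono) auto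
      finally have 1: "norm (\<phi> f - w ^ (n * S) *\<^sub>R \<phi> ((V r ^^ (n * S)) f)) \<le> \<dots>" .
      have "norm (\<phi> ((V r ^^ (n * S)) f)) \<le> ?A"
        unfolding r_def using bound[of n "n * S" "real S" f] elim(2)
        by (intro order_trans[OF norm_blinfun mult_left_mono]) auto
      then have "norm (w ^ (n * S) *\<^sub>R \<phi> ((V r ^^ (n * S)) f)) \<le> w ^ (n * S) * ?A"
        using w by (simp add: mult_left_mono)
      then show ?case
        using 1 norm_triangle_sub[of "\<phi> f" "w ^ (n * S) *\<^sub>R \<phi> ((V r ^^ (n * S)) f)"] unfolding wS by linarith
    qed
    have "norm (\<phi> f) \<le> exp (- \<mu> * t) ^ S * ?A + t * (real S * (norm (\<psi> - \<phi>) * c (real S)) + e / (t + 1))"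
      by (rule tendsto_le[OF sequentially_bot _ tendsto_const ev]) (intro tendsto_intros weight)
    also have "\<dots> \<le> exp (- \<mu> * t) ^ S * ?A + t * (real S * (norm (\<psi> - \<phi>) * c (real S))) + e"
      using \<open>t > 0\<close> \<open>e > 0\<close> by (simp add: field_simps)
    finally show "norm (\<phi> f) \<le> exp (- \<mu> * t) ^ S * ?A + t * (real S * (norm (\<psi> - \<phi>) * c (real S))) + e" .
  qed

  \<comment> \<open>Order of limits: first \<open>\<phi> \<rightarrow> \<psi>\<close> at fixed
    \<open>S\<close>, which removes the term growing with \<open>S\<close>; then
    \<open>S \<rightarrow> \<infinity>\<close>, where the weight beats the stability bound because
    \<open>\<mu> > a\<close>.\<close>
  obtain \<Phi> where \<Phi>: "\<And>i. \<Phi> i \<in> Domain pairs" "\<Phi> \<longlonglongrightarrow> \<psi>"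
    using \<psi> unfolding closure_sequential by blast
  have decay: "norm (\<psi> f) \<le> exp ((a - \<mu>) * t) ^ S * (norm \<psi> * (M * norm f))" for S :: nat
  proof -
    have "norm (\<psi> f) \<le> exp (- \<mu> * t) ^ S * (norm \<psi> * (K (t * real S) * norm f)) + t * (real S * (norm (\<psi> - \<psi>) * c (real S)))"
    proof (rule LIMSEQ_le)
      show "(\<lambda>i. norm (\<Phi> i f)) \<longlonglongrightarrow> norm (\<psi> f)" by (intro tendsto_intros \<Phi>)
      show "(\<lambda>i. exp (- \<mu> * t) ^ S * (norm (\<Phi> i) * (K (t * real S) * norm f)) + t * (real S * (norm (\<psi> - \<Phi> i) * c (real S))))
          \<longlonglongrightarrow> exp (- \<mu> * t) ^ S * (norm \<psi> * (K (t * real S) * norm f)) + t * (real S * (norm (\<psi> - \<psi>) * c (real S)))"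
        by (intro tendsto_intros \<Phi>)
      show "\<exists>N. \<forall>i\<ge>N. norm (\<Phi> i f) \<le> exp (- \<mu> * t) ^ S * (norm (\<Phi> i) * (K (t * real S) * norm f))
          + t * (real S * (norm (\<psi> - \<Phi> i) * c (real S)))"
        using finite_time \<Phi>(1) by blast
    qed
    also have "\<dots> = exp (- \<mu> * t) ^ S * exp (a * t) ^ S * (norm \<psi> * (M * norm f))"
      by (simp add: K_def mult_ac flip: exp_of_nat_mult)
    also have "exp (- \<mu> * t) ^ S * exp (a * t) ^ S = exp ((a - \<mu>) * t) ^ S"
      by (simp add: algebra_simps flip: power_mult_distrib exp_add)
    finally show ?thesis .
  qed
  have "(\<lambda>S. exp ((a - \<mu>) * t) ^ S * (norm \<psi> * (M * norm f))) \<longlonglongrightarrow> 0 * (norm \<psi> * (M * norm f))"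
    using \<open>\<mu> > a\<close> \<open>t > 0\<close> by (intro tendsto_intros LIMSEQ_power_zero) (simp add: mult_neg_pos)
  then have "norm (\<psi> f) \<le> 0 * (norm \<psi> * (M * norm f))"
    by (rule tendsto_lowerbound) (use decay in auto)
  then show ?thesis by simp
qed

end


subsection \<open>The Trotter product\<close>

lemma single_valued_generator: "single_valued (generator T)"
  unfolding single_valued_def generator_def
  by (auto intro: tendsto_unique[OF trivial_limit_at_right_real])

lemma op_apply_eq: "single_valued G \<Longrightarrow> (x, y) \<in> G \<Longrightarrow> op_apply G x = y"
  unfolding op_apply_def single_valued_def by blast

lemma single_valued_op_sum: "single_valued G \<Longrightarrow> single_valued H \<Longrightarrow> single_valued (op_sum G H)"
  unfolding op_sum_def single_valued_def by blast

lemma semigroup_exp: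
  assumes "is_generator scl G"
  shows "c0_semigroup scl (semigroup_exp scl G)" "generator (semigroup_exp scl G) = G"
proof -
  have "\<exists>T. c0_semigroup scl T \<and> generator T = G" using assms by (simp add: is_generator_def)
  then have "c0_semigroup scl (semigroup_exp scl G) \<and> generator (semigroup_exp scl G) = G"
    unfolding semigroup_exp_def by (rule someI_ex)
  then show "c0_semigroup scl (semigroup_exp scl G)" "generator (semigroup_exp scl G) = G" by auto
qed

lemma c0_semigroup_scl: "c0_semigroup scl T \<Longrightarrow> s \<ge> 0 \<Longrightarrow> T s (scl c x) = scl c (T s x)"
  unfolding c0_semigroup_def Vector_Spaces.linear_iff by blast

context normed_space_over
begin

lemma generator_scl:
  assumes T: "c0_semigroup scl T" and xy: "(x, y) \<in> generator T"
  shows "(scl c x, scl c y) \<in> generator T"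
proof -
  interpret sc: bounded_linear "scl c" by (rule bounded_linear_scl)
  have "((\<lambda>h. scl c ((T h x - x) /\<^sub>R h)) \<longlongrightarrow> scl c y) (at_right 0)"
    using xy by (intro sc.tendsto) (simp add: generator_def)
  moreover have "\<forall>\<^sub>F h in at_right 0. scl c ((T h x - x) /\<^sub>R h) = (T h (scl c x) - scl c x) /\<^sub>R h"
    using eventually_at_right_less
    by eventually_elim (simp add: sc.scaleR sc.diff c0_semigroup_scl[OF T])
  ultimately have "((\<lambda>h. (T h (scl c x) - scl c x) /\<^sub>R h) \<longlongrightarrow> scl c y) (at_right 0)"
    by (rule Lim_transform_eventually)
  then show ?thesis by (simp add: generator_def)
qed

text \<open>The range is a subspace for \<open>scl\<close>, so a functional separating a missing
  point annihilates it, and annihilation is the relation in \<open>vanish\<close>.\<close>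

lemma dense_range_if_no_annihilator:
  assumes L: "Real_Vector_Spaces.subspace L" "\<And>c x y. (x, y) \<in> L \<Longrightarrow> (scl c x, scl c y) \<in> L"
    and vanish: "\<And>\<psi>. \<psi> \<in> dual_space scl \<Longrightarrow>
      (\<And>x y. (x, y) \<in> L \<Longrightarrow> blinfun_apply \<psi> y = \<mu> *\<^sub>R blinfun_apply \<psi> x) \<Longrightarrow> \<psi> = 0"
  shows "closure ((\<lambda>(x, y). \<mu> *\<^sub>R x - y) ` L) = UNIV"
proof (rule ccontr)
  let ?R = "(\<lambda>(x, y). \<mu> *\<^sub>R x - y) ` L"
  assume "closure ?R \<noteq> UNIV"
  then obtain z where z: "z \<notin> closure ?R" by blast
  have "module.subspace scl ?R"
    unfolding subspace_def
  proof (intro conjI ballI allI)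
    show "0 \<in> ?R" using real_vector.subspace_0[OF L(1)] by (force simp: zero_prod_def)
  next
    fix u v assume "u \<in> ?R" "v \<in> ?R"
    then obtain x y x' y' where "(x, y) \<in> L" "u = \<mu> *\<^sub>R x - y" "(x', y') \<in> L" "v = \<mu> *\<^sub>R x' - y'" by auto
    then have "(x + x', y + y') \<in> L" "u + v = \<mu> *\<^sub>R (x + x') - (y + y')"
      using real_vector.subspace_add[OF L(1)] by (fastforce simp: algebra_simps)+
    then show "u + v \<in> ?R" by force
  next
    fix c u assume "u \<in> ?R"
    then obtain x y where xy: "(x, y) \<in> L" "u = \<mu> *\<^sub>R x - y" by auto
    have "scl c u = \<mu> *\<^sub>R scl c x - scl c y" by (simp add: xy(2) scale_right_diff_distrib scl_scaleR)
    then show "scl c u \<in> ?R" using L(2)[OF xy(1), of c] by force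
  qed
  from separating_functional[OF this z] obtain \<psi> where \<psi>: "\<psi> \<in> dual_space scl"
    "\<And>x. x \<in> ?R \<Longrightarrow> blinfun_apply \<psi> x = 0" "blinfun_apply \<psi> z \<noteq> 0" by blast
  have "blinfun_apply \<psi> y = \<mu> *\<^sub>R blinfun_apply \<psi> x" if "(x, y) \<in> L" for x y
  proof -
    have "blinfun_apply \<psi> (\<mu> *\<^sub>R x - y) = 0" using that by (intro \<psi>(2)) force
    then show ?thesis by (simp add: blinfun.diff_right blinfun.scaleR_right)
  qed
  from vanish[OF \<psi>(1) this] \<psi>(3) show False by simp
qed

end

lemma blinfun_eq_0_if_dense:
  fixes \<psi> :: "'a::real_normed_vector \<Rightarrow>\<^sub>L 'b::real_normed_vector"
  assumes "closure A = UNIV" and "\<And>x. x \<in> A \<Longrightarrow> blinfun_apply \<psi> x = 0"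
  shows "\<psi> = 0"
proof -
  have "closed {x. blinfun_apply \<psi> x = 0}" by (intro closed_Collect_eq continuous_intros)
  then have "closure A \<subseteq> {x. blinfun_apply \<psi> x = 0}" using assms(2) by (intro closure_minimal) auto
  then show ?thesis using assms(1) by (intro blinfun_eqI) auto
qed

locale trotter_pair = normed_space_over scl
  for scl :: "'k::{real_normed_field,euclidean_space} \<Rightarrow> 'a::banach \<Rightarrow> 'a" +
  fixes C D :: "('a \<times> 'a) set" and M a :: real
  assumes generators: "is_generator scl C" "is_generator scl D"
    and dense: "closure (Domain C \<inter> Domain D) = UNIV"
    and stability: "r > 0 \<Longrightarrow>
      norm ((trotter_step scl C D r ^^ m) x) \<le> M * exp (a * (r * real m)) * norm x"
    and M_ge: "M \<ge> 1" and a_ge: "a \<ge> 0"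
begin

abbreviation "TC \<equiv> semigroup_exp scl C"
abbreviation "TD \<equiv> semigroup_exp scl D"
abbreviation "V \<equiv> trotter_step scl C D"
abbreviation "L \<equiv> op_sum C D"

lemma generator_TC: "generator TC = C" and generator_TD: "generator TD = D"
  by (rule semigroup_exp(2)[OF generators(1)], rule semigroup_exp(2)[OF generators(2)])

lemma c0_TC: "c0_semigroup scl TC" and c0_TD: "c0_semigroup scl TD"
  by (rule semigroup_exp(1)[OF generators(1)], rule semigroup_exp(1)[OF generators(2)])

sublocale TC: operator_semigroup TC by (rule c0_semigroup_imp_operator_semigroup[OF c0_TC])
sublocale TD: operator_semigroup TD by (rule c0_semigroup_imp_operator_semigroup[OF c0_TD])

lemma closure_Domain: "closure (Domain C) = UNIV" "closure (Domain D) = UNIV"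
  using dense closure_mono[of "Domain C \<inter> Domain D"] by blast+

lemma V_apply: "V r x = TC r (TD r x)"
  by (simp add: trotter_step_def)

lemma V_scl: "r > 0 \<Longrightarrow> V r (scl c x) = scl c (V r x)"
  by (simp add: V_apply c0_semigroup_scl[OF c0_TC] c0_semigroup_scl[OF c0_TD])

lemma subspace_op_sum: "Real_Vector_Spaces.subspace L"
proof -
  have C: "Real_Vector_Spaces.subspace C" and D: "Real_Vector_Spaces.subspace D"
    using TC.subspace_generator TD.subspace_generator by (simp_all add: generator_TC generator_TD)
  show ?thesis unfolding real_vector.subspace_def
  proof (intro conjI ballI allI)
    show "0 \<in> L" using real_vector.subspace_0[OF C] real_vector.subspace_0[OF D]
      unfolding op_sum_def by (force simp: zero_prod_def)
  next
    fix u v assume "u \<in> L" "v \<in> L"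
    then obtain x y z x' y' z' where uv: "u = (x, y + z)" "v = (x', y' + z')"
      and "(x, y) \<in> C" "(x, z) \<in> D" "(x', y') \<in> C" "(x', z') \<in> D"
      unfolding op_sum_def by blast
    then have "(x + x', y + y') \<in> C" "(x + x', z + z') \<in> D"
      using real_vector.subspace_add[OF C, of "(x, y)" "(x', y')"]
        real_vector.subspace_add[OF D, of "(x, z)" "(x', z')"] by auto
    moreover have "u + v = (x + x', (y + y') + (z + z'))" by (simp add: uv algebra_simps)
    ultimately show "u + v \<in> L" unfolding op_sum_def by blast
  next
    fix c :: real and u assume "u \<in> L"
    then obtain x y z where u: "u = (x, y + z)" and "(x, y) \<in> C" "(x, z) \<in> D"
      unfolding op_sum_def by blast
    then have "(c *\<^sub>R x, c *\<^sub>R y) \<in> C" "(c *\<^sub>R x, c *\<^sub>R z) \<in> D"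
      using real_vector.subspace_scale[OF C, of "(x, y)" c]
        real_vector.subspace_scale[OF D, of "(x, z)" c] by auto
    moreover have "c *\<^sub>R u = (c *\<^sub>R x, c *\<^sub>R y + c *\<^sub>R z)" by (simp add: u algebra_simps)
    ultimately show "c *\<^sub>R u \<in> L" unfolding op_sum_def by blast
  qed
qed

lemma op_sum_scl:
  assumes "(x, y) \<in> L"
  shows "(scl c x, scl c y) \<in> L"
proof -
  obtain y1 y2 where "(x, y1) \<in> C" "(x, y2) \<in> D" and y: "y = y1 + y2"
    using assms unfolding op_sum_def by blast
  then have "(scl c x, scl c y1) \<in> C" "(scl c x, scl c y2) \<in> D"
    using generator_scl[OF c0_TC, unfolded generator_TC] generator_scl[OF c0_TD, unfolded generator_TD] by auto
  then show ?thesis unfolding op_sum_def y scale_right_distrib by blast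
qed

lemma op_sum_apply: "(x, y) \<in> L \<Longrightarrow> op_apply L x = y"
  using single_valued_generator[of TC] single_valued_generator[of TD]
  by (intro op_apply_eq single_valued_op_sum) (simp_all add: generator_TC generator_TD)

text \<open>The quotient splits as \<open>TC r ((TD r x - x) /\<^sub>R r - y2) + TC r y2 + (TC r x -
  x) /\<^sub>R r\<close>; local boundedness of \<open>TC\<close> disposes of the first term.\<close>

lemma V_consistent:
  assumes "(x, y) \<in> L"
  shows "((\<lambda>r. (V r x - x) /\<^sub>R r) \<longlongrightarrow> y) (at_right 0)"
proof -
  obtain y1 y2 where xy: "(x, y1) \<in> C" "(x, y2) \<in> D" and y: "y = y1 + y2"
    using assms unfolding op_sum_def by blast
  have lim1: "((\<lambda>r. (TC r x - x) /\<^sub>R r) \<longlongrightarrow> y1) (at_right 0)"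
    and lim2: "((\<lambda>r. (TD r x - x) /\<^sub>R r) \<longlongrightarrow> y2) (at_right 0)"
    using xy generator_TC generator_TD unfolding generator_def by blast+
  obtain K where K: "K \<ge> 1" "\<And>s x. 0 \<le> s \<Longrightarrow> s \<le> 1 \<Longrightarrow> norm (TC s x) \<le> K * norm x"
    using TC.bounded_on_interval[of 1] by blast
  have ev: "\<forall>\<^sub>F r in at_right 0. r \<in> {0<..<(1::real)}" by (rule eventually_at_right_real) simp
  have "((\<lambda>r. TC r ((TD r x - x) /\<^sub>R r - y2)) \<longlongrightarrow> 0) (at_right 0)"
  proof (rule Lim_null_comparison)
    show "\<forall>\<^sub>F r in at_right 0. norm (TC r ((TD r x - x) /\<^sub>R r - y2)) \<le> K * norm ((TD r x - x) /\<^sub>R r - y2)"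
      using ev by eventually_elim (use K in auto)
    have "((\<lambda>r. K * norm ((TD r x - x) /\<^sub>R r - y2)) \<longlongrightarrow> K * norm (y2 - y2)) (at_right 0)"
      by (intro tendsto_intros lim2)
    then show "((\<lambda>r. K * norm ((TD r x - x) /\<^sub>R r - y2)) \<longlongrightarrow> 0) (at_right 0)" by simp
  qed
  from tendsto_add[OF tendsto_add[OF this TC.tendsto_right_zero[of y2]] lim1]
  have "((\<lambda>r. TC r ((TD r x - x) /\<^sub>R r - y2) + TC r y2 + (TC r x - x) /\<^sub>R r) \<longlongrightarrow> y) (at_right 0)"
    by (simp add: y add.commute)
  moreover have "\<forall>\<^sub>F r in at_right 0.
      TC r ((TD r x - x) /\<^sub>R r - y2) + TC r y2 + (TC r x - x) /\<^sub>R r = (V r x - x) /\<^sub>R r"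
    using ev
    by eventually_elim (simp add: V_apply TC.T_diff TC.T_add TC.T_scaleR algebra_simps)
  ultimately show ?thesis by (rule Lim_transform_eventually)
qed

sublocale chernoff_family V L M a
proof (rule chernoff_family.intro)
  show "bounded_linear (V r)" if "r > 0" for r
    using bounded_linear_compose[OF TC.bounded_linear TD.bounded_linear, of r r] that
    by (simp add: trotter_step_def comp_def)
  show "closure (Domain L) = UNIV" using dense by (simp add: Domain_op_sum)
qed (fact stability M_ge a_ge subspace_op_sum V_consistent)+

text \<open>The sum of the adjoints, contained in the adjoint of \<open>L\<close>; its domain is the
  one that the density hypothesis speaks of.\<close>

definition adjoint_pairs :: "(('a \<Rightarrow>\<^sub>L 'k) \<times> ('a \<Rightarrow>\<^sub>L 'k)) set" where
  "adjoint_pairs = op_sum (adjoint_op scl C) (adjoint_op scl D)"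

lemma adjoint_pairs_adj:
  assumes "(\<phi>, \<phi>') \<in> adjoint_pairs" "(x, y) \<in> L"
  shows "blinfun_apply \<phi> y = blinfun_apply \<phi>' x"
proof -
  obtain \<psi>1 \<psi>2 where \<psi>: "(\<phi>, \<psi>1) \<in> adjoint_op scl C" "(\<phi>, \<psi>2) \<in> adjoint_op scl D" "\<phi>' = \<psi>1 + \<psi>2"
    using assms(1) unfolding adjoint_pairs_def op_sum_def by blast
  obtain y1 y2 where y: "(x, y1) \<in> C" "(x, y2) \<in> D" "y = y1 + y2"
    using assms(2) unfolding op_sum_def by blast
  have "blinfun_apply \<phi> y1 = blinfun_apply \<psi>1 x" "blinfun_apply \<phi> y2 = blinfun_apply \<psi>2 x"
    using \<psi>(1,2) y(1,2) unfolding adjoint_op_def by blast+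
  then show ?thesis by (simp add: \<psi>(3) y(3) blinfun.add_left blinfun.add_right)
qed

text \<open>Expanding the outer factor of \<open>\<phi> (TC r (TD r x))\<close> at
  \<open>TD r x\<close> leaves the cross term
  \<open>r *\<^sub>R (\<psi>1 (TD r x) - \<psi>1 x)\<close>. It is small because density of the
  common adjoint domain makes \<open>\<psi>1\<close>, which comes from \<open>C\<close>, norm
  continuous along the dual semigroup of \<open>D\<close>.\<close>

lemma adjoint_pairs_expansion:
  assumes "dual_space scl \<subseteq> closure (Domain (adjoint_op scl C) \<inter> Domain (adjoint_op scl D))"
    and "(\<phi>, \<phi>') \<in> adjoint_pairs" "\<epsilon> > 0"
  shows "\<forall>\<^sub>F r in at_right 0. \<forall>x.
    norm (blinfun_apply \<phi> (V r x) - blinfun_apply \<phi> x - r *\<^sub>R blinfun_apply \<phi>' x) \<le> \<epsilon> * r * norm x"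
proof -
  obtain \<psi>1 \<psi>2 where \<psi>: "(\<phi>, \<psi>1) \<in> adjoint_op scl C" "(\<phi>, \<psi>2) \<in> adjoint_op scl D" and \<phi>': "\<phi>' = \<psi>1 + \<psi>2"
    using assms(2) unfolding adjoint_pairs_def op_sum_def by blast
  have adj1: "blinfun_apply \<phi> y = blinfun_apply \<psi>1 x" if "(x, y) \<in> generator TC" for x y
    using that \<psi>(1) unfolding adjoint_op_def generator_TC by blast
  have adj2: "blinfun_apply \<phi> y = blinfun_apply \<psi>2 x" if "(x, y) \<in> generator TD" for x y
    using that \<psi>(2) unfolding adjoint_op_def generator_TD by blast
  have dense': "closure (Domain (generator TC)) = UNIV" "closure (Domain (generator TD)) = UNIV"
    using closure_Domain by (simp_all add: generator_TC generator_TD)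
  have "\<psi>1 \<in> dual_space scl" "\<psi>2 \<in> dual_space scl" using \<psi> by (auto simp: adjoint_op_def)
  then have dual: "\<psi>1 \<in> closure (Domain (adjoint_op scl C))" "\<psi>1 \<in> closure (Domain (adjoint_op scl D))"
      "\<psi>2 \<in> closure (Domain (adjoint_op scl D))"
    using assms(1) closure_mono[of "Domain (adjoint_op scl C) \<inter> Domain (adjoint_op scl D)"] by blast+
  have domC: "Domain (adjoint_op scl C) \<subseteq> TC.adjoint_domain"
    and domD: "Domain (adjoint_op scl D) \<subseteq> TD.adjoint_domain"
    unfolding adjoint_op_def TC.adjoint_domain_def TD.adjoint_domain_def generator_TC generator_TD by auto
  have \<psi>1C: "\<psi>1 \<in> closure TC.adjoint_domain"
    using dual(1) closure_mono[OF domC] by blast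
  have \<psi>1D: "\<psi>1 \<in> closure TD.adjoint_domain"
    and \<psi>2D: "\<psi>2 \<in> closure TD.adjoint_domain"
    using dual(2,3) closure_mono[OF domD] by blast+
  obtain K where K: "K \<ge> 1" "\<And>s x. 0 \<le> s \<Longrightarrow> s \<le> 1 \<Longrightarrow> norm (TD s x) \<le> K * norm x"
    using TD.bounded_on_interval[of 1] by blast
  define \<eta> where "\<eta> = \<epsilon> / (3 * K)"
  have "\<eta> > 0" using K(1) \<open>\<epsilon> > 0\<close> by (simp add: \<eta>_def)
  have "\<epsilon> / 3 > 0" using \<open>\<epsilon> > 0\<close> by simp
  have ev: "\<forall>\<^sub>F r in at_right 0. r \<in> {0<..<(1::real)}" by (rule eventually_at_right_real) simp
  have "\<forall>\<^sub>F r in at_right 0. \<forall>x. norm (\<phi> (TC r x) - \<phi> x - r *\<^sub>R \<psi>1 x) \<le> \<eta> * r * norm x"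
    by (rule TC.adjoint_expansion[OF dense'(1) _ \<psi>1C \<open>\<eta> > 0\<close>]) (rule adj1)
  moreover have "\<forall>\<^sub>F r in at_right 0. \<forall>x. norm (\<phi> (TD r x) - \<phi> x - r *\<^sub>R \<psi>2 x) \<le> \<epsilon> / 3 * r * norm x"
    by (rule TD.adjoint_expansion[OF dense'(2) _ \<psi>2D \<open>\<epsilon> / 3 > 0\<close>]) (rule adj2)
  ultimately show ?thesis
    using TD.adjoint_continuous[OF dense'(2) \<psi>1D \<open>\<epsilon> / 3 > 0\<close>] ev
  proof eventually_elim
    case (elim r)
    show ?case
    proof
      fix x
      let ?u = "TD r x"
      have r: "r > 0" "r < 1" using elim(4) by auto
      have "norm (\<phi> (TC r ?u) - \<phi> ?u - r *\<^sub>R \<psi>1 ?u) \<le> \<eta> * r * norm ?u" using elim(1) by blast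
      also have "\<dots> \<le> \<eta> * r * (K * norm x)" using K(2)[of r x] r \<open>\<eta> > 0\<close> by (intro mult_left_mono) auto
      also have "\<dots> = \<epsilon> / 3 * r * norm x" using K(1) by (simp add: \<eta>_def)
      finally have 1: "norm (\<phi> (TC r ?u) - \<phi> ?u - r *\<^sub>R \<psi>1 ?u) \<le> \<epsilon> / 3 * r * norm x" .
      have 2: "norm (\<phi> ?u - \<phi> x - r *\<^sub>R \<psi>2 x) \<le> \<epsilon> / 3 * r * norm x" using elim(2) by blast
      have "r * norm (\<psi>1 ?u - \<psi>1 x) \<le> r * (\<epsilon> / 3 * norm x)" using elim(3) r by (intro mult_left_mono) auto
      then have 3: "norm (r *\<^sub>R (\<psi>1 ?u - \<psi>1 x)) \<le> \<epsilon> / 3 * r * norm x" using r by (simp add: mult_ac)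
      have eq: "\<phi> (V r x) - \<phi> x - r *\<^sub>R \<phi>' x =
          (\<phi> (TC r ?u) - \<phi> ?u - r *\<^sub>R \<psi>1 ?u) + (\<phi> ?u - \<phi> x - r *\<^sub>R \<psi>2 x) + r *\<^sub>R (\<psi>1 ?u - \<psi>1 x)"
        by (simp add: V_apply \<phi>' blinfun.add_left algebra_simps)
      have "norm (\<phi> (V r x) - \<phi> x - r *\<^sub>R \<phi>' x) \<le> \<epsilon> / 3 * r * norm x + \<epsilon> / 3 * r * norm x + \<epsilon> / 3 * r * norm x"
        unfolding eq by (rule norm_triangle_le[OF add_mono[OF norm_triangle_le[OF add_mono[OF 1 2]] 3]])
      then show "norm (\<phi> (V r x) - \<phi> x - r *\<^sub>R \<phi>' x) \<le> \<epsilon> * r * norm x" by simp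
    qed
  qed
qed

section \<open>Density of the range from either side of the equivalence\<close>

lemma dense_range_if_approximation:
  assumes "t > 0" and "dual_space scl \<subseteq> closure (Domain (adjoint_op scl C) \<inter> Domain (adjoint_op scl D))"
    and A: "approximation_condition scl C D t A" and "\<mu> > a"
  shows "closure ((\<lambda>(x, y). \<mu> *\<^sub>R x - y) ` L) = UNIV"
proof (rule dense_range_if_no_annihilator[OF subspace_op_sum op_sum_scl])
  fix \<psi> assume \<psi>: "\<psi> \<in> dual_space scl" and eig: "\<And>x y. (x, y) \<in> L \<Longrightarrow> blinfun_apply \<psi> y = \<mu> *\<^sub>R blinfun_apply \<psi> x"
  have A': "closure A = UNIV" "A \<subseteq> Domain L"
    and approx: "\<And>f s. f \<in> A \<Longrightarrow> s \<ge> 0 \<Longrightarrow> \<exists>F :: nat \<Rightarrow> 'a. (\<forall>n\<ge>1. F n \<in> Domain L) \<and>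
      (\<lambda>n. norm ((V (t / real n) ^^ nat \<lfloor>real n * s\<rfloor>) f - F n)) \<longlonglongrightarrow> 0 \<and>
      bounded ((\<lambda>n. op_apply L (F n)) ` {1..})"
    using A unfolding approximation_condition_def Domain_op_sum by blast+
  have "Domain adjoint_pairs = Domain (adjoint_op scl C) \<inter> Domain (adjoint_op scl D)"
    unfolding adjoint_pairs_def by (rule Domain_op_sum)
  then have \<psi>': "\<psi> \<in> closure (Domain adjoint_pairs)" using \<psi> assms(2) by auto
  show "\<psi> = 0"
  proof (rule blinfun_eq_0_if_dense[OF A'(1)])
    fix f assume f: "f \<in> A"
    then obtain g where g: "(f, g) \<in> L" using A'(2) by blast
    have "\<exists>F. \<forall>s\<ge>0. (\<forall>n\<ge>1. F s n \<in> Domain L) \<and>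
      (\<lambda>n. norm ((V (t / real n) ^^ nat \<lfloor>real n * s\<rfloor>) f - F s n)) \<longlonglongrightarrow> 0 \<and>
      bounded ((\<lambda>n. op_apply L (F s n)) ` {1..})"
      using approx[OF f] by (intro choice) blast
    then obtain F where F: "\<And>s n. s \<ge> 0 \<Longrightarrow> n \<ge> 1 \<Longrightarrow> F s n \<in> Domain L"
      "\<And>s. s \<ge> 0 \<Longrightarrow> (\<lambda>n. norm ((V (t / real n) ^^ nat \<lfloor>real n * s\<rfloor>) f - F s n)) \<longlonglongrightarrow> 0"
      "\<And>s. s \<ge> 0 \<Longrightarrow> bounded ((\<lambda>n. op_apply L (F s n)) ` {1..})"
      by blast
    have "\<exists>N. \<forall>n\<ge>1. norm (op_apply L (F s n)) \<le> N" if "s \<ge> 0" for s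
      using F(3)[OF that] unfolding bounded_iff by auto
    then obtain N where N: "\<And>s n. s \<ge> 0 \<Longrightarrow> n \<ge> 1 \<Longrightarrow> norm (op_apply L (F s n)) \<le> N s" by metis
    have FL: "(F s n, op_apply L (F s n)) \<in> L" if "s \<ge> 0" "n \<ge> 1" for s n
      using F(1)[OF that] op_sum_apply by fastforce
    show "blinfun_apply \<psi> f = 0"
      by (rule annihilator_vanishes[where F = F and Y = "\<lambda>s n. op_apply L (F s n)" and N = N,
            OF \<open>t > 0\<close> \<open>\<mu> > a\<close> adjoint_pairs_expansion[OF assms(2)] adjoint_pairs_adj \<psi>' eig g FL F(2) N])
  qed
qed

text \<open>An annihilator satisfies
  \<open>\<psi> (T n x) = exp (\<mu> * n) *\<^sub>R \<psi> x\<close>, while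
  \<open>norm (T n x)\<close> grows at most like \<open>\<kappa> ^ n\<close>, so it vanishes for
  \<open>\<mu> > ln \<kappa>\<close>. Integer times suffice for this contradiction.\<close>

lemma dense_range_if_generator:
  assumes T: "c0_semigroup scl T" and gen: "generator T = closure L"
  obtains \<omega> where "\<And>\<mu>. \<mu> > \<omega> \<Longrightarrow> closure ((\<lambda>(x, y). \<mu> *\<^sub>R x - y) ` L) = UNIV"
proof -
  interpret T: operator_semigroup T by (rule c0_semigroup_imp_operator_semigroup[OF T])
  obtain \<kappa> where \<kappa>: "\<kappa> \<ge> 1" "\<And>s x. 0 \<le> s \<Longrightarrow> s \<le> 1 \<Longrightarrow> norm (T s x) \<le> \<kappa> * norm x"
    using T.bounded_on_interval[of 1] by blast
  have T_nat: "norm (T (real n) x) \<le> \<kappa> ^ n * norm x" for n x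
  proof (induction n)
    case (Suc n)
    have "norm (T (real (Suc n)) x) = norm (T 1 (T (real n) x))" using T.add[of 1 "real n" x] by simp
    also have "\<dots> \<le> \<kappa> * norm (T (real n) x)" using \<kappa>(2) by simp
    also have "\<dots> \<le> \<kappa> * (\<kappa> ^ n * norm x)" using \<kappa>(1) Suc by (intro mult_left_mono) auto
    finally show ?case by simp
  qed (simp add: T.zero)
  show ?thesis
  proof (rule that[of "ln \<kappa>"])
    fix \<mu> assume "\<mu> > ln \<kappa>"
    then have "exp \<mu> > \<kappa>" using \<kappa>(1) by (metis exp_less_mono exp_ln less_le_trans zero_less_one)
    show "closure ((\<lambda>(x, y). \<mu> *\<^sub>R x - y) ` L) = UNIV"
    proof (rule dense_range_if_no_annihilator[OF subspace_op_sum op_sum_scl])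
      fix \<psi> assume eig: "\<And>x y. (x, y) \<in> L \<Longrightarrow> blinfun_apply \<psi> y = \<mu> *\<^sub>R blinfun_apply \<psi> x"
      have "closed {u. blinfun_apply \<psi> (snd u) = \<mu> *\<^sub>R blinfun_apply \<psi> (fst u)}"
        by (intro closed_Collect_eq continuous_intros)
      then have sub: "closure L \<subseteq> {u. blinfun_apply \<psi> (snd u) = \<mu> *\<^sub>R blinfun_apply \<psi> (fst u)}"
        using eig by (intro closure_minimal) auto
      show "\<psi> = 0"
      proof (rule blinfun_eq_0_if_dense[OF dense_domain])
        fix x assume "x \<in> Domain L"
        then obtain y where xy: "(x, y) \<in> generator T" using closure_subset[of L] by (auto simp: gen)
        have "norm (\<psi> x) \<le> (\<kappa> / exp \<mu>) ^ n * (norm \<psi> * norm x)" for n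
        proof -
          have "blinfun_apply \<psi> (T (real n) x) = exp (\<mu> * real n) *\<^sub>R blinfun_apply \<psi> x"
          proof (rule T.orbit_eq_exp[OF blinfun.bounded_linear_right xy])
            show "blinfun_apply \<psi> (T s y) = \<mu> *\<^sub>R blinfun_apply \<psi> (T s x)" if "s \<ge> 0" for s
              using T.generator_orbit[OF xy that] sub by (auto simp: gen)
          qed simp
          then have "exp (\<mu> * real n) * norm (\<psi> x) = norm (\<psi> (T (real n) x))" by simp
          also have "\<dots> \<le> norm \<psi> * (\<kappa> ^ n * norm x)"
            by (intro order_trans[OF norm_blinfun mult_left_mono[OF T_nat]]) auto
          finally show ?thesis
            by (simp add: power_divide field_simps flip: exp_of_nat_mult)
        qed
        moreover have "(\<lambda>n. (\<kappa> / exp \<mu>) ^ n * (norm \<psi> * norm x)) \<longlonglongrightarrow> 0 * (norm \<psi> * norm x)"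
          using \<kappa>(1) \<open>exp \<mu> > \<kappa>\<close> by (intro tendsto_intros LIMSEQ_power_zero) simp
        ultimately have "norm (\<psi> x) \<le> 0 * (norm \<psi> * norm x)"
          by (intro tendsto_lowerbound) auto
        then show "\<psi> x = 0" by simp
      qed
    qed
  qed
qed

lemma product_formula:
  assumes "c0_semigroup scl T" "generator T = closure L" "\<sigma> \<ge> 0" "sampling r p \<sigma>"
  shows "(\<lambda>n. (V (r n) ^^ p n) x) \<longlonglongrightarrow> T \<sigma> x"
proof -
  obtain \<omega> where "\<And>\<mu>. \<mu> > \<omega> \<Longrightarrow> closure ((\<lambda>(x, y). \<mu> *\<^sub>R x - y) ` L) = UNIV"
    using dense_range_if_generator[OF assms(1,2)] by blast
  then interpret chernoff_generation V L M a \<omega> by unfold_locales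
  show ?thesis by (rule chernoff_product_formula[OF c0_semigroup_imp_operator_semigroup[OF assms(1)] assms(2-4)])
qed

lemma is_generator_if_dense_range:
  assumes "\<And>\<mu>. \<mu> > \<omega> \<Longrightarrow> closure ((\<lambda>(x, y). \<mu> *\<^sub>R x - y) ` L) = UNIV"
  shows "is_generator scl (closure L)"
proof -
  interpret chernoff_generation V L M a \<omega> by unfold_locales (rule assms)
  have "Vector_Spaces.linear scl scl (W s)" if "s \<ge> 0" for s
    unfolding Vector_Spaces.linear_iff
    using vector_space_axioms W_plus[OF that] W_commute[OF that bounded_linear_scl V_scl] by blast
  then have "c0_semigroup scl W"
    unfolding c0_semigroup_def
    using bounded_linear_W W_zero W_add continuous_on_W by (auto simp: fun_eq_iff)
  then show ?thesis unfolding is_generator_def using generator_W by blast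
qed

text \<open>The graph point of \<open>T (t * s) f\<close> lies in the closure of \<open>L\<close>,
  so it is a limit of points of \<open>L\<close>. Their first coordinates give (a), and convergence
  of the second ones gives (b).\<close>

lemma approximation_if_generator:
  assumes "t > 0" and gen: "is_generator scl (closure L)"
  shows "approximation_condition scl C D t (Domain L)"
  unfolding approximation_condition_def
proof (intro conjI ballI allI impI)
  obtain T where T: "c0_semigroup scl T" "generator T = closure L" using gen by (auto simp: is_generator_def)
  interpret T: operator_semigroup T by (rule c0_semigroup_imp_operator_semigroup[OF T(1)])
  show "module.subspace scl (Domain L)"
    unfolding subspace_def
  proof (intro conjI ballI allI)
    show "0 \<in> Domain L" using real_vector.subspace_0[OF subspace_op_sum] by (auto simp: zero_prod_def)
    show "x + y \<in> Domain L" if "x \<in> Domain L" "y \<in> Domain L" for x y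
      using that real_vector.subspace_add[OF subspace_op_sum] by fastforce
    show "scl c x \<in> Domain L" if "x \<in> Domain L" for c x using that op_sum_scl by blast
  qed
  show "closure (Domain L) = UNIV" by (rule dense_domain)
  show "Domain L \<subseteq> Domain C \<inter> Domain D" by (simp add: Domain_op_sum)
  fix f and s :: real assume "f \<in> Domain L" "s \<ge> 0"
  then obtain g where "(f, g) \<in> generator T" using closure_subset[of L] by (auto simp: T(2))
  have ts: "t * s \<ge> 0" using \<open>t > 0\<close> \<open>s \<ge> 0\<close> by simp
  have "(T (t * s) f, T (t * s) g) \<in> closure L"
    using T.generator_orbit[OF \<open>(f, g) \<in> generator T\<close> ts] by (simp add: T(2))
  then obtain u where u: "\<And>n. u n \<in> L" "u \<longlonglongrightarrow> (T (t * s) f, T (t * s) g)"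
    unfolding closure_sequential by blast
  define F where "F = (\<lambda>n. fst (u n))"
  have F_L: "(F n, snd (u n)) \<in> L" for n using u(1)[of n] by (simp add: F_def)
  have F_lim: "F \<longlonglongrightarrow> T (t * s) f" using tendsto_fst[OF u(2)] by (simp add: F_def)
  have "(\<lambda>n. (V (t / real n) ^^ nat \<lfloor>real n * s\<rfloor>) f) \<longlonglongrightarrow> T (t * s) f"
    by (rule product_formula[OF T ts sampling_floor[OF \<open>t > 0\<close> \<open>s \<ge> 0\<close>]])
  then have "(\<lambda>n. norm ((V (t / real n) ^^ nat \<lfloor>real n * s\<rfloor>) f - F n)) \<longlonglongrightarrow> norm (T (t * s) f - T (t * s) f)"
    by (intro tendsto_intros F_lim)
  then have near: "(\<lambda>n. norm ((V (t / real n) ^^ nat \<lfloor>real n * s\<rfloor>) f - F n)) \<longlonglongrightarrow> 0" by simp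
  have "bounded (range (\<lambda>n. snd (u n)))" using tendsto_snd[OF u(2)] by (intro convergent_imp_bounded)
  moreover have "op_apply L (F n) = snd (u n)" for n by (rule op_sum_apply[OF F_L])
  ultimately have "bounded ((\<lambda>n. op_apply L (F n)) ` {1..})" by (auto intro: bounded_subset)
  then show "\<exists>F :: nat \<Rightarrow> 'a. (\<forall>n\<ge>1. F n \<in> Domain C \<inter> Domain D) \<and>
        (\<lambda>n. norm ((V (t / real n) ^^ nat \<lfloor>real n * s\<rfloor>) f - F n)) \<longlonglongrightarrow> 0 \<and>
        bounded ((\<lambda>n. op_apply L (F n)) ` {1..})"
    using near F_L by (intro exI[of _ F]) (auto simp flip: Domain_op_sum)
qed

end

text \<open>The instance \<open>n = 1\<close>, \<open>s = r\<close> speaks of an arbitrary step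
  length. Replacing \<open>a\<close> by its absolute value weakens the bound and yields the
  nonnegative rate of \<open>chernoff_family\<close>.\<close>

lemma trotter_pairI:
  fixes scl :: "'k::{real_normed_field,euclidean_space} \<Rightarrow> 'a::banach \<Rightarrow> 'a"
  assumes "normed_space_over scl" "is_generator scl C" "is_generator scl D"
    and "closure (Domain C \<inter> Domain D) = UNIV" and "M \<ge> 1"
    and stable: "\<forall>n\<ge>1. \<forall>m :: nat. \<forall>s>0.
      onorm (trotter_step scl C D (s / real n) ^^ m) \<le> M * exp (a * s * (real m / real n))"
  shows "trotter_pair scl C D M \<bar>a\<bar>"
proof (rule trotter_pair.intro[OF assms(1)], rule trotter_pair_axioms.intro)
  fix r :: real and m :: nat and x :: 'a
  assume "r > 0"
  interpret C: operator_semigroup "semigroup_exp scl C"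
    by (rule c0_semigroup_imp_operator_semigroup[OF semigroup_exp(1)[OF assms(2)]])
  interpret D: operator_semigroup "semigroup_exp scl D"
    by (rule c0_semigroup_imp_operator_semigroup[OF semigroup_exp(1)[OF assms(3)]])
  have bl: "bounded_linear (trotter_step scl C D r)"
    using bounded_linear_compose[OF C.bounded_linear D.bounded_linear, of r r] \<open>r > 0\<close>
    by (simp add: trotter_step_def comp_def)
  have "bounded_linear (trotter_step scl C D r ^^ m)"
    by (induction m) (simp_all add: id_def comp_def bounded_linear_compose[OF bl, unfolded comp_def] bounded_linear_ident)
  then have "norm ((trotter_step scl C D r ^^ m) x) \<le> onorm (trotter_step scl C D r ^^ m) * norm x"
    by (rule onorm)
  also have "onorm (trotter_step scl C D r ^^ m) \<le> M * exp (a * r * real m)"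
    using stable[rule_format, of 1 r m] \<open>r > 0\<close> by simp
  also have "\<dots> \<le> M * exp (\<bar>a\<bar> * (r * real m))"
    using \<open>r > 0\<close> \<open>M \<ge> 1\<close> by (intro mult_left_mono) (auto simp: mult.assoc intro!: mult_right_mono)
  finally show "norm ((trotter_step scl C D r ^^ m) x) \<le> M * exp (\<bar>a\<bar> * (r * real m)) * norm x"
    by (simp add: mult_right_mono)
qed (use assms in auto)

theorem corollary5p5:
  fixes scl :: "'k::{real_normed_field,euclidean_space} \<Rightarrow> 'a::banach \<Rightarrow> 'a"
    and C D :: "('a \<times> 'a) set" and t :: real
  assumes "normed_space_over scl"
    and "(reflexive_space scl \<and> separable_space (euclidean :: 'a topology)) \<or> hilbert_space scl"
    and "t > 0"
    and "is_generator scl C" and "is_generator scl D"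
    and "closure (Domain C \<inter> Domain D) = UNIV"
    and "dual_space scl \<subseteq> closure (Domain (adjoint_op scl C) \<inter> Domain (adjoint_op scl D))"
    and "\<exists>a M :: real. M \<ge> 1 \<and>
           (\<forall>n\<ge>1. \<forall>m :: nat. \<forall>s>0.
              onorm (trotter_step scl C D (s / real n) ^^ m) \<le> M * exp (a * s * (real m / real n)))"
  shows "((closable (op_sum C D) \<and> is_generator scl (closure (op_sum C D))) \<longleftrightarrow>
            (\<exists>A. approximation_condition scl C D t A)) \<and>
         ((\<exists>A. approximation_condition scl C D t A) \<longrightarrow>
            (\<forall>f. \<forall>s>0.
               (\<lambda>n. (trotter_step scl C D (s / real n) ^^ n) f)
                 \<longlonglongrightarrow> semigroup_exp scl (closure (op_sum C D)) s f))"
proof -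
  obtain a M :: real where "M \<ge> 1" and stable: "\<forall>n\<ge>1. \<forall>m :: nat. \<forall>s>0.
      onorm (trotter_step scl C D (s / real n) ^^ m) \<le> M * exp (a * s * (real m / real n))"
    using assms(8) by blast
  interpret trotter_pair scl C D M "\<bar>a\<bar>"
    by (rule trotter_pairI[OF assms(1,4,5,6) \<open>M \<ge> 1\<close> stable])
  have gen: "is_generator scl (closure L)" if "approximation_condition scl C D t A" for A
    using is_generator_if_dense_range dense_range_if_approximation[OF assms(3,7) that] by blast
  \<comment> \<open>The limits defining a generator are unique, so a closure that is a generator is
    single valued.\<close>
  have "closable L" if is_gen: "is_generator scl (closure L)"
  proof -
    obtain T where "generator T = closure L" using is_gen unfolding is_generator_def by blast
    then show ?thesis unfolding closable_def using single_valued_generator by metis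
  qed
  moreover have "approximation_condition scl C D t (Domain L)" if "is_generator scl (closure L)"
    using approximation_if_generator[OF assms(3) that] .
  moreover have "(\<lambda>n. (V (s / real n) ^^ n) f) \<longlonglongrightarrow> semigroup_exp scl (closure L) s f"
    if "is_generator scl (closure L)" "s > 0" for f s
    using that by (intro product_formula semigroup_exp sampling_const) auto
  ultimately show ?thesis using gen by blast
qed

end
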